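(* Let $k$ be an infinite field, $S=k[x,y,z,w]$, $f=w(x+y)(x+y+z+w)$, and let $J(f)\subset S$ be the Jacobian ideal of $f$. Put $R=S_{\mathfrak m}$, where $\mathfrak m=(x,y,z,w)$, and $\mathfrak a=J(f)R$. Then: (1) $\mathfrak a$ is a height two unmixed ideal and $R/\mathfrak a^{(n)}$ is Cohen-Macaulay for all $n\ge 1$; (2) the symbolic Rees algebra $\mathcal R_s(\mathfrak a)$ is Noetherian; (3) $\mathfrak a$ is a set-theoretic complete intersection.
   Context: The Jacobian ideal $J(f)$ is the ideal generated by the partial derivatives $f_x,f_y,f_z,f_w$ of $f$. For an ideal $\mathfrak a$ of a Noetherian ring $R$, the $n$-th symbolic power is $\mathfrak a^{(n)}=\bigcap_{\mathfrak p\in \operatorname{Ass}(R/\mathfrak a)}(\mathfrak a^nR_{\mathfrak p}\cap R)$, and the symbolic Rees algebra is $\mathcal R_s(\mathfrak a)=\bigoplus_{n\ge 0}\mathfrak a^{(n)}t^n\subseteq R[t]$. An ideal is unmixed if all its associated primes have the same height. An ideal $\mathfrak a$ of height $h$ in a local ring $(R,\mathfrak m_R)$ is called a set-theoretic complete intersection if there exist $f_1,\ldots,f_h\in\mathfrak m_R$ with $\sqrt{\mathfrak a}=\sqrt{(f_1,\ldots,f_h)}$. *)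

theory Defs
  imports
    "HOL-Algebra.Algebra"
    "HOL-Algebra.Algebraic_Closure_Type"
    "HOL-Library.Poly_Mapping"
    "HOL-Library.Extended_Nat"
begin

section \<open>Localization\<close>

text \<open>The class of the fraction \<open>a / s\<close> in the localization of \<open>R\<close> at a multiplicative set \<open>S\<close>;
  \<open>R\<close> is not assumed to be a domain, hence the extra factor \<open>u\<close>.\<close>

definition loc_frac :: "('a, 'b) ring_scheme \<Rightarrow> 'a set \<Rightarrow> 'a \<Rightarrow> 'a \<Rightarrow> ('a \<times> 'a) set" where
  "loc_frac R S a s =
     {(b, t). b \<in> carrier R \<and> t \<in> S \<and>
        (\<exists>u\<in>S. u \<otimes>\<^bsub>R\<^esub> (t \<otimes>\<^bsub>R\<^esub> a) = u \<otimes>\<^bsub>R\<^esub> (s \<otimes>\<^bsub>R\<^esub> b))}"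

text \<open>The unions below are unions of equal classes, one for each choice of representatives.\<close>

definition localization :: "('a, 'b) ring_scheme \<Rightarrow> 'a set \<Rightarrow> ('a \<times> 'a) set ring" where
  "localization R S =
     \<lparr>carrier = {loc_frac R S a s | a s. a \<in> carrier R \<and> s \<in> S},
      monoid.mult = (\<lambda>P Q. \<Union>(a, s)\<in>P. \<Union>(b, t)\<in>Q. loc_frac R S (a \<otimes>\<^bsub>R\<^esub> b) (s \<otimes>\<^bsub>R\<^esub> t)),
      one = loc_frac R S \<one>\<^bsub>R\<^esub> \<one>\<^bsub>R\<^esub>,
      ring.zero = loc_frac R S \<zero>\<^bsub>R\<^esub> \<one>\<^bsub>R\<^esub>,
      add = (\<lambda>P Q. \<Union>(a, s)\<in>P. \<Union>(b, t)\<in>Q.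
               loc_frac R S (a \<otimes>\<^bsub>R\<^esub> t \<oplus>\<^bsub>R\<^esub> b \<otimes>\<^bsub>R\<^esub> s) (s \<otimes>\<^bsub>R\<^esub> t))\<rparr>"

definition localization_at :: "('a, 'b) ring_scheme \<Rightarrow> 'a set \<Rightarrow> ('a \<times> 'a) set ring" where
  "localization_at R p = localization R (carrier R - p)"

definition to_localization_at :: "('a, 'b) ring_scheme \<Rightarrow> 'a set \<Rightarrow> 'a \<Rightarrow> ('a \<times> 'a) set" where
  "to_localization_at R p a = loc_frac R (carrier R - p) a \<one>\<^bsub>R\<^esub>"

definition extend_to_localization_at ::
    "('a, 'b) ring_scheme \<Rightarrow> 'a set \<Rightarrow> 'a set \<Rightarrow> ('a \<times> 'a) set set" where
  "extend_to_localization_at R p I =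
     Idl\<^bsub>localization_at R p\<^esub> (to_localization_at R p ` I)"

section \<open>Associated primes, symbolic powers, symbolic Rees algebra\<close>

text \<open>The associated primes of the \<open>R\<close>-module \<open>R / I\<close>: the prime ideals that are annihilators
  of elements of \<open>R / I\<close>, where \<open>R\<close> acts through the projection \<open>R \<rightarrow> R / I\<close>.\<close>

definition assoc_primes :: "('a, 'b) ring_scheme \<Rightarrow> 'a set \<Rightarrow> 'a set set" where
  "assoc_primes R I =
     {p. primeideal p R \<and>
         (\<exists>x\<in>carrier (R Quot I).
            p = {r \<in> carrier R. (I +>\<^bsub>R\<^esub> r) \<otimes>\<^bsub>R Quot I\<^esub> x = \<zero>\<^bsub>R Quot I\<^esub>})}"

primrec ideal_power :: "('a, 'b) ring_scheme \<Rightarrow> 'a set \<Rightarrow> nat \<Rightarrow> 'a set" where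
  "ideal_power R I 0 = carrier R"
| "ideal_power R I (Suc n) = I \<cdot>\<^bsub>R\<^esub> ideal_power R I n"

definition symbolic_power :: "('a, 'b) ring_scheme \<Rightarrow> 'a set \<Rightarrow> nat \<Rightarrow> 'a set" where
  "symbolic_power R I n =
     {r \<in> carrier R. \<forall>p\<in>assoc_primes R I.
        to_localization_at R p r \<in> extend_to_localization_at R p (ideal_power R I n)}"

text \<open>\<open>UP R\<close> is the polynomial ring \<open>R[t]\<close>.\<close>

definition symbolic_rees_algebra ::
    "('a, 'b) ring_scheme \<Rightarrow> 'a set \<Rightarrow> ('a, nat \<Rightarrow> 'a) up_ring" where
  "symbolic_rees_algebra R I =
     (UP R)\<lparr>carrier :=
        {P \<in> carrier (UP R). \<forall>n. up_ring.coeff (UP R) P n \<in> symbolic_power R I n}\<rparr>"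

section \<open>Height, dimension, depth\<close>

definition prime_chain :: "('a, 'b) ring_scheme \<Rightarrow> 'a set list \<Rightarrow> bool" where
  "prime_chain R ps \<longleftrightarrow> ps \<noteq> [] \<and> (\<forall>p\<in>set ps. primeideal p R) \<and> sorted_wrt (\<subset>) ps"

definition prime_height :: "('a, 'b) ring_scheme \<Rightarrow> 'a set \<Rightarrow> enat" where
  "prime_height R p = (SUP ps\<in>{ps. prime_chain R ps \<and> last ps = p}. enat (length ps - 1))"

definition ideal_height :: "('a, 'b) ring_scheme \<Rightarrow> 'a set \<Rightarrow> enat" where
  "ideal_height R I = (INF p\<in>{p. primeideal p R \<and> I \<subseteq> p}. prime_height R p)"

definition krull_dim :: "('a, 'b) ring_scheme \<Rightarrow> enat" where
  "krull_dim R = (SUP ps\<in>{ps. prime_chain R ps}. enat (length ps - 1))"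

definition unmixed :: "('a, 'b) ring_scheme \<Rightarrow> 'a set \<Rightarrow> bool" where
  "unmixed R I \<longleftrightarrow>
     (\<forall>p\<in>assoc_primes R I. \<forall>q\<in>assoc_primes R I. prime_height R p = prime_height R q)"

definition is_local_ring :: "('a, 'b) ring_scheme \<Rightarrow> bool" where
  "is_local_ring R \<longleftrightarrow> cring R \<and> (\<exists>!M. maximalideal M R)"

definition the_maximal_ideal :: "('a, 'b) ring_scheme \<Rightarrow> 'a set" where
  "the_maximal_ideal R = (THE M. maximalideal M R)"

text \<open>Each entry is a nonzerodivisor modulo the preceding ones, and the quotient by all of them is nonzero.\<close>

definition regular_sequence :: "('a, 'b) ring_scheme \<Rightarrow> 'a list \<Rightarrow> bool" where
  "regular_sequence R xs \<longleftrightarrow>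
     set xs \<subseteq> carrier R \<and>
     (\<forall>i<length xs. \<forall>a\<in>carrier R.
        xs ! i \<otimes>\<^bsub>R\<^esub> a \<in> Idl\<^bsub>R\<^esub> (set (take i xs)) \<longrightarrow> a \<in> Idl\<^bsub>R\<^esub> (set (take i xs))) \<and>
     Idl\<^bsub>R\<^esub> (set xs) \<noteq> carrier R"

definition local_depth :: "('a, 'b) ring_scheme \<Rightarrow> enat" where
  "local_depth R =
     (SUP xs\<in>{xs. regular_sequence R xs \<and> set xs \<subseteq> the_maximal_ideal R}. enat (length xs))"

definition cohen_macaulay_local :: "('a, 'b) ring_scheme \<Rightarrow> bool" where
  "cohen_macaulay_local R \<longleftrightarrow>
     is_local_ring R \<and> noetherian_ring R \<and> local_depth R = krull_dim R"

section \<open>Set-theoretic complete intersections\<close>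

definition ideal_radical :: "('a, 'b) ring_scheme \<Rightarrow> 'a set \<Rightarrow> 'a set" where
  "ideal_radical R I = {r \<in> carrier R. \<exists>n::nat. r [^]\<^bsub>R\<^esub> n \<in> I}"

definition set_theoretic_complete_intersection :: "('a, 'b) ring_scheme \<Rightarrow> 'a set \<Rightarrow> bool" where
  "set_theoretic_complete_intersection R I \<longleftrightarrow>
     is_local_ring R \<and> ideal I R \<and>
     (\<exists>fs. set fs \<subseteq> the_maximal_ideal R \<and> enat (length fs) = ideal_height R I \<and>
           ideal_radical R I = ideal_radical R (Idl\<^bsub>R\<^esub> (set fs)))"

section \<open>The polynomial ring in four variables\<close>

datatype var = VX | VY | VZ | VW

type_synonym 'k poly4 = "(var \<Rightarrow>\<^sub>0 nat) \<Rightarrow>\<^sub>0 'k"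

definition Var :: "var \<Rightarrow> 'k::comm_ring_1 poly4" where
  "Var v = Poly_Mapping.single (Poly_Mapping.single v 1) 1"

text \<open>The partial derivative with respect to \<open>v\<close>. Subtraction of exponents is truncated, but it is
  only relevant for monomials in which \<open>v\<close> occurs, as the coefficient vanishes otherwise.\<close>

definition partial_deriv :: "var \<Rightarrow> 'k::comm_ring_1 poly4 \<Rightarrow> 'k poly4" where
  "partial_deriv v p =
     (\<Sum>m\<in>Poly_Mapping.keys p.
        Poly_Mapping.single (m - Poly_Mapping.single v 1)
          (of_nat (Poly_Mapping.lookup m v) * Poly_Mapping.lookup p m))"

definition jacobian_ideal :: "'k::comm_ring_1 poly4 \<Rightarrow> 'k poly4 set" where
  "jacobian_ideal f = Idl\<^bsub>ring_of_type_algebra\<^esub> (range (\<lambda>v. partial_deriv v f))"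

end

theory Submission
  imports Defs
begin

text \<open>
  Put \<open>u = w\<close>, \<open>v = x + y\<close> and \<open>c = x + y + z + w\<close>; together with \<open>y\<close> these are linear coordinates of the
  polynomial ring, and \<open>f = u v c\<close>. The partial derivatives of \<open>f\<close> are \<open>u c + u v\<close> (twice), \<open>u v\<close> and
  \<open>v c + u v\<close>, so in every characteristic the Jacobian ideal is the monomial ideal
  \<open>(u v, u c, v c) = (u, v) \<inter> (u, c) \<inter> (v, c)\<close>. The theorem is therefore a statement about monomials.

  Let \<open>A\<close> be a set of coordinates. The polynomials all of whose monomials have degree at least \<open>n\<close> in the
  coordinates from \<open>A\<close> form the \<open>n\<close>-th power of the ideal \<open>(A)\<close>. If \<open>s r\<close> lies in this power and \<open>s\<close> does
  not lie in \<open>(A)\<close>, then \<open>r\<close> lies in it (\<open>weight_ideal_cancel\<close>), and this remains true in the local ring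
  (\<open>wideal_cancel\<close>). Hence every \<open>(A)\<close> is prime, the associated primes of \<open>\<aa>\<close> are \<open>(u, v)\<close>, \<open>(u, c)\<close> and
  \<open>(v, c)\<close>, and \<open>\<aa>\<^sup>(\<^sup>n\<^sup>)\<close> is the intersection of their \<open>n\<close>-th powers (\<open>symbolic_power_\<aa>\<close>).

  All bounds on heights and dimensions come from one fact: a chain of primes of the local ring has at most
  five members (\<open>prime_chain_length\<close>). Indeed, elements \<open>x\<^sub>i\<close> of \<open>P\<^sub>i\<^sub>+\<^sub>1\<close> outside \<open>P\<^sub>i\<close> are algebraically
  independent modulo \<open>P\<^sub>0\<close>, whereas a count of monomials shows that five polynomials in four variables
  are dependent. Continuing a chain that ends in \<open>(u, v)\<close> by \<open>(u, v, c)\<close> and the maximal ideal gives height at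
  most two; putting \<open>0\<close> and \<open>(u)\<close> in front of a chain of primes over \<open>\<aa>\<^sup>(\<^sup>n\<^sup>)\<close> bounds the dimension of the
  residue ring by two. That ring has the regular sequence \<open>y, u + v + c\<close>. As the depth never exceeds the
  dimension (\<open>local_depth_le_krull_dim\<close>), it is Cohen-Macaulay.

  A monomial in \<open>\<aa>\<^sup>(\<^sup>n\<^sup>)\<close> is a multiple of a product of factors \<open>u v\<close>, \<open>u c\<close>, \<open>v c\<close>, counted once, and
  \<open>u v c\<close>, counted twice, with total count \<open>n\<close> (\<open>symbolic_monomials_generated\<close>). So the symbolic Rees algebra
  is generated over the local ring by \<open>u v t\<close>, \<open>u c t\<close>, \<open>v c t\<close> and \<open>u v c t\<^sup>2\<close>, and it is Noetherian by
  Hilbert's basis theorem (\<open>adjoin_noetherian\<close>). Finally \<open>\<aa>\<^sup>2\<close> lies in the ideal generated by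
  \<open>u v + u c + v c\<close> and \<open>u v c\<close>, which lies in \<open>\<aa>\<close>, so the two ideals have the same radical.
\<close>

section \<open>Ideals and primes in commutative rings\<close>

lemma ideal_closed:
  assumes "ideal I R"
  shows ideal_zero: "\<zero>\<^bsub>R\<^esub> \<in> I" and ideal_add: "a \<in> I \<Longrightarrow> b \<in> I \<Longrightarrow> a \<oplus>\<^bsub>R\<^esub> b \<in> I"
  using additive_subgroup.zero_closed[OF ideal.axioms(1)[OF assms]]
    additive_subgroup.a_closed[OF ideal.axioms(1)[OF assms]] by auto

lemma (in cring) ideal_cringI:
  assumes "I \<subseteq> carrier R" "\<zero> \<in> I"
    and add: "\<And>a b. a \<in> I \<Longrightarrow> b \<in> I \<Longrightarrow> a \<oplus> b \<in> I"
    and mult: "\<And>r a. r \<in> carrier R \<Longrightarrow> a \<in> I \<Longrightarrow> r \<otimes> a \<in> I"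
  shows "ideal I R"
proof (rule idealI)
  have neg: "\<ominus> a \<in> I" if "a \<in> I" for a
  proof -
    have "\<ominus> a = (\<ominus> \<one>) \<otimes> a" using that assms(1) by (auto simp: l_minus)
    then show ?thesis using mult[of "\<ominus> \<one>" a] that by auto
  qed
  show "subgroup I (add_monoid R)"
    by (rule add.subgroupI) (use assms neg in \<open>auto simp flip: a_inv_def\<close>)
  show "a \<otimes> x \<in> I" if "a \<in> I" "x \<in> carrier R" for a x
    using mult[OF that(2,1)] m_comm[of x a] that assms(1) by auto
qed (use mult ring_axioms in auto)

lemma (in ideal) sum_mem_cancel:
  assumes "a \<in> I" "b \<in> carrier R" "a \<oplus> b \<in> I"
  shows "b \<in> I"
proof -
  have "b = \<ominus> a \<oplus> (a \<oplus> b)"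
    using assms Icarr r_neg1 by auto
  moreover have "\<ominus> a \<oplus> (a \<oplus> b) \<in> I" using assms(1,3) a_closed a_inv_closed by blast
  ultimately show ?thesis by metis
qed

lemma (in cring) unit_mult_mem_ideal:
  assumes "ideal I R" "u \<in> Units R" "b \<in> carrier R" "u \<otimes> b \<in> I"
  shows "b \<in> I"
proof -
  have "inv u \<otimes> (u \<otimes> b) = b" using assms(2,3) by (simp add: m_assoc[symmetric] Units_closed)
  then show ?thesis using ideal.I_l_closed[OF assms(1,4), of "inv u"] assms(2) by auto
qed

text \<open>A maximal element among the ideals that contain \<open>I\<close> and miss \<open>T\<close> is prime: for \<open>a\<close> and \<open>b\<close> outside
  \<open>M\<close> both \<open>M + (a)\<close> and \<open>M + (b)\<close> meet \<open>T\<close>, hence so does \<open>M + (a b)\<close>.\<close>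

lemma (in noetherian_ring) exists_prime_disjoint:
  assumes "cring R" and I: "ideal I R"
    and T: "T \<subseteq> carrier R" "T \<noteq> {}" "\<And>a b. a \<in> T \<Longrightarrow> b \<in> T \<Longrightarrow> a \<otimes> b \<in> T"
    and disj: "I \<inter> T = {}"
  shows "\<exists>P. primeideal P R \<and> I \<subseteq> P \<and> P \<inter> T = {}"
proof -
  interpret cring R by fact
  define F where "F = {J. ideal J R \<and> I \<subseteq> J \<and> J \<inter> T = {}}"
  have "\<exists>M\<in>F. \<forall>G\<in>F. M \<subseteq> G \<longrightarrow> G = M"
  proof (rule subset_Zorn_nonempty)
    show "F \<noteq> {}" using I disj by (auto simp: F_def)
    fix C assume C: "C \<noteq> {}" "subset.chain F C"
    then have "subset.chain {I. ideal I R} C"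
      by (auto simp: pred_on.chain_def F_def)
    from ideal_chain_is_trivial[OF C(1) this] C(2) show "\<Union>C \<in> F"
      by (auto simp: pred_on.chain_def)
  qed
  then obtain M where MF: "M \<in> F" and maxF: "\<forall>G\<in>F. M \<subseteq> G \<longrightarrow> G = M" by blast
  have M: "ideal M R" "I \<subseteq> M" "M \<inter> T = {}" using MF by (auto simp: F_def)
  have max: "G = M" if "ideal G R" "M \<subseteq> G" "G \<inter> T = {}" for G
    using maxF that M(2) unfolding F_def by blast
  interpret M: ideal M R by fact
  have hit: "\<exists>m\<in>M. \<exists>r\<in>carrier R. m \<oplus> r \<otimes> a \<in> T" if a: "a \<in> carrier R" "a \<notin> M" for a
  proof (rule ccontr)
    assume no: "\<not> ?thesis"
    have J: "ideal (M <+>\<^bsub>R\<^esub> PIdl a) R"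
      by (rule add_ideals[OF M(1) cgenideal_ideal[OF a(1)]])
    have mem: "m \<oplus> r \<otimes> a \<in> M <+>\<^bsub>R\<^esub> PIdl a" if "m \<in> M" "r \<in> carrier R" for m r
      unfolding set_add_def' cgenideal_def using that by blast
    have "m \<in> (M <+>\<^bsub>R\<^esub> PIdl a)" if "m \<in> M" for m
      using mem[OF that zero_closed] that a M.Icarr by simp
    then have "M \<subseteq> M <+>\<^bsub>R\<^esub> PIdl a" by blast
    moreover have "(M <+>\<^bsub>R\<^esub> PIdl a) \<inter> T = {}"
    proof -
      have "t \<notin> T" if "t \<in> M <+>\<^bsub>R\<^esub> PIdl a" for t
        using that no unfolding set_add_def' cgenideal_def by blast
      then show ?thesis by blast
    qed
    ultimately have "M <+>\<^bsub>R\<^esub> PIdl a = M" using max[OF J] by blast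
    moreover have "\<zero> \<oplus> \<one> \<otimes> a \<in> M <+>\<^bsub>R\<^esub> PIdl a" by (rule mem[OF M.zero_closed one_closed])
    ultimately show False using a by simp
  qed
  have "primeideal M R"
  proof (rule primeidealI[OF M(1) \<open>cring R\<close>])
    show "carrier R \<noteq> M" using M(3) T by auto
    fix a b assume ab: "a \<in> carrier R" "b \<in> carrier R" "a \<otimes> b \<in> M"
    show "a \<in> M \<or> b \<in> M"
    proof (rule ccontr)
      assume "\<not> ?thesis"
      then obtain m r n s where *: "m \<in> M" "r \<in> carrier R" "m \<oplus> r \<otimes> a \<in> T"
        "n \<in> M" "s \<in> carrier R" "n \<oplus> s \<otimes> b \<in> T"
        using hit[OF ab(1)] hit[OF ab(2)] by metis
      have "(m \<oplus> r \<otimes> a) \<otimes> (n \<oplus> s \<otimes> b)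
        = (n \<oplus> s \<otimes> b) \<otimes> m \<oplus> ((r \<otimes> a) \<otimes> n \<oplus> (r \<otimes> s) \<otimes> (a \<otimes> b))"
        using * ab M.Icarr by algebra
      also have "\<dots> \<in> M"
        using * ab M.Icarr
        by (intro ideal_add[OF M(1)])
          (rule M.I_l_closed; simp)+
      finally show False using T(3)[of "m \<oplus> r \<otimes> a" "n \<oplus> s \<otimes> b"] * M(3) by blast
    qed
  qed
  then show ?thesis using M by blast
qed

text \<open>The multiplicative set of all \<open>s x\<^sup>n\<close> with \<open>s \<notin> P\<close> misses \<open>I\<close>, because powers of \<open>x\<close> can be
  cancelled modulo \<open>I\<close>. A prime that contains \<open>I\<close> and misses this set lies below \<open>P\<close> and does not
  contain \<open>x\<close>.\<close>

lemma (in noetherian_ring) exists_smaller_prime: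
  assumes "cring R" and I: "ideal I R" and P: "primeideal P R" and "I \<subseteq> P" and x: "x \<in> P"
    and reg: "\<And>a. a \<in> carrier R \<Longrightarrow> x \<otimes> a \<in> I \<Longrightarrow> a \<in> I"
  shows "\<exists>Q. primeideal Q R \<and> I \<subseteq> Q \<and> Q \<subset> P"
proof -
  interpret cring R by fact
  interpret P: primeideal P R by fact
  have xc: "x \<in> carrier R" using x P.Icarr by blast
  define T where "T = {s \<otimes> x [^] (n::nat) | s n. s \<in> carrier R - P}"
  have one: "\<one> \<notin> P" using P.one_imp_carrier P.I_notcarr by blast
  have cancel: "x [^] (n::nat) \<otimes> s \<in> I \<Longrightarrow> s \<in> I" if "s \<in> carrier R" for n s
  proof (induction n)
    case (Suc n)
    have "x [^] Suc n \<otimes> s = x \<otimes> (x [^] n \<otimes> s)"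
      using xc that by (simp add: m_ac)
    then show ?case using reg[of "x [^] n \<otimes> s"] Suc xc that by simp
  qed (use that in simp)
  have "\<exists>Q. primeideal Q R \<and> I \<subseteq> Q \<and> Q \<inter> T = {}"
  proof (rule exists_prime_disjoint[OF \<open>cring R\<close> I])
    show "T \<subseteq> carrier R" "T \<noteq> {}" using xc one by (auto simp: T_def)
    show "I \<inter> T = {}"
      using cancel \<open>I \<subseteq> P\<close> xc by (auto simp: T_def m_comm)
    fix a b assume "a \<in> T" "b \<in> T"
    then obtain s t n m where st: "s \<in> carrier R - P" "t \<in> carrier R - P"
      "a = s \<otimes> x [^] (n::nat)" "b = t \<otimes> x [^] (m::nat)" unfolding T_def by blast
    have "a \<otimes> b = (s \<otimes> t) \<otimes> (x [^] n \<otimes> x [^] m)"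
      using st xc by (simp add: m_ac)
    also have "x [^] n \<otimes> x [^] m = x [^] (n + m)"
      using xc by (simp add: nat_pow_mult)
    finally show "a \<otimes> b \<in> T"
      unfolding T_def using st P.I_prime[of s t] by blast
  qed
  then obtain Q where Q: "primeideal Q R" "I \<subseteq> Q" "Q \<inter> T = {}" by blast
  interpret Q: primeideal Q R by fact
  have "q \<in> P" if "q \<in> Q" for q
  proof (rule ccontr)
    assume "q \<notin> P"
    then have "q \<otimes> x [^] (0::nat) \<in> T" unfolding T_def using that Q.Icarr by blast
    then show False using that Q(3) Q.Icarr by auto
  qed
  moreover have "x \<notin> Q"
  proof -
    have "\<one> \<otimes> x [^] (1::nat) \<in> T" unfolding T_def using one by blast
    then show ?thesis using xc Q(3) by auto
  qed
  ultimately show ?thesis using Q x by blast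
qed

lemma (in cring) primeideal_not_one: "primeideal P R \<Longrightarrow> \<one> \<notin> P"
  using ideal.one_imp_carrier primeideal.I_notcarr primeideal.axioms(1) by fastforce

text \<open>Each entry \<open>x\<close> of the sequence is regular modulo its predecessors, so below a prime that contains
  \<open>x\<close> and its predecessors there is a smaller one that contains the predecessors.\<close>

lemma (in noetherian_ring) regular_sequence_prime_chain:
  assumes "cring R" and reg: "regular_sequence R xs" and "k \<le> length xs"
    and "primeideal P R" "Idl (set (take k xs)) \<subseteq> P"
  shows "\<exists>ps. prime_chain R ps \<and> last ps = P \<and> length ps = Suc k"
  using assms(3-5)
proof (induction k arbitrary: P)
  case 0
  then have "prime_chain R [P]" by (auto simp: prime_chain_def)
  then show ?case by (intro exI[of _ "[P]"]) auto
next
  case (Suc k)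
  interpret cring R by fact
  from reg have xs: "set xs \<subseteq> carrier R" by (auto simp: regular_sequence_def)
  have tk: "set (take i xs) \<subseteq> carrier R" for i using xs by (meson set_take_subset subset_trans)
  have t: "set (take (Suc k) xs) = insert (xs ! k) (set (take k xs))"
    using Suc by (simp add: take_Suc_conv_app_nth)
  have "set (take (Suc k) xs) \<subseteq> P"
    using genideal_self[OF tk] Suc.prems(3) by blast
  then have mem: "xs ! k \<in> P" and sub: "set (take k xs) \<subseteq> P" using t by auto
  have "\<exists>Q. primeideal Q R \<and> Idl (set (take k xs)) \<subseteq> Q \<and> Q \<subset> P"
  proof (rule exists_smaller_prime[OF \<open>cring R\<close> genideal_ideal[OF tk] Suc.prems(2) _ mem])
    show "Idl (set (take k xs)) \<subseteq> P"
      using genideal_minimal sub Suc.prems(2) primeideal.axioms(1) by blast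
    show "a \<in> carrier R \<Longrightarrow> xs ! k \<otimes> a \<in> Idl (set (take k xs)) \<Longrightarrow> a \<in> Idl (set (take k xs))" for a
      using reg Suc.prems(1) by (auto simp: regular_sequence_def)
  qed
  then obtain Q where Q: "primeideal Q R" "Idl (set (take k xs)) \<subseteq> Q" "Q \<subset> P" by blast
  from Suc.IH[OF _ Q(1,2)] Suc.prems(1) obtain ps
    where ps: "prime_chain R ps" "last ps = Q" "length ps = Suc k" by auto
  have "p \<subset> P" if "p \<in> set ps" for p
  proof -
    have "ps = butlast ps @ [Q]" using ps append_butlast_last_id[of ps] by (auto simp: prime_chain_def)
    then have "p = Q \<or> p \<subset> Q" using ps(1) that unfolding prime_chain_def
      by (metis Un_iff empty_iff empty_set list.set_intros(1) set_ConsD set_append sorted_wrt_append)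
    then show ?thesis using Q by blast
  qed
  then have "prime_chain R (ps @ [P])"
    using ps Suc.prems(2) by (auto simp: prime_chain_def sorted_wrt_append)
  then show ?case using ps by (intro exI[of _ "ps @ [P]"]) auto
qed

lemma local_depth_le_krull_dim:
  assumes "cring R" "noetherian_ring R"
  shows "local_depth R \<le> krull_dim R"
  unfolding local_depth_def
proof (rule SUP_least, clarify)
  fix xs assume reg: "regular_sequence R xs"
  interpret cring R by fact
  interpret noetherian_ring R by fact
  have xs: "set xs \<subseteq> carrier R" "Idl\<^bsub>R\<^esub> (set xs) \<noteq> carrier R" using reg by (auto simp: regular_sequence_def)
  have "Idl\<^bsub>R\<^esub> (set xs) \<inter> {\<one>\<^bsub>R\<^esub>} = {}"
    using ideal.one_imp_carrier[OF genideal_ideal[OF xs(1)]] xs(2) by auto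
  then obtain P where P: "primeideal P R" "Idl\<^bsub>R\<^esub> (set xs) \<subseteq> P"
    using exists_prime_disjoint[OF \<open>cring R\<close> genideal_ideal[OF xs(1)], of "{\<one>\<^bsub>R\<^esub>}"] by auto
  with regular_sequence_prime_chain[OF \<open>cring R\<close> reg, of "length xs" P]
  obtain ps where ps: "prime_chain R ps" "length ps = Suc (length xs)" by auto
  then have "enat (length xs) = enat (length ps - 1)" by simp
  also have "\<dots> \<le> krull_dim R" unfolding krull_dim_def using ps by (intro SUP_upper) auto
  finally show "enat (length xs) \<le> krull_dim R" .
qed

section \<open>Noetherian rings\<close>

text \<open>Every ideal of \<open>B\<close> is generated by the image of its preimage, since elements of \<open>B\<close> are images up
  to units. This covers quotients and localizations alike.\<close>

lemma noetherian_ring_fractions: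
  assumes "ring_hom_ring A B h" "noetherian_ring A" "cring B"
    and frac: "\<And>b. b \<in> carrier B \<Longrightarrow>
      \<exists>a\<in>carrier A. \<exists>s\<in>carrier A. h s \<in> Units B \<and> h s \<otimes>\<^bsub>B\<^esub> b = h a"
  shows "noetherian_ring B"
proof -
  interpret A: noetherian_ring A by fact
  interpret B: cring B by fact
  interpret h: ring_hom_ring A B h by fact
  show ?thesis
  proof (rule B.noetherian_ringI)
    fix J assume J: "ideal J B"
    interpret J: ideal J B by fact
    have I: "ideal {a \<in> carrier A. h a \<in> J} A" by (rule h.ideal_vimage[OF J])
    obtain G where G: "G \<subseteq> carrier A" "finite G" "{a \<in> carrier A. h a \<in> J} = Idl\<^bsub>A\<^esub> G"
      using A.finetely_gen[OF I] by blast
    have hX: "h ` G \<subseteq> carrier B" using G by auto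
    have GJ: "h ` G \<subseteq> J" using G A.genideal_self[OF G(1)] by auto
    have "J = Idl\<^bsub>B\<^esub> (h ` G)"
    proof
      show "Idl\<^bsub>B\<^esub> (h ` G) \<subseteq> J" by (rule B.genideal_minimal[OF J GJ])
      show "J \<subseteq> Idl\<^bsub>B\<^esub> (h ` G)"
      proof
        fix b assume b: "b \<in> J"
        then have bc: "b \<in> carrier B" using J.Icarr by blast
        then obtain a s where as: "a \<in> carrier A" "s \<in> carrier A" "h s \<in> Units B" "h s \<otimes>\<^bsub>B\<^esub> b = h a"
          using frac by blast
        have "h a \<in> J" using as b J.I_l_closed[of b "h s"] by simp
        then have "a \<in> Idl\<^bsub>A\<^esub> G" using G(3) as by blast
        moreover have "Idl\<^bsub>A\<^esub> G \<subseteq> {a \<in> carrier A. h a \<in> Idl\<^bsub>B\<^esub> (h ` G)}"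
          using G B.genideal_self[OF hX]
          by (intro A.genideal_minimal h.ideal_vimage B.genideal_ideal[OF hX]) auto
        ultimately have "h s \<otimes>\<^bsub>B\<^esub> b \<in> Idl\<^bsub>B\<^esub> (h ` G)" using as by auto
        then show "b \<in> Idl\<^bsub>B\<^esub> (h ` G)"
          by (rule B.unit_mult_mem_ideal[OF B.genideal_ideal[OF hX] as(3) bc])
      qed
    qed
    then show "\<exists>A\<subseteq>carrier B. finite A \<and> J = Idl\<^bsub>B\<^esub> A"
      using hX G(2) by blast
  qed
qed

text \<open>The values at \<open>x\<close> of the polynomials over \<open>A\<close> of degree less than the given number, recursively by
  splitting off the leading term.\<close>

primrec poly_exprs :: "('a, 'b) ring_scheme \<Rightarrow> 'a set \<Rightarrow> 'a \<Rightarrow> nat \<Rightarrow> 'a set" where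
  "poly_exprs R A x 0 = {\<zero>\<^bsub>R\<^esub>}"
| "poly_exprs R A x (Suc d) = {a \<otimes>\<^bsub>R\<^esub> x [^]\<^bsub>R\<^esub> d \<oplus>\<^bsub>R\<^esub> q | a q. a \<in> A \<and> q \<in> poly_exprs R A x d}"

text \<open>An element of \<open>J\<close> may have several expressions and so contribute several leading coefficients, even in
  the same degree.\<close>

definition lead_coeffs :: "('a, 'b) ring_scheme \<Rightarrow> 'a set \<Rightarrow> 'a \<Rightarrow> 'a set \<Rightarrow> nat \<Rightarrow> 'a set" where
  "lead_coeffs R A x J d =
    {a \<in> A. \<exists>q\<in>poly_exprs R A x d. a \<otimes>\<^bsub>R\<^esub> x [^]\<^bsub>R\<^esub> d \<oplus>\<^bsub>R\<^esub> q \<in> J}"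

locale adjunction = cring R for R (structure) +
  fixes A x
  assumes A: "subring A R" and x: "x \<in> carrier R"
begin

abbreviation (input) "exprs \<equiv> poly_exprs R A x"

lemma Ac: "a \<in> A \<Longrightarrow> a \<in> carrier R" using subringE(1)[OF A] by blast

lemma exprs_carrier: "p \<in> exprs d \<Longrightarrow> p \<in> carrier R"
  by (induction d arbitrary: p) (use x Ac in auto)

lemma exprs_zero: "\<zero> \<in> exprs d"
proof (induction d)
  case (Suc d)
  have "\<zero> = \<zero> \<otimes> x [^] d \<oplus> \<zero>" using x by simp
  then show ?case using Suc subringE(2)[OF A] by force
qed simp

lemma exprs_Suc: "p \<in> exprs d \<Longrightarrow> p \<in> exprs (Suc d)"
proof -
  assume p: "p \<in> exprs d"
  have "p = \<zero> \<otimes> x [^] d \<oplus> p" using x exprs_carrier[OF p] by simp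
  then show ?thesis using p subringE(2)[OF A] by force
qed

lemma exprs_mono: "p \<in> exprs d \<Longrightarrow> d \<le> e \<Longrightarrow> p \<in> exprs e"
  by (induction e) (use exprs_Suc in \<open>auto simp: le_Suc_eq simp del: poly_exprs.simps(2)\<close>)

lemma exprs_add:
  "p \<in> exprs d \<Longrightarrow> q \<in> exprs d \<Longrightarrow> p \<oplus> q \<in> exprs d"
proof (induction d arbitrary: p q)
  case (Suc d)
  then obtain a p' b q' where *: "a \<in> A" "b \<in> A" "p' \<in> exprs d" "q' \<in> exprs d"
    "p = a \<otimes> x [^] d \<oplus> p'" "q = b \<otimes> x [^] d \<oplus> q'" by auto
  have "p \<oplus> q = (a \<oplus> b) \<otimes> x [^] d \<oplus> (p' \<oplus> q')"
    using * x Ac exprs_carrier nat_pow_closed[of x d]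
    by (simp add: l_distr a_ac)
  then show ?case using Suc.IH[of p' q'] * subringE(7)[OF A] by auto
qed simp

lemma exprs_smult:
  "c \<in> A \<Longrightarrow> p \<in> exprs d \<Longrightarrow> c \<otimes> p \<in> exprs d"
proof (induction d arbitrary: p)
  case (Suc d)
  then obtain a p' where *: "a \<in> A" "p' \<in> exprs d" "p = a \<otimes> x [^] d \<oplus> p'" by auto
  have "c \<otimes> p = (c \<otimes> a) \<otimes> x [^] d \<oplus> c \<otimes> p'"
    using * x Ac exprs_carrier Suc.prems
    by (simp add: r_distr m_assoc)
  moreover have "c \<otimes> a \<in> A" "c \<otimes> p' \<in> exprs d"
    using Suc * subringE(6)[OF A] by blast+
  ultimately show ?case unfolding poly_exprs.simps by blast
qed (use Ac in simp)

lemma exprs_uminus: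
  assumes "p \<in> exprs d" shows "\<ominus> p \<in> exprs d"
proof -
  have "\<ominus> p = (\<ominus> \<one>) \<otimes> p" using exprs_carrier[OF assms] by (simp add: l_minus)
  then show ?thesis using exprs_smult[OF _ assms, of "\<ominus> \<one>"] subringE(3,5)[OF A] by auto
qed

lemma exprs_shift: "p \<in> exprs d \<Longrightarrow> x \<otimes> p \<in> exprs (Suc d)"
proof (induction d arbitrary: p)
  case 0
  then show ?case using x exprs_zero[of "Suc 0"] by simp
next
  case (Suc d)
  then obtain a p' where *: "a \<in> A" "p' \<in> exprs d" "p = a \<otimes> x [^] d \<oplus> p'" by auto
  have "x \<otimes> p = a \<otimes> x [^] Suc d \<oplus> x \<otimes> p'"
    using * x Ac exprs_carrier by (simp add: r_distr m_ac)
  then show ?case using Suc.IH[OF *(2)] * poly_exprs.simps(2)[of R A x "Suc d"] by blast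
qed

lemma exprs_pow_shift:
  "p \<in> exprs d \<Longrightarrow> x [^] (e::nat) \<otimes> p \<in> exprs (d + e)"
proof (induction e)
  case 0
  then show ?case using exprs_carrier by simp
next
  case (Suc e)
  have "x [^] Suc e \<otimes> p = x \<otimes> (x [^] e \<otimes> p)"
    using x exprs_carrier[OF Suc.prems] by (simp add: m_ac)
  then show ?case using exprs_shift[OF Suc.IH[OF Suc.prems]] by (metis add_Suc_right)
qed

lemma exprs_mult:
  "p \<in> exprs d \<Longrightarrow> q \<in> exprs e \<Longrightarrow> p \<otimes> q \<in> exprs (e + d)"
proof (induction d arbitrary: p)
  case 0
  then show ?case using exprs_zero exprs_carrier by simp
next
  case (Suc d)
  then obtain a p' where *: "a \<in> A" "p' \<in> exprs d" "p = a \<otimes> x [^] d \<oplus> p'" by auto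
  have "p \<otimes> q = a \<otimes> (x [^] d \<otimes> q) \<oplus> p' \<otimes> q"
    using * x Ac exprs_carrier Suc.prems by (simp add: l_distr m_assoc)
  moreover have "\<dots> \<in> exprs (e + d)"
    by (rule exprs_add[OF exprs_smult[OF *(1) exprs_pow_shift[OF Suc.prems(2)]] Suc.IH[OF *(2) Suc.prems(2)]])
  ultimately show ?case using exprs_mono[of "p \<otimes> q" "e + d" "e + Suc d"] by simp
qed

definition adjoin where "adjoin = (\<Union>d. exprs d)"

abbreviation (input) "adjoin_ring \<equiv> R\<lparr>carrier := adjoin\<rparr>"

lemma adjoin_base: "a \<in> A \<Longrightarrow> a \<in> adjoin"
proof -
  assume a: "a \<in> A"
  have "a = a \<otimes> x [^] (0::nat) \<oplus> \<zero>" using a Ac by simp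
  then have "a \<in> exprs (Suc 0)" using a by auto
  then show ?thesis unfolding adjoin_def by blast
qed

lemma adjoin_gen: "x \<in> adjoin"
proof -
  have "x = \<one> \<otimes> x [^] Suc 0 \<oplus> \<zero>" using x by simp
  then have "x \<in> exprs (Suc (Suc 0))"
    using subringE(3)[OF A] exprs_zero[of "Suc 0"] poly_exprs.simps(2)[of R A x "Suc 0"] by blast
  then show ?thesis unfolding adjoin_def by blast
qed

lemma adjoin_subring: "subring adjoin R"
proof (rule subringI)
  show "adjoin \<subseteq> carrier R" using exprs_carrier by (auto simp: adjoin_def)
  show "\<one> \<in> adjoin" using adjoin_base subringE(3)[OF A] by blast
  show "\<And>h. h \<in> adjoin \<Longrightarrow> \<ominus> h \<in> adjoin" using exprs_uminus by (auto simp: adjoin_def)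
  show "\<And>p q. p \<in> adjoin \<Longrightarrow> q \<in> adjoin \<Longrightarrow> p \<otimes> q \<in> adjoin"
    using exprs_mult by (force simp: adjoin_def)
  show "p \<oplus> q \<in> adjoin" if pq: "p \<in> adjoin" "q \<in> adjoin" for p q
  proof -
    obtain d e where "p \<in> exprs d" "q \<in> exprs e"
      using pq by (auto simp: adjoin_def)
    then have "p \<in> exprs (max d e)" "q \<in> exprs (max d e)"
      by (auto intro: exprs_mono)
    then show ?thesis using exprs_add unfolding adjoin_def by blast
  qed
qed

lemma adjoin_minimal:
  assumes C: "subring C R" and AC: "A \<subseteq> C" "x \<in> C"
  shows "adjoin \<subseteq> C"
proof -
  have pow: "x [^] (n::nat) \<in> C" for n
    by (induction n) (use AC subringE(3,6)[OF C] in auto)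
  have "p \<in> C" if "p \<in> exprs d" for p d
    using that
    by (induction d arbitrary: p)
      (use AC subringE(2,6,7)[OF C] pow in \<open>auto simp: subset_iff\<close>)
  then show ?thesis by (auto simp: adjoin_def)
qed

lemma lead_coeffs_ideal:
  assumes J: "ideal J (adjoin_ring)"
  shows "ideal (lead_coeffs R A x J d) (R\<lparr>carrier := A\<rparr>)"
proof -
  interpret J: ideal J "adjoin_ring" by fact
  have cA: "cring (R\<lparr>carrier := A\<rparr>)"
    using A by (simp add: subcring_iff[OF subringE(1)[OF A], symmetric] subcringI')
  interpret A: cring "R\<lparr>carrier := A\<rparr>" by (rule cA)
  show ?thesis
  proof (rule A.ideal_cringI, goal_cases)
    case 1
    show ?case by (auto simp: lead_coeffs_def)
  next
    case 2
    have "\<zero> \<otimes> x [^] d \<oplus> \<zero> \<in> J" using ideal_zero[OF J] x by simp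
    then show ?case using exprs_zero subringE(2)[OF A] by (auto simp: lead_coeffs_def)
  next
    case (3 a b)
    then obtain p q where *: "a \<in> A" "b \<in> A" "p \<in> exprs d" "q \<in> exprs d"
      "a \<otimes> x [^] d \<oplus> p \<in> J" "b \<otimes> x [^] d \<oplus> q \<in> J" by (auto simp: lead_coeffs_def)
    have "(a \<oplus> b) \<otimes> x [^] d \<oplus> (p \<oplus> q) = (a \<otimes> x [^] d \<oplus> p) \<oplus> (b \<otimes> x [^] d \<oplus> q)"
      using * x Ac exprs_carrier by (simp add: l_distr a_ac)
    also have "\<dots> \<in> J" using ideal_add[OF J] *(5,6) by simp
    finally show ?case using * exprs_add subringE(7)[OF A] by (auto simp: lead_coeffs_def)
  next
    case (4 c a)
    then obtain p where *: "c \<in> A" "a \<in> A" "p \<in> exprs d"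
      "a \<otimes> x [^] d \<oplus> p \<in> J" by (auto simp: lead_coeffs_def)
    have "(c \<otimes> a) \<otimes> x [^] d \<oplus> c \<otimes> p = c \<otimes> (a \<otimes> x [^] d \<oplus> p)"
      using * x Ac exprs_carrier by (simp add: r_distr m_assoc)
    also have "\<dots> \<in> J" using J.I_l_closed[of _ c] * adjoin_base by simp
    finally show ?case using * exprs_smult subringE(6)[OF A] by (auto simp: lead_coeffs_def)
  qed
qed

lemma lead_coeffs_Suc:
  assumes J: "ideal J (adjoin_ring)"
  shows "lead_coeffs R A x J d \<subseteq> lead_coeffs R A x J (Suc d)"
proof
  interpret J: ideal J "adjoin_ring" by fact
  fix a assume "a \<in> lead_coeffs R A x J d"
  then obtain p where *: "a \<in> A" "p \<in> exprs d"
    "a \<otimes> x [^] d \<oplus> p \<in> J" by (auto simp: lead_coeffs_def)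
  have "a \<otimes> x [^] Suc d \<oplus> x \<otimes> p = x \<otimes> (a \<otimes> x [^] d \<oplus> p)"
    using * x Ac exprs_carrier by (simp add: r_distr m_ac)
  also have "\<dots> \<in> J" using J.I_l_closed[of _ x] * adjoin_gen by simp
  finally show "a \<in> lead_coeffs R A x J (Suc d)"
    using * exprs_shift[OF *(2)] unfolding lead_coeffs_def by blast
qed

lemma lead_coeffs_mono:
  assumes J: "ideal J (adjoin_ring)" and "d \<le> e"
  shows "lead_coeffs R A x J d \<subseteq> lead_coeffs R A x J e"
  using lift_Suc_mono_le[of "lead_coeffs R A x J", OF lead_coeffs_Suc[OF J] assms(2)] .

text \<open>Two nested ideals with the same leading coefficients in each degree agree: subtracting an
  element of the smaller one lowers the degree.\<close>

lemma ideal_eq_by_lead_coeffs: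
  assumes J: "ideal J (adjoin_ring)" and K: "ideal K (adjoin_ring)" "K \<subseteq> J"
    and le: "\<And>d. lead_coeffs R A x J d \<subseteq> lead_coeffs R A x K d"
  shows "J \<subseteq> K"
proof -
  interpret J: ideal J "adjoin_ring" by fact
  interpret K: ideal K "adjoin_ring" by fact
  have "p \<in> K" if "p \<in> exprs d" "p \<in> J" for p d
    using that
  proof (induction d arbitrary: p)
    case 0
    then show ?case using ideal_zero[OF K(1)] by simp
  next
    case (Suc d)
    then obtain a q where p: "a \<in> A" "q \<in> exprs d" "p = a \<otimes> x [^] d \<oplus> q" by auto
    with Suc.prems have "a \<in> lead_coeffs R A x J d" by (auto simp: lead_coeffs_def)
    with le obtain q' where q': "q' \<in> exprs d" "a \<otimes> x [^] d \<oplus> q' \<in> K"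
      by (auto simp: lead_coeffs_def)
    define h where "h = a \<otimes> x [^] d \<oplus> q'"
    have car: "a \<otimes> x [^] d \<in> carrier R" "q \<in> carrier R" "q' \<in> carrier R" "h \<in> carrier R"
      using p q' x Ac exprs_carrier by (auto simp: h_def)
    have ph: "p = h \<oplus> (q \<oplus> \<ominus> q')"
      unfolding p h_def using car by algebra
    have "\<ominus> \<one> \<in> adjoin" using subringE(3,5)[OF adjoin_subring] by blast
    moreover have "h \<in> J" using q' K by (auto simp: h_def)
    ultimately have "(\<ominus> \<one>) \<otimes> h \<in> J" using J.I_l_closed[of h "\<ominus> \<one>"] by simp
    then have "p \<oplus> (\<ominus> \<one>) \<otimes> h \<in> J" using ideal_add[OF J] Suc.prems by simp
    moreover have "p \<oplus> (\<ominus> \<one>) \<otimes> h = q \<oplus> \<ominus> q'"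
      unfolding ph using car by algebra
    ultimately have "q \<oplus> \<ominus> q' \<in> J" by simp
    then have "q \<oplus> \<ominus> q' \<in> K"
      using Suc.IH exprs_add[OF p(2) exprs_uminus[OF q'(1)]] by blast
    then show ?case using ideal_add[OF K(1)] q' ph by (auto simp: h_def)
  qed
  moreover have "J \<subseteq> adjoin" using J.a_subset by simp
  ultimately show ?thesis by (auto simp: adjoin_def)
qed

text \<open>Hilbert's basis theorem. The ideals of leading coefficients of \<open>J\<close> are constant from some degree
  \<open>N\<close> on; elements of \<open>J\<close> realizing generators of the finitely many remaining ones generate \<open>J\<close>.\<close>

theorem adjoin_noetherian:
  assumes noeth: "noetherian_ring (R\<lparr>carrier := A\<rparr>)"
  shows "noetherian_ring (adjoin_ring)"
proof -
  interpret A: noetherian_ring "R\<lparr>carrier := A\<rparr>" by (rule noeth)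
  interpret B: ring "adjoin_ring" by (rule subring_is_ring[OF adjoin_subring])
  show ?thesis
  proof (rule B.noetherian_ringI)
    fix J assume J: "ideal J (adjoin_ring)"
    interpret J: ideal J "adjoin_ring" by fact
    define L where "L = lead_coeffs R A x J"
    have Lmono: "L d \<subseteq> L e" if "d \<le> e" for d e
      unfolding L_def by (rule lead_coeffs_mono[OF J that])
    have Lid: "ideal (L d) (R\<lparr>carrier := A\<rparr>)" for d
      unfolding L_def by (rule lead_coeffs_ideal[OF J])
    have "subset.chain {I. ideal I (R\<lparr>carrier := A\<rparr>)} (range L)"
      using Lid Lmono unfolding pred_on.chain_def
      by (smt (verit, best) UNIV_I image_iff linorder_le_cases mem_Collect_eq subset_iff
            psubsetI sup2CI)
    from A.ideal_chain_is_trivial[OF _ this] obtain N where N: "\<Union>(range L) = L N" by blast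
    then have LN: "L d \<subseteq> L N" for d by blast
    have "\<forall>d. \<exists>Y. finite Y \<and> Y \<subseteq> A \<and> L d = Idl\<^bsub>R\<lparr>carrier := A\<rparr>\<^esub> Y"
      using A.finetely_gen[OF Lid] by fastforce
    then obtain Y where Y: "\<And>d. finite (Y d)" "\<And>d. Y d \<subseteq> A" "\<And>d. L d = Idl\<^bsub>R\<lparr>carrier := A\<rparr>\<^esub> (Y d)"
      by metis
    have YL: "Y d \<subseteq> L d" for d using A.genideal_self[of "Y d"] Y by simp
    have "\<forall>d a. \<exists>q. a \<in> Y d \<longrightarrow> q \<in> exprs d \<and> a \<otimes> x [^] d \<oplus> q \<in> J"
      using YL unfolding L_def lead_coeffs_def by blast
    then obtain g where g: "\<And>d a. a \<in> Y d \<Longrightarrow> g d a \<in> exprs d"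
       "\<And>d a. a \<in> Y d \<Longrightarrow> a \<otimes> x [^] d \<oplus> g d a \<in> J" by metis
    define G where "G = (\<Union>d\<le>N. (\<lambda>a. a \<otimes> x [^] d \<oplus> g d a) ` Y d)"
    have GJ: "G \<subseteq> J" "finite G" using g Y(1) by (auto simp: G_def)
    have Gc: "G \<subseteq> carrier (adjoin_ring)" using GJ J.a_subset by auto
    define K where "K = Idl\<^bsub>adjoin_ring\<^esub> G"
    have K: "ideal K (adjoin_ring)" unfolding K_def by (rule B.genideal_ideal[OF Gc])
    have KJ: "K \<subseteq> J" unfolding K_def by (rule B.genideal_minimal[OF J GJ(1)])
    have low: "L d \<subseteq> lead_coeffs R A x K d" if "d \<le> N" for d
      unfolding Y(3)
    proof (rule A.genideal_minimal[OF lead_coeffs_ideal[OF K]])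
      show "Y d \<subseteq> lead_coeffs R A x K d"
      proof
        fix a assume a: "a \<in> Y d"
        then have "a \<otimes> x [^] d \<oplus> g d a \<in> K"
          unfolding K_def using B.genideal_self[OF Gc] that by (auto simp: G_def)
        then show "a \<in> lead_coeffs R A x K d" using a g Y(2) unfolding lead_coeffs_def by blast
      qed
    qed
    have "L d \<subseteq> lead_coeffs R A x K d" for d
    proof (cases "d \<le> N")
      case False
      then show ?thesis using LN[of d] low[of N] lead_coeffs_mono[OF K, of N d] by auto
    qed (rule low)
    then have "J \<subseteq> K" by (intro ideal_eq_by_lead_coeffs[OF J K KJ]) (simp add: L_def)
    with KJ have "J = K" by blast
    then show "\<exists>G\<subseteq>carrier (adjoin_ring). finite G \<and> J = Idl\<^bsub>adjoin_ring\<^esub> G"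
      unfolding K_def using Gc GJ(2) by blast
  qed
qed

end

lemma (in cring) finitely_generated_noetherian:
  assumes "finite G" "G \<subseteq> carrier R" "subring A R" "noetherian_ring (R\<lparr>carrier := A\<rparr>)"
  shows "\<exists>B. subring B R \<and> A \<subseteq> B \<and> G \<subseteq> B \<and> noetherian_ring (R\<lparr>carrier := B\<rparr>)
    \<and> (\<forall>C. subring C R \<longrightarrow> A \<subseteq> C \<longrightarrow> G \<subseteq> C \<longrightarrow> B \<subseteq> C)"
  using assms(1,2)
proof (induction G rule: finite_induct)
  case empty
  then show ?case using assms by blast
next
  case (insert x G)
  have "G \<subseteq> carrier R" using insert.prems by blast
  from insert.IH[OF this] obtain B where B: "subring B R" "A \<subseteq> B" "G \<subseteq> B"
    "noetherian_ring (R\<lparr>carrier := B\<rparr>)"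
    and min: "\<forall>C. subring C R \<longrightarrow> A \<subseteq> C \<longrightarrow> G \<subseteq> C \<longrightarrow> B \<subseteq> C"
    by (elim exE conjE)
  interpret adjunction: adjunction R B x by (intro adjunction.intro adjunction_axioms.intro is_cring) (use B(1) insert.prems in blast)+
  show ?case
  proof (intro exI[of _ adjunction.adjoin] conjI allI impI)
    show "A \<subseteq> adjunction.adjoin" "insert x G \<subseteq> adjunction.adjoin"
      using B(2,3) adjunction.adjoin_base adjunction.adjoin_gen by blast+
    show "adjunction.adjoin \<subseteq> C" if "subring C R" "A \<subseteq> C" "insert x G \<subseteq> C" for C
      using adjunction.adjoin_minimal[OF that(1)] min that by blast
  qed (rule adjunction.adjoin_subring adjunction.adjoin_noetherian[OF B(4)])+
qed

section \<open>Localization of a domain at a prime\<close>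

locale localized_domain = domain A for A (structure) +
  fixes p
  assumes p: "primeideal p A"
begin

interpretation p: primeideal p A by (rule p)

abbreviation T where "T \<equiv> carrier A - p"
abbreviation frac where "frac \<equiv> loc_frac A T"
abbreviation Q where "Q \<equiv> localization_at A p"
abbreviation \<iota> where "\<iota> \<equiv> to_localization_at A p"

lemma T_carrier: "s \<in> T \<Longrightarrow> s \<in> carrier A" by blast

lemma T_one: "\<one> \<in> T" using primeideal_not_one[OF p] by simp

lemma T_mult: "s \<in> T \<Longrightarrow> t \<in> T \<Longrightarrow> s \<otimes> t \<in> T"
  using p.I_prime by auto

lemma T_nonzero: "s \<in> T \<Longrightarrow> s \<noteq> \<zero>"
  using ideal_zero[OF p.is_ideal] by auto

lemma mem_frac:
  assumes "a \<in> carrier A" "s \<in> T"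
  shows "(b, t) \<in> frac a s \<longleftrightarrow> b \<in> carrier A \<and> t \<in> T \<and> t \<otimes> a = s \<otimes> b"
proof -
  have "u \<otimes> (t \<otimes> a) = u \<otimes> (s \<otimes> b) \<longleftrightarrow> t \<otimes> a = s \<otimes> b" if "u \<in> T" "t \<in> T" "b \<in> carrier A" for u
    using m_lcancel[of u "t \<otimes> a" "s \<otimes> b"] that assms T_nonzero by auto
  then show ?thesis using T_one unfolding loc_frac_def by blast
qed

lemma self_mem_frac: "a \<in> carrier A \<Longrightarrow> s \<in> T \<Longrightarrow> (a, s) \<in> frac a s"
  by (simp add: mem_frac)

lemma frac_eqI:
  assumes "a \<in> carrier A" "s \<in> T" "b \<in> carrier A" "t \<in> T" "t \<otimes> a = s \<otimes> b"
  shows "frac a s = frac b t"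
proof -
  have "v \<otimes> a = s \<otimes> c \<longleftrightarrow> v \<otimes> b = t \<otimes> c" if c: "c \<in> carrier A" "v \<in> T" for c v
  proof -
    have "v \<otimes> a = s \<otimes> c \<longleftrightarrow> t \<otimes> (v \<otimes> a) = t \<otimes> (s \<otimes> c)"
      using m_lcancel[of t "v \<otimes> a" "s \<otimes> c"] assms c T_nonzero by auto
    also have "t \<otimes> (v \<otimes> a) = v \<otimes> (t \<otimes> a)" using assms(1-4) c by (simp add: m_lcomm)
    also have "v \<otimes> (t \<otimes> a) = s \<otimes> (v \<otimes> b)"
      unfolding assms(5) using assms(1-4) c by (simp add: m_lcomm)
    also have "t \<otimes> (s \<otimes> c) = s \<otimes> (t \<otimes> c)" using assms c by (simp add: m_lcomm)
    also have "s \<otimes> (v \<otimes> b) = s \<otimes> (t \<otimes> c) \<longleftrightarrow> v \<otimes> b = t \<otimes> c"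
      using m_lcancel[of s "v \<otimes> b" "t \<otimes> c"] assms c T_nonzero by auto
    finally show ?thesis .
  qed
  then have "(c, v) \<in> frac a s \<longleftrightarrow> (c, v) \<in> frac b t" for c v
    using mem_frac[of a s c v] mem_frac[of b t c v] assms by blast
  then show ?thesis by auto
qed

lemma frac_eqD:
  assumes "a \<in> carrier A" "s \<in> T" "b \<in> carrier A" "t \<in> T" "frac a s = frac b t"
  shows "t \<otimes> a = s \<otimes> b"
  using self_mem_frac[OF assms(3,4), folded assms(5)] mem_frac[OF assms(1,2)] by simp

lemma carrier_Q: "carrier Q = {frac a s | a s. a \<in> carrier A \<and> s \<in> T}"
  by (simp add: localization_at_def localization_def)

lemma frac_carrier: "a \<in> carrier A \<Longrightarrow> s \<in> T \<Longrightarrow> frac a s \<in> carrier Q"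
  unfolding carrier_Q by blast

lemma one_Q: "\<one>\<^bsub>Q\<^esub> = frac \<one> \<one>" and zero_Q: "\<zero>\<^bsub>Q\<^esub> = frac \<zero> \<one>"
  by (simp_all add: localization_at_def localization_def)

lemma mult_Q:
  assumes "a \<in> carrier A" "s \<in> T" "b \<in> carrier A" "t \<in> T"
  shows "frac a s \<otimes>\<^bsub>Q\<^esub> frac b t = frac (a \<otimes> b) (s \<otimes> t)"
proof -
  have "frac (a' \<otimes> b') (s' \<otimes> t') = frac (a \<otimes> b) (s \<otimes> t)"
    if "(a', s') \<in> frac a s" "(b', t') \<in> frac b t" for a' s' b' t'
  proof -
    have *: "a' \<in> carrier A" "s' \<in> T" "s' \<otimes> a = s \<otimes> a'" "b' \<in> carrier A" "t' \<in> T" "t' \<otimes> b = t \<otimes> b'"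
      using that mem_frac assms by auto
    have "(s' \<otimes> t') \<otimes> (a \<otimes> b) = (s' \<otimes> a) \<otimes> (t' \<otimes> b)"
      using *(1,2,4,5) assms by (simp add: m_ac)
    also have "\<dots> = (s \<otimes> t) \<otimes> (a' \<otimes> b')"
      unfolding *(3,6) using *(1,2,4,5) assms by (simp add: m_ac)
    finally show ?thesis
      using * assms by (intro frac_eqI[symmetric] T_mult) auto
  qed
  then have "(\<Union>(a, s)\<in>frac a s. \<Union>(b, t)\<in>frac b t. frac (a \<otimes> b) (s \<otimes> t))
    = (\<Union>_\<in>frac a s. \<Union>_\<in>frac b t. frac (a \<otimes> b) (s \<otimes> t))"
    by (intro SUP_cong) auto
  also have "\<dots> = frac (a \<otimes> b) (s \<otimes> t)" using self_mem_frac assms by blast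
  finally show ?thesis by (simp add: localization_at_def localization_def)
qed

lemma add_Q:
  assumes "a \<in> carrier A" "s \<in> T" "b \<in> carrier A" "t \<in> T"
  shows "frac a s \<oplus>\<^bsub>Q\<^esub> frac b t = frac (a \<otimes> t \<oplus> b \<otimes> s) (s \<otimes> t)"
proof -
  have "frac (a' \<otimes> t' \<oplus> b' \<otimes> s') (s' \<otimes> t') = frac (a \<otimes> t \<oplus> b \<otimes> s) (s \<otimes> t)"
    if "(a', s') \<in> frac a s" "(b', t') \<in> frac b t" for a' s' b' t'
  proof -
    have *: "a' \<in> carrier A" "s' \<in> T" "s' \<otimes> a = s \<otimes> a'" "b' \<in> carrier A" "t' \<in> T" "t' \<otimes> b = t \<otimes> b'"
      using that mem_frac assms by auto
    have "(s' \<otimes> t') \<otimes> (a \<otimes> t \<oplus> b \<otimes> s) = (t \<otimes> t') \<otimes> (s' \<otimes> a) \<oplus> (s \<otimes> s') \<otimes> (t' \<otimes> b)"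
      using *(1,2,4,5) assms by (simp add: m_ac r_distr)
    also have "\<dots> = (s \<otimes> t) \<otimes> (a' \<otimes> t' \<oplus> b' \<otimes> s')"
      unfolding *(3,6) using *(1,2,4,5) assms by (simp add: m_ac r_distr)
    finally show ?thesis
      using * assms by (intro frac_eqI[symmetric] T_mult) auto
  qed
  then have "(\<Union>(a, s)\<in>frac a s. \<Union>(b, t)\<in>frac b t. frac (a \<otimes> t \<oplus> b \<otimes> s) (s \<otimes> t))
    = (\<Union>_\<in>frac a s. \<Union>_\<in>frac b t. frac (a \<otimes> t \<oplus> b \<otimes> s) (s \<otimes> t))"
    by (intro SUP_cong) auto
  also have "\<dots> = frac (a \<otimes> t \<oplus> b \<otimes> s) (s \<otimes> t)" using self_mem_frac assms by blast
  finally show ?thesis by (simp add: localization_at_def localization_def)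
qed

lemma Q_cases:
  assumes "q \<in> carrier Q"
  obtains a s where "a \<in> carrier A" "s \<in> T" "q = frac a s"
  using assms unfolding carrier_Q by blast

lemma cring_Q: "cring Q"
proof (rule cringI)
  show "abelian_group Q"
  proof (rule abelian_groupI)
    fix x y z assume "x \<in> carrier Q" "y \<in> carrier Q" "z \<in> carrier Q"
    then obtain a s b t c u where *: "a \<in> carrier A" "s \<in> T" "x = frac a s"
      "b \<in> carrier A" "t \<in> T" "y = frac b t" "c \<in> carrier A" "u \<in> T" "z = frac c u"
      by (meson Q_cases)
    have m: "s \<otimes> t \<in> T" "t \<otimes> u \<in> T" "s \<otimes> t \<otimes> u \<in> T" "s \<otimes> (t \<otimes> u) \<in> T" "t \<otimes> s \<in> T"
      using * T_mult by blast+
    show "x \<oplus>\<^bsub>Q\<^esub> y \<in> carrier Q"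
      using * m by (simp add: add_Q frac_carrier)
    have num: "(a \<otimes> t \<oplus> b \<otimes> s) \<otimes> u \<oplus> c \<otimes> (s \<otimes> t) = a \<otimes> (t \<otimes> u) \<oplus> (b \<otimes> u \<oplus> c \<otimes> t) \<otimes> s"
      using * T_carrier by (simp add: l_distr r_distr m_ac a_ac)
    have "x \<oplus>\<^bsub>Q\<^esub> y \<oplus>\<^bsub>Q\<^esub> z = frac (a \<otimes> t \<oplus> b \<otimes> s) (s \<otimes> t) \<oplus>\<^bsub>Q\<^esub> frac c u"
      using * by (simp add: add_Q)
    also have "\<dots> = frac ((a \<otimes> t \<oplus> b \<otimes> s) \<otimes> u \<oplus> c \<otimes> (s \<otimes> t)) (s \<otimes> t \<otimes> u)"
      using * m by (intro add_Q) auto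
    also have "\<dots> = frac (a \<otimes> (t \<otimes> u) \<oplus> (b \<otimes> u \<oplus> c \<otimes> t) \<otimes> s) (s \<otimes> (t \<otimes> u))"
      unfolding num using * by (simp add: m_assoc)
    also have "\<dots> = frac a s \<oplus>\<^bsub>Q\<^esub> frac (b \<otimes> u \<oplus> c \<otimes> t) (t \<otimes> u)"
      using * m by (intro add_Q[symmetric]) auto
    also have "\<dots> = x \<oplus>\<^bsub>Q\<^esub> (y \<oplus>\<^bsub>Q\<^esub> z)"
      using * by (simp add: add_Q)
    finally show "x \<oplus>\<^bsub>Q\<^esub> y \<oplus>\<^bsub>Q\<^esub> z = x \<oplus>\<^bsub>Q\<^esub> (y \<oplus>\<^bsub>Q\<^esub> z)" .
    show "x \<oplus>\<^bsub>Q\<^esub> y = y \<oplus>\<^bsub>Q\<^esub> x"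
      using * m by (simp add: add_Q m_comm[of s t] a_comm)
  next
    fix x assume "x \<in> carrier Q"
    then obtain a s where *: "a \<in> carrier A" "s \<in> T" "x = frac a s" by (meson Q_cases)
    show "\<zero>\<^bsub>Q\<^esub> \<oplus>\<^bsub>Q\<^esub> x = x"
      using * T_one by (simp add: zero_Q add_Q)
    have "frac (\<ominus> a) s \<oplus>\<^bsub>Q\<^esub> x = frac (\<ominus> a \<otimes> s \<oplus> a \<otimes> s) (s \<otimes> s)"
      using * by (simp add: add_Q)
    also have "\<dots> = frac \<zero> \<one>"
      using * T_one T_mult[of s s] by (intro frac_eqI) (auto simp: l_minus l_neg)
    finally show "\<exists>y\<in>carrier Q. y \<oplus>\<^bsub>Q\<^esub> x = \<zero>\<^bsub>Q\<^esub>"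
      using frac_carrier[of "\<ominus> a" s] * zero_Q by auto
  qed (use frac_carrier T_one zero_Q in auto)
  show "comm_monoid Q"
  proof (rule comm_monoidI)
    fix x y z assume "x \<in> carrier Q" "y \<in> carrier Q" "z \<in> carrier Q"
    then obtain a s b t c u where *: "a \<in> carrier A" "s \<in> T" "x = frac a s"
      "b \<in> carrier A" "t \<in> T" "y = frac b t" "c \<in> carrier A" "u \<in> T" "z = frac c u"
      by (meson Q_cases)
    have m: "s \<otimes> t \<in> T" "t \<otimes> u \<in> T" using * T_mult by blast+
    show "x \<otimes>\<^bsub>Q\<^esub> y \<in> carrier Q"
      using * m by (simp add: mult_Q frac_carrier)
    show "x \<otimes>\<^bsub>Q\<^esub> y \<otimes>\<^bsub>Q\<^esub> z = x \<otimes>\<^bsub>Q\<^esub> (y \<otimes>\<^bsub>Q\<^esub> z)"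
      using * m by (simp add: mult_Q m_assoc)
    show "x \<otimes>\<^bsub>Q\<^esub> y = y \<otimes>\<^bsub>Q\<^esub> x"
      using * m by (simp add: mult_Q m_comm)
    show "\<one>\<^bsub>Q\<^esub> \<otimes>\<^bsub>Q\<^esub> x = x"
      using * T_one by (simp add: one_Q mult_Q)
  qed (use frac_carrier T_one one_Q in auto)
  fix x y z assume "x \<in> carrier Q" "y \<in> carrier Q" "z \<in> carrier Q"
  then obtain a s b t c u where *: "a \<in> carrier A" "s \<in> T" "x = frac a s"
    "b \<in> carrier A" "t \<in> T" "y = frac b t" "c \<in> carrier A" "u \<in> T" "z = frac c u"
    by (meson Q_cases)
  have m: "s \<otimes> t \<in> T" "t \<otimes> u \<in> T" "s \<otimes> u \<in> T" "s \<otimes> u \<otimes> (t \<otimes> u) \<in> T" "s \<otimes> t \<otimes> u \<in> T"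
    using * T_mult by blast+
  have "(x \<oplus>\<^bsub>Q\<^esub> y) \<otimes>\<^bsub>Q\<^esub> z = frac ((a \<otimes> t \<oplus> b \<otimes> s) \<otimes> c) (s \<otimes> t \<otimes> u)"
    using * m by (simp add: add_Q mult_Q)
  also have "\<dots> = frac (a \<otimes> c \<otimes> (t \<otimes> u) \<oplus> b \<otimes> c \<otimes> (s \<otimes> u)) (s \<otimes> u \<otimes> (t \<otimes> u))"
  proof (rule frac_eqI[OF _ m(5) _ m(4)])
    have "s \<in> carrier A" "t \<in> carrier A" "u \<in> carrier A" using * by auto
    then show "s \<otimes> u \<otimes> (t \<otimes> u) \<otimes> ((a \<otimes> t \<oplus> b \<otimes> s) \<otimes> c)
      = s \<otimes> t \<otimes> u \<otimes> (a \<otimes> c \<otimes> (t \<otimes> u) \<oplus> b \<otimes> c \<otimes> (s \<otimes> u))"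
      using *(1,4,7) by (simp add: l_distr r_distr m_ac)
  qed (use * in auto)
  also have "\<dots> = x \<otimes>\<^bsub>Q\<^esub> z \<oplus>\<^bsub>Q\<^esub> y \<otimes>\<^bsub>Q\<^esub> z"
    using * m by (simp add: add_Q mult_Q)
  finally show "(x \<oplus>\<^bsub>Q\<^esub> y) \<otimes>\<^bsub>Q\<^esub> z = x \<otimes>\<^bsub>Q\<^esub> z \<oplus>\<^bsub>Q\<^esub> y \<otimes>\<^bsub>Q\<^esub> z" .
qed

lemma \<iota>_hom: "ring_hom_ring A Q \<iota>"
proof (rule ring_hom_ringI)
  show "ring A" "ring Q" using ring_axioms cring.axioms(1)[OF cring_Q] by auto
  show "\<iota> a \<in> carrier Q" if "a \<in> carrier A" for a
    unfolding to_localization_at_def using frac_carrier[OF that T_one] .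
  show "\<iota> (a \<otimes> b) = \<iota> a \<otimes>\<^bsub>Q\<^esub> \<iota> b" "\<iota> (a \<oplus> b) = \<iota> a \<oplus>\<^bsub>Q\<^esub> \<iota> b"
    if "a \<in> carrier A" "b \<in> carrier A" for a b
    unfolding to_localization_at_def mult_Q[OF that(1) T_one that(2) T_one]
      add_Q[OF that(1) T_one that(2) T_one] using that by simp_all
  show "\<iota> \<one> = \<one>\<^bsub>Q\<^esub>" by (simp add: to_localization_at_def one_Q)
qed

lemma \<iota>_unit:
  assumes "s \<in> T" shows "\<iota> s \<in> Units Q"
proof -
  have "frac s s = frac \<one> \<one>" using assms T_one by (intro frac_eqI) auto
  then have "frac \<one> s \<otimes>\<^bsub>Q\<^esub> frac s \<one> = \<one>\<^bsub>Q\<^esub>" "frac s \<one> \<otimes>\<^bsub>Q\<^esub> frac \<one> s = \<one>\<^bsub>Q\<^esub>"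
    using assms T_one by (auto simp: mult_Q one_Q)
  then show ?thesis
    unfolding Units_def to_localization_at_def using assms T_one frac_carrier by blast
qed

lemma \<iota>_frac:
  assumes "q \<in> carrier Q" shows "\<exists>a\<in>carrier A. \<exists>s\<in>T. \<iota> s \<otimes>\<^bsub>Q\<^esub> q = \<iota> a"
proof -
  obtain a s where *: "a \<in> carrier A" "s \<in> T" "q = frac a s" using Q_cases[OF assms] .
  have "frac (s \<otimes> a) s = frac a \<one>" using * T_one by (intro frac_eqI) auto
  then have "\<iota> s \<otimes>\<^bsub>Q\<^esub> q = \<iota> a"
    unfolding to_localization_at_def using * T_one by (simp add: mult_Q)
  then show ?thesis using * by blast
qed

lemma \<iota>_inj: "a \<in> carrier A \<Longrightarrow> b \<in> carrier A \<Longrightarrow> \<iota> a = \<iota> b \<Longrightarrow> a = b"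
  unfolding to_localization_at_def using frac_eqD[of a \<one> b \<one>] T_one by simp

text \<open>The fractions of which some multiple by an element outside \<open>p\<close> comes from \<open>I\<close> already form an ideal.\<close>

lemma \<iota>_mem_extend:
  assumes I: "ideal I A" and r: "r \<in> carrier A"
  shows "\<iota> r \<in> extend_to_localization_at A p I \<longleftrightarrow> (\<exists>s\<in>T. s \<otimes> r \<in> I)"
proof
  interpret Q: cring Q by (rule cring_Q)
  interpret h: ring_hom_ring A Q \<iota> by (rule \<iota>_hom)
  have Ic: "I \<subseteq> carrier A" using ideal.Icarr[OF I] by blast
  then have \<iota>I: "\<iota> ` I \<subseteq> carrier Q" by auto
  {
    assume "\<exists>s\<in>T. s \<otimes> r \<in> I"
    then obtain s where s: "s \<in> T" "s \<otimes> r \<in> I" by blast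
    then have "\<iota> (s \<otimes> r) \<in> Idl\<^bsub>Q\<^esub> (\<iota> ` I)" using Q.genideal_self[OF \<iota>I] by blast
    then have "\<iota> s \<otimes>\<^bsub>Q\<^esub> \<iota> r \<in> Idl\<^bsub>Q\<^esub> (\<iota> ` I)" using s r by simp
    then show "\<iota> r \<in> extend_to_localization_at A p I"
      unfolding extend_to_localization_at_def
      using Q.unit_mult_mem_ideal[OF Q.genideal_ideal[OF \<iota>I] \<iota>_unit[OF s(1)]] r by simp
  }
  define J where "J = {q \<in> carrier Q. \<exists>s\<in>T. \<exists>i\<in>I. \<iota> s \<otimes>\<^bsub>Q\<^esub> q = \<iota> i}"
  have "ideal J Q"
  proof (rule Q.ideal_cringI)
    show "J \<subseteq> carrier Q" by (auto simp: J_def)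
    show "\<zero>\<^bsub>Q\<^esub> \<in> J"
      using T_one ideal_zero[OF I]
      by (auto simp: J_def intro!: bexI[of _ \<one>] bexI[of _ \<zero>])
  next
    fix q q' assume "q \<in> J" "q' \<in> J"
    then obtain s i t j where *: "q \<in> carrier Q" "q' \<in> carrier Q" "s \<in> T" "t \<in> T" "i \<in> I" "j \<in> I"
      "\<iota> s \<otimes>\<^bsub>Q\<^esub> q = \<iota> i" "\<iota> t \<otimes>\<^bsub>Q\<^esub> q' = \<iota> j" by (auto simp: J_def)
    have c: "\<iota> s \<in> carrier Q" "\<iota> t \<in> carrier Q" "i \<in> carrier A" "j \<in> carrier A" using * Ic by auto
    have "\<iota> (s \<otimes> t) \<otimes>\<^bsub>Q\<^esub> (q \<oplus>\<^bsub>Q\<^esub> q') = \<iota> t \<otimes>\<^bsub>Q\<^esub> (\<iota> s \<otimes>\<^bsub>Q\<^esub> q) \<oplus>\<^bsub>Q\<^esub> \<iota> s \<otimes>\<^bsub>Q\<^esub> (\<iota> t \<otimes>\<^bsub>Q\<^esub> q')"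
      using *(1-6) c by (simp add: Q.r_distr Q.m_ac)
    also have "\<dots> = \<iota> (t \<otimes> i \<oplus> s \<otimes> j)" unfolding *(7,8) using *(1-6) c by simp
    finally show "q \<oplus>\<^bsub>Q\<^esub> q' \<in> J"
      using * T_mult[of s t] ideal.I_l_closed[OF I]
        ideal_add[OF I, of "t \<otimes> i" "s \<otimes> j"]
      unfolding J_def by blast
  next
    fix x q assume "x \<in> carrier Q" "q \<in> J"
    then obtain a t s i where *: "x \<in> carrier Q" "q \<in> carrier Q" "s \<in> T" "i \<in> I" "\<iota> s \<otimes>\<^bsub>Q\<^esub> q = \<iota> i"
      "a \<in> carrier A" "t \<in> T" "\<iota> t \<otimes>\<^bsub>Q\<^esub> x = \<iota> a"
      using \<iota>_frac[of x] by (auto simp: J_def simp del: Diff_iff)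
    have c: "\<iota> s \<in> carrier Q" "\<iota> t \<in> carrier Q" "i \<in> carrier A" using * Ic by auto
    have "\<iota> (t \<otimes> s) \<otimes>\<^bsub>Q\<^esub> (x \<otimes>\<^bsub>Q\<^esub> q) = (\<iota> t \<otimes>\<^bsub>Q\<^esub> x) \<otimes>\<^bsub>Q\<^esub> (\<iota> s \<otimes>\<^bsub>Q\<^esub> q)"
      using *(1-4,6,7) c by (simp add: Q.m_ac)
    also have "\<dots> = \<iota> (a \<otimes> i)" unfolding *(5,8) using *(1-4,6,7) c by simp
    finally show "x \<otimes>\<^bsub>Q\<^esub> q \<in> J"
      using * T_mult[of t s] ideal.I_l_closed[OF I] Q.m_closed unfolding J_def by blast
  qed
  moreover have "\<iota> ` I \<subseteq> J"
  proof (rule image_subsetI)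
    fix i assume i: "i \<in> I"
    then have "\<iota> \<one> \<otimes>\<^bsub>Q\<^esub> \<iota> i = \<iota> i" using Ic by auto
    moreover have "\<iota> i \<in> carrier Q" using i Ic by auto
    ultimately show "\<iota> i \<in> J" unfolding J_def using T_one i by blast
  qed
  ultimately have sub: "extend_to_localization_at A p I \<subseteq> J"
    unfolding extend_to_localization_at_def by (rule Q.genideal_minimal)
  assume "\<iota> r \<in> extend_to_localization_at A p I"
  with sub obtain s i where *: "s \<in> T" "i \<in> I" "\<iota> s \<otimes>\<^bsub>Q\<^esub> \<iota> r = \<iota> i" unfolding J_def by blast
  then have "\<iota> (s \<otimes> r) = \<iota> i" using r by simp
  then have "s \<otimes> r = i" using \<iota>_inj * r Ic by auto
  then show "\<exists>s\<in>T. s \<otimes> r \<in> I" using * by blast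
qed

end

section \<open>Polynomials in four variables\<close>

abbreviation (input) "lookup \<equiv> Poly_Mapping.lookup"
abbreviation (input) "single \<equiv> Poly_Mapping.single"
abbreviation (input) "keys \<equiv> Poly_Mapping.keys"
abbreviation (input) "type_ring \<equiv> ring_of_type_algebra"
abbreviation (input) "coords \<equiv> {VX, VZ, VW}"

lemma type_ring_simps [simp]:
  "carrier type_ring = UNIV"
  "x \<otimes>\<^bsub>type_ring\<^esub> y = x * y"
  "x \<oplus>\<^bsub>type_ring\<^esub> y = x + y"
  "\<one>\<^bsub>type_ring\<^esub> = 1"
  "\<zero>\<^bsub>type_ring\<^esub> = 0"
  by (simp_all add: ring_of_type_algebra_def)

text \<open>The order of the variables is arbitrary: it only serves to single out monomials in products.\<close>

instantiation var :: linorder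
begin

primrec var_rank :: "var \<Rightarrow> nat" where
  "var_rank VX = 0" | "var_rank VY = 1" | "var_rank VZ = 2" | "var_rank VW = 3"

definition less_eq_var :: "var \<Rightarrow> var \<Rightarrow> bool" where "less_eq_var a b \<longleftrightarrow> var_rank a \<le> var_rank b"

definition less_var :: "var \<Rightarrow> var \<Rightarrow> bool" where "less_var a b \<longleftrightarrow> var_rank a < var_rank b"

instance
proof
  fix a b :: var
  assume "a \<le> b" "b \<le> a"
  then show "a = b" by (cases a; cases b) (auto simp: less_eq_var_def)
qed (auto simp: less_eq_var_def less_var_def)

end

lemma UNIV_var: "UNIV = {VX, VY, VZ, VW}"
  using var.exhaust by auto

instance var :: finite
  by standard (simp add: UNIV_var)

definition weight :: "var set \<Rightarrow> (var \<Rightarrow>\<^sub>0 nat) \<Rightarrow> nat" where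
  "weight A e = (\<Sum>v\<in>A. lookup e v)"

lemma weight_add: "weight A (e + e') = weight A e + weight A e'"
  by (simp add: weight_def lookup_add sum.distrib)

lemma weight_zero [simp]: "weight A 0 = 0"
  by (simp add: weight_def)

lemma weight_single: "weight A (single v n) = (if v \<in> A then n else 0)"
  by (simp add: weight_def lookup_single when_def)

lemma weight_mono: "A \<subseteq> B \<Longrightarrow> weight A e \<le> weight B e"
  unfolding weight_def by (intro sum_mono2) auto

text \<open>The \<open>n\<close>-th power of the ideal generated by the variables in \<open>A\<close>.\<close>

definition weight_ideal :: "var set \<Rightarrow> nat \<Rightarrow> 'k::comm_ring_1 poly4 set" where
  "weight_ideal A n = {p. \<forall>e\<in>keys p. n \<le> weight A e}"

lemma weight_ideal_zero [simp]: "0 \<in> weight_ideal A n"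
  by (simp add: weight_ideal_def)

lemma weight_ideal_0 [simp]: "p \<in> weight_ideal A 0"
  by (simp add: weight_ideal_def)

lemma weight_ideal_add: "p \<in> weight_ideal A n \<Longrightarrow> q \<in> weight_ideal A n \<Longrightarrow> p + q \<in> weight_ideal A n"
  using keys_add[of p q] by (fastforce simp: weight_ideal_def)

lemma weight_ideal_mult:
  "p \<in> weight_ideal A m \<Longrightarrow> q \<in> weight_ideal A n \<Longrightarrow> p * q \<in> weight_ideal A (m + n)"
  using keys_mult[of p q] by (fastforce simp: weight_ideal_def weight_add intro: add_mono)

lemma weight_ideal_smult: "p \<in> weight_ideal A n \<Longrightarrow> q * p \<in> weight_ideal A n"
  using weight_ideal_mult[of q A 0 p n] by simp

lemma weight_ideal_mono: "A \<subseteq> B \<Longrightarrow> m \<le> n \<Longrightarrow> weight_ideal A n \<subseteq> weight_ideal B m"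
  unfolding weight_ideal_def using weight_mono[of A B] by (fastforce intro: order_trans)

lemma single_in_weight_ideal: "n \<le> weight A e \<Longrightarrow> single e c \<in> weight_ideal A n"
  by (simp add: weight_ideal_def)

lemma single_in_weight_ideal_iff:
  "c \<noteq> 0 \<Longrightarrow> single e c \<in> weight_ideal A n \<longleftrightarrow> n \<le> weight A e"
  by (simp add: weight_ideal_def)

lemma not_one_in_weight_ideal: "0 < n \<Longrightarrow> 1 \<notin> weight_ideal A n"
  by (simp add: weight_ideal_def)

lemma weight_UNIV_eq_0: "weight UNIV e = 0 \<longleftrightarrow> e = 0"
  by (auto simp: weight_def intro!: poly_mapping_eqI)

lemma weight_ideal_empty: "weight_ideal {} 1 = {0}"
  by (auto simp: weight_ideal_def weight_def)

lemma weight_ideal_UNIV: "p \<in> weight_ideal UNIV 1 \<longleftrightarrow> lookup p 0 = 0"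
proof -
  have "(1 \<le> weight UNIV e) = (e \<noteq> 0)" for e using weight_UNIV_eq_0[of e] by linarith
  then show ?thesis by (auto simp: weight_ideal_def in_keys_iff)
qed

lemma sum_singles: "(\<Sum>e\<in>keys p. single e (lookup p e)) = p"
  by (rule poly_mapping_eqI) (auto simp: lookup_sum lookup_single when_def in_keys_iff)

lemma poly_in_additive_set:
  assumes "0 \<in> J" "\<And>p q. p \<in> J \<Longrightarrow> q \<in> J \<Longrightarrow> p + q \<in> J"
    and single: "\<And>e. e \<in> keys p \<Longrightarrow> single e (lookup p e) \<in> J"
  shows "(p :: 'k::comm_ring_1 poly4) \<in> J"
proof -
  have "(\<Sum>e\<in>F. single e (lookup p e)) \<in> J"
    if "F \<subseteq> keys p" for F
    using finite_subset[OF that finite_keys] that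
    by (induction F rule: finite_induct) (use assms in auto)
  then show ?thesis using sum_singles[of p] by (metis order_refl)
qed

lemma single_factor_Var:
  assumes "lookup e v \<noteq> 0"
  shows "single e c
    = Var v * single (e - single v 1) (c::'k::comm_ring_1)"
    and "e = single v 1 + (e - single v 1)"
proof -
  show *: "e = single v 1 + (e - single v 1)"
    using assms by (intro poly_mapping_eqI) (auto simp: lookup_add lookup_minus lookup_single when_def)
  show "single e c = Var v * single (e - single v 1) c"
    unfolding Var_def mult_single by (subst *) simp
qed

lemma poly_in_generated_set:
  assumes "\<And>c. single 0 c \<in> J" "\<And>v. Var v \<in> J"
    and "\<And>p q. p \<in> J \<Longrightarrow> q \<in> J \<Longrightarrow> p + q \<in> J" "\<And>p q. p \<in> J \<Longrightarrow> q \<in> J \<Longrightarrow> p * q \<in> J"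
  shows "(p :: 'k::comm_ring_1 poly4) \<in> J"
proof (rule poly_in_additive_set)
  show "0 \<in> J" using assms(1)[of 0] by simp
  have "single e c \<in> J" for e c
  proof (induction "weight UNIV e" arbitrary: e)
    case 0
    then show ?case using assms(1) weight_UNIV_eq_0[of e] by simp
  next
    case (Suc n)
    then have "e \<noteq> 0" by auto
    then obtain v where v: "lookup e v \<noteq> 0" by (metis poly_mapping_eqI lookup_zero)
    have "weight UNIV e = 1 + weight UNIV (e - single v 1)"
      by (subst single_factor_Var(2)[OF v]) (simp only: weight_add weight_single, simp)
    then have "single (e - single v 1) c \<in> J"
      using Suc by simp
    then show ?case unfolding single_factor_Var(1)[OF v, of c] using assms by blast
  qed
  then show "single e (lookup p e) \<in> J" for e .
qed (rule assms)

text \<open>Compare the smallest monomials of lowest weight in \<open>s\<close> and \<open>r\<close>: their product cannot be cancelled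
  in \<open>s r\<close>.\<close>

lemma weight_ideal_cancel:
  fixes s r :: "'k::idom poly4"
  assumes s: "s \<notin> weight_ideal A 1" and sr: "s * r \<in> weight_ideal A n"
  shows "r \<in> weight_ideal A n"
proof (cases "r = 0")
  case False
  have least: "\<exists>e\<in>keys p. \<forall>e'\<in>keys p.
      weight A e < weight A e' \<or> weight A e = weight A e' \<and> e \<le> e'"
    if p: "p \<noteq> 0" for p :: "'k poly4"
  proof -
    define m where "m = Min (weight A ` keys p)"
    define L where "L = {e \<in> keys p. weight A e = m}"
    have ne: "finite (weight A ` keys p)" "weight A ` keys p \<noteq> {}"
      using p by auto
    have "m \<in> weight A ` keys p" unfolding m_def by (rule Min_in[OF ne])
    then have "L \<noteq> {}" "finite L" by (auto simp: L_def)
    then have "Min L \<in> L" by simp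
    moreover have "m \<le> weight A e'" if "e' \<in> keys p" for e'
      unfolding m_def using Min_le[OF ne(1)] that by blast
    ultimately have *: "Min L \<in> keys p" "weight A (Min L) = m"
      "\<And>e'. e' \<in> keys p \<Longrightarrow> m \<le> weight A e'"
      by (auto simp: L_def)
    show ?thesis
    proof (intro bexI[OF _ *(1)] ballI)
      fix e' assume e': "e' \<in> keys p"
      then consider "m < weight A e'" | "m = weight A e'" using *(3) le_neq_implies_less by blast
      then show "weight A (Min L) < weight A e' \<or> weight A (Min L) = weight A e' \<and> Min L \<le> e'"
        using *(2) e' Min_le[OF \<open>finite L\<close>, of e'] by cases (auto simp: L_def)
    qed
  qed
  have "s \<noteq> 0" using s by auto
  from least[OF this] obtain e where e: "e \<in> keys s"
    and emin: "\<And>e'. e' \<in> keys s \<Longrightarrow>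
      weight A e < weight A e' \<or> weight A e = weight A e' \<and> e \<le> e'" by blast
  from least[OF False] obtain f where f: "f \<in> keys r"
    and fmin: "\<And>f'. f' \<in> keys r \<Longrightarrow>
      weight A f < weight A f' \<or> weight A f = weight A f' \<and> f \<le> f'" by blast
  define s' where "s' = s - single e (lookup s e)"
  define r' where "r' = r - single f (lookup r f)"
  have s': "keys s' \<subseteq> keys s - {e}"
    by (auto simp: s'_def in_keys_iff lookup_minus lookup_single when_def split: if_splits)
  have r': "keys r' \<subseteq> keys r - {f}"
    by (auto simp: r'_def in_keys_iff lookup_minus lookup_single when_def split: if_splits)
  have uniq: "e' = e \<and> f' = f"
    if "e' \<in> keys s" "f' \<in> keys r" "e' + f' = e + f" for e' f'
  proof -
    have "weight A e' + weight A f' = weight A e + weight A f"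
      using that(3) by (metis weight_add)
    then have "e \<le> e'" "f \<le> f'"
      using emin[OF that(1)] fmin[OF that(2)] by auto
    then show ?thesis using that(3) by (metis add_less_le_mono add_le_less_mono order_le_less order_less_irrefl)
  qed
  have "s * r = single (e + f) (lookup s e * lookup r f)
      + single e (lookup s e) * r' + s' * r"
    unfolding s'_def r'_def by (simp add: algebra_simps mult_single)
  moreover have "lookup (s' * r) (e + f) = 0"
  proof -
    have "e + f \<notin> keys (s' * r)"
    proof
      assume "e + f \<in> keys (s' * r)"
      then obtain e' f' where "e' \<in> keys s'" "f' \<in> keys r" "e' + f' = e + f"
        using keys_mult[of s' r] by fastforce
      then show False using uniq[of e' f'] s' by auto
    qed
    then show ?thesis by (simp add: in_keys_iff)
  qed
  moreover have "lookup (single e (lookup s e) * r') (e + f) = 0"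
  proof -
    have "e + f \<notin> keys (single e (lookup s e) * r')"
    proof
      assume "e + f \<in> keys (single e (lookup s e) * r')"
      then obtain e' f' where "e' \<in> keys (single e (lookup s e))"
        "f' \<in> keys r'" "e' + f' = e + f"
        using keys_mult[of "single e (lookup s e)" r'] by fastforce
      then show False using r' by (auto split: if_splits)
    qed
    then show ?thesis by (simp add: in_keys_iff)
  qed
  ultimately have "lookup (s * r) (e + f) = lookup s e * lookup r f"
    by (simp add: lookup_add)
  also have "\<dots> \<noteq> 0" using e f by (simp add: in_keys_iff)
  finally have "e + f \<in> keys (s * r)" by (simp add: in_keys_iff)
  then have "n \<le> weight A e + weight A f" using sr by (simp add: weight_ideal_def flip: weight_add)
  moreover have "weight A e = 0" using s emin by (fastforce simp: weight_ideal_def)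
  ultimately show ?thesis using fmin by (fastforce simp: weight_ideal_def)
qed auto

section \<open>Chains of prime ideals in the polynomial ring\<close>

definition exponents :: "nat \<Rightarrow> nat \<Rightarrow> nat list set" where
  "exponents n N = {e. set e \<subseteq> {..<N} \<and> length e = n}"

primrec monom_of :: "'a::comm_monoid_mult list \<Rightarrow> nat list \<Rightarrow> 'a" where
  "monom_of [] e = 1"
| "monom_of (x # xs) e = x ^ hd e * monom_of xs (tl e)"

lemma finite_exponents: "finite (exponents n N)"
  unfolding exponents_def by (rule finite_lists_length_eq) simp

lemma card_exponents: "card (exponents n N) = N ^ n"
  unfolding exponents_def by (simp add: card_lists_length_eq)

lemma sum_exponents_Suc:
  "(\<Sum>e\<in>exponents (Suc n) N. g e) = (\<Sum>m<N. \<Sum>e\<in>exponents n N. g (m # e))"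
proof -
  have "exponents (Suc n) N = (\<lambda>(m, e). m # e) ` ({..<N} \<times> exponents n N)"
    by (auto simp: exponents_def length_Suc_conv image_iff)
  moreover have "inj_on (\<lambda>(m, e). m # e) ({..<N} \<times> exponents n N)" by (auto simp: inj_on_def)
  ultimately show ?thesis by (simp add: sum.reindex sum.cartesian_product case_prod_unfold)
qed

lemma prime_setD:
  assumes "primeideal P (type_ring :: 'a::comm_ring_1 ring)"
  shows "0 \<in> P" "a \<in> P \<Longrightarrow> b \<in> P \<Longrightarrow> a + b \<in> P" "a \<in> P \<Longrightarrow> r * a \<in> P" "1 \<notin> P"
    "a * b \<in> P \<Longrightarrow> a \<in> P \<or> b \<in> P" "a \<in> P \<Longrightarrow> a + b \<in> P \<Longrightarrow> b \<in> P"
proof -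
  interpret cring "type_ring :: 'a ring" by (rule cring_from_type_algebra)
  interpret primeideal P "type_ring :: 'a ring" by fact
  have I: "ideal P (type_ring :: 'a ring)" by (rule is_ideal)
  show "0 \<in> P" using ideal_zero[OF I] by simp
  show "a \<in> P \<Longrightarrow> b \<in> P \<Longrightarrow> a + b \<in> P"
    using ideal_add[OF I, of a b] by simp
  show "a \<in> P \<Longrightarrow> r * a \<in> P" using I_l_closed[of a r] by simp
  show "1 \<notin> P" using primeideal_not_one[OF assms] by simp
  show "a * b \<in> P \<Longrightarrow> a \<in> P \<or> b \<in> P" using I_prime[of a b] by simp
  show "a \<in> P \<Longrightarrow> a + b \<in> P \<Longrightarrow> b \<in> P" using sum_mem_cancel[of a b] by simp
qed

text \<open>If each \<open>x\<^sub>i\<close> lies in \<open>P\<^sub>i\<^sub>+\<^sub>1\<close> but not in \<open>P\<^sub>i\<close>, then the \<open>x\<^sub>i\<close> are algebraically independent modulo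
  \<open>P\<^sub>0\<close>. In a relation, divide by the largest possible power of \<open>x\<^sub>0\<close>; this is allowed modulo \<open>P\<^sub>0\<close>, and
  modulo \<open>P\<^sub>1\<close> only the terms without \<open>x\<^sub>0\<close> remain, a relation between the other \<open>x\<^sub>i\<close>.\<close>

lemma monomials_independent_mod_prime:
  fixes xs :: "'k::field poly4 list"
  assumes "\<And>i. i \<le> length xs \<Longrightarrow> primeideal (P i) type_ring"
    and "\<And>i. i < length xs \<Longrightarrow> P i \<subseteq> P (Suc i)"
    and "\<And>i. i < length xs \<Longrightarrow> xs ! i \<in> P (Suc i) \<and> xs ! i \<notin> P i"
    and "(\<Sum>e\<in>exponents (length xs) N. single 0 (c e) * monom_of xs e) \<in> P 0"
    and "e \<in> exponents (length xs) N"
  shows "c e = 0"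
  using assms
proof (induction xs arbitrary: P c e)
  case Nil
  have "exponents 0 N = {[]}" by (auto simp: exponents_def)
  then have c: "single 0 (c []) \<in> P 0" and e: "e = []" using Nil by auto
  show ?case
  proof (rule ccontr)
    assume "c e \<noteq> 0"
    then have "single 0 (inverse (c [])) * single 0 (c []) = (1 :: 'k poly4)"
      using e by (simp add: mult_single)
    moreover have "single 0 (inverse (c [])) * single 0 (c []) \<in> P 0"
      using prime_setD(3)[OF Nil(1)[of 0] c] by simp
    ultimately show False using prime_setD(4)[OF Nil(1)[of 0]] by simp
  qed
next
  case (Cons x xs)
  define n where "n = length xs"
  define y where "y m = (\<Sum>e\<in>exponents n N. single 0 (c (m # e)) * monom_of xs e)" for m
  note P0 = prime_setD[OF Cons.prems(1)[of 0, simplified]]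
  note P1 = prime_setD[OF Cons.prems(1)[of 1, simplified]]
  have x: "x \<in> P 1" "x \<notin> P 0" using Cons.prems(3)[of 0] by auto
  have sub: "P 0 \<subseteq> P 1" using Cons.prems(2)[of 0] by simp
  have xpow: "x ^ m * q \<in> P 0 \<Longrightarrow> q \<in> P 0" for m q
    by (induction m) (use P0(5) x in \<open>auto simp: mult.assoc\<close>)
  have total: "(\<Sum>m<N. x ^ m * y m) \<in> P 0"
    using Cons.prems(4)
    by (simp add: sum_exponents_Suc y_def n_def sum_distrib_left mult_ac)
  have IH: "c (m # e) = 0" if "y m \<in> P 1" "e \<in> exponents n N" for m e
  proof (rule Cons.IH[of "\<lambda>i. P (Suc i)" "\<lambda>e. c (m # e)"])
    show "\<And>i. i \<le> length xs \<Longrightarrow> primeideal (P (Suc i)) type_ring"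
      using Cons.prems(1) by simp
    show "\<And>i. i < length xs \<Longrightarrow> P (Suc i) \<subseteq> P (Suc (Suc i))"
      using Cons.prems(2) by simp
    show "i < length xs \<Longrightarrow> xs ! i \<in> P (Suc (Suc i)) \<and> xs ! i \<notin> P (Suc i)" for i
      using Cons.prems(3)[of "Suc i"] by simp
  qed (use that in \<open>simp_all add: y_def n_def\<close>)
  have zero: "\<forall>e\<in>exponents n N. c (m # e) = 0" if "m < N" for m
    using that
  proof (induction m rule: less_induct)
    case (less m)
    have y0: "y m' = 0" if "m' < m" for m'
      using less that by (simp add: y_def)
    have "(\<Sum>m'<N. x ^ m' * y m') = (\<Sum>m'\<in>{m..<N}. x ^ m' * y m')"
      using y0 by (intro sum.mono_neutral_right) auto
    also have "\<dots> = x ^ m * y m + (\<Sum>m'\<in>{Suc m..<N}. x ^ m' * y m')"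
      using less.prems by (simp add: sum.atLeast_Suc_lessThan)
    also have "(\<Sum>m'\<in>{Suc m..<N}. x ^ m' * y m')
      = (\<Sum>m'\<in>{Suc m..<N}. x ^ m * (x * (x ^ (m' - Suc m) * y m')))"
    proof (rule sum.cong)
      fix m' assume "m' \<in> {Suc m..<N}"
      then have "x ^ m' = x ^ m * (x * x ^ (m' - Suc m))"
        by (simp flip: power_Suc power_add)
      then show "x ^ m' * y m' = x ^ m * (x * (x ^ (m' - Suc m) * y m'))"
        by (simp add: mult.assoc)
    qed simp
    also have "x ^ m * y m + \<dots> = x ^ m * (y m + x * (\<Sum>m'\<in>{Suc m..<N}. x ^ (m' - Suc m) * y m'))"
      by (simp add: sum_distrib_left distrib_left)
    finally have eq: "(\<Sum>m'<N. x ^ m' * y m')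
      = x ^ m * (y m + x * (\<Sum>m'\<in>{Suc m..<N}. x ^ (m' - Suc m) * y m'))" .
    have "y m + x * (\<Sum>m'\<in>{Suc m..<N}. x ^ (m' - Suc m) * y m') \<in> P 0"
      by (rule xpow[OF total[unfolded eq]])
    then have "x * (\<Sum>m'\<in>{Suc m..<N}. x ^ (m' - Suc m) * y m') + y m \<in> P 1"
      using sub by (auto simp: add.commute)
    moreover have "x * (\<Sum>m'\<in>{Suc m..<N}. x ^ (m' - Suc m) * y m') \<in> P 1"
      using P1(3)[of x "\<Sum>m'\<in>{Suc m..<N}. x ^ (m' - Suc m) * y m'"] x(1)
      by (simp add: mult.commute)
    ultimately have "y m \<in> P 1" using P1(6) unfolding One_nat_def by blast
    then show ?case using IH by blast
  qed
  obtain m e' where e': "e = m # e'" "m < N" "e' \<in> exponents n N"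
    using Cons.prems(5) by (auto simp: exponents_def length_Suc_conv n_def)
  show ?case using zero[OF e'(2)] e'(1,3) by blast
qed

definition bounded_exps :: "nat \<Rightarrow> 'k::comm_ring_1 poly4 \<Rightarrow> bool" where
  "bounded_exps D p \<longleftrightarrow> (\<forall>e\<in>keys p. \<forall>v. lookup e v \<le> D)"

lemma bounded_exps_mult: "bounded_exps D p \<Longrightarrow> bounded_exps D' q \<Longrightarrow> bounded_exps (D + D') (p * q)"
  using keys_mult[of p q] by (fastforce simp: bounded_exps_def lookup_add intro: add_mono)

lemma bounded_exps_mono: "bounded_exps D p \<Longrightarrow> D \<le> D' \<Longrightarrow> bounded_exps D' p"
  unfolding bounded_exps_def by (meson order_trans)

lemma bounded_exps_power: "bounded_exps D p \<Longrightarrow> bounded_exps (k * D) (p ^ k)"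
proof (induction k)
  case (Suc k)
  then show ?case using bounded_exps_mult[of D p "k * D" "p ^ k"] by simp
qed (simp add: bounded_exps_def)

lemma bounded_exps_exists: "\<exists>D. bounded_exps D p"
proof -
  define D where "D = Max ((\<lambda>(e, v). lookup e v) ` (keys p \<times> UNIV))"
  have "lookup e v \<le> D" if "e \<in> keys p" for e v
    unfolding D_def by (rule Max_ge) (use that in \<open>auto simp: image_iff\<close>)
  then show ?thesis by (auto simp: bounded_exps_def)
qed

lemma bounded_exps_monom_of:
  "\<forall>x\<in>set xs. bounded_exps d x \<Longrightarrow> e \<in> exponents (length xs) N \<Longrightarrow>
    bounded_exps (length xs * (N * d)) (monom_of xs e)"
proof (induction xs arbitrary: e)
  case (Cons x xs)
  then obtain m e' where e: "e = m # e'" "m < N" "e' \<in> exponents (length xs) N"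
    by (auto simp: exponents_def length_Suc_conv)
  have "bounded_exps (N * d) (x ^ m)"
    using bounded_exps_mono[OF bounded_exps_power[of d x m], of "N * d"] Cons.prems(1) e by simp
  from bounded_exps_mult[OF this Cons.IH[OF _ e(3)]] show ?case
    using Cons.prems(1) e by simp
qed (simp add: bounded_exps_def)

text \<open>Counting: the \<open>N\<^sup>5\<close> monomials with exponents below \<open>N\<close> in five polynomials lie in a space of
  dimension \<open>O(N\<^sup>4)\<close>, so five polynomials in four variables are algebraically dependent.\<close>

lemma algebraically_dependent:
  fixes xs :: "'k::field poly4 list"
  assumes len: "length xs = 5"
  shows "\<exists>N c. (\<Sum>e\<in>exponents 5 N. single 0 (c e) * monom_of xs e) = 0
    \<and> (\<exists>e\<in>exponents 5 N. c e \<noteq> 0)"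
proof -
  interpret V: vector_space "\<lambda>(c::'k) (p::'k poly4). single 0 c * p"
    by unfold_locales (simp_all add: distrib_left distrib_right single_add mult_single flip: mult.assoc)
  have "\<exists>d. \<forall>x\<in>set xs. bounded_exps d x"
  proof -
    obtain D where D: "\<And>x. bounded_exps (D x) (x :: 'k poly4)" using bounded_exps_exists by metis
    have "bounded_exps (Max (D ` set xs)) x" if "x \<in> set xs" for x
      by (rule bounded_exps_mono[OF D]) (use that in auto)
    then show ?thesis by blast
  qed
  then obtain d' where "\<forall>x\<in>set xs. bounded_exps d' x" by blast
  moreover define d where "d = Suc d'"
  ultimately have d: "\<forall>x\<in>set xs. bounded_exps d x" "d \<ge> 1"
    using bounded_exps_mono[of d' _ d] by auto
  \<comment> \<open>For \<open>N > (6 d)\<^sup>4\<close> the number \<open>N\<^sup>5\<close> of monomials in the \<open>x\<^sub>i\<close> exceeds the number of monomials with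
    exponents at most \<open>5 N d\<close>.\<close>
  define N where "N = (6 * d) ^ 4 + 1"
  define D where "D = 5 * (N * d)"
  define expo where "expo l = single VX (l ! 0) + single VY (l ! 1)
    + single VZ (l ! 2) + single VW (l ! 3)" for l :: "nat list"
  define B where "B = (\<lambda>l. single (expo l) (1::'k)) ` exponents 4 (Suc D)"
  have B: "finite B" "card B \<le> Suc D ^ 4"
    using card_image_le[OF finite_exponents, of _ 4 "Suc D"] finite_exponents
    by (auto simp: B_def card_exponents)
  have span: "p \<in> V.span B" if p: "bounded_exps D p" for p :: "'k poly4"
  proof -
    have "single e c \<in> V.span B" if e: "e \<in> keys p" for e and c :: 'k
    proof -
      define l where "l = map (lookup e) [VX, VY, VZ, VW]"
      have "l \<in> exponents 4 (Suc D)"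
        using p e by (auto simp: exponents_def l_def bounded_exps_def less_Suc_eq_le)
      moreover have "expo l = e"
      proof (rule poly_mapping_eqI)
        fix v show "lookup (expo l) v = lookup e v"
          by (cases v) (simp_all add: expo_def l_def lookup_add lookup_single when_def)
      qed
      ultimately have "single e 1 \<in> B" unfolding B_def by force
      from V.span_scale[OF V.span_base[OF this], of c] show ?thesis by (simp add: mult_single)
    qed
    then have "(\<Sum>e\<in>keys p. single e (lookup p e)) \<in> V.span B"
      by (intro V.span_sum)
    then show ?thesis by (simp only: sum_singles)
  qed
  have bounded: "monom_of xs e \<in> V.span B" if "e \<in> exponents 5 N" for e
    using span bounded_exps_monom_of[OF d(1), of e N] that by (simp add: len D_def)
  have "Suc D \<le> 6 * d * N" using d(2) by (simp add: D_def N_def)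
  then have "Suc D ^ 4 \<le> (6 * d * N) ^ 4" by (rule power_mono) simp
  also have "\<dots> = (6 * d) ^ 4 * N ^ 4" by (simp only: power_mult_distrib)
  also have "\<dots> < N * N ^ 4" unfolding N_def by (intro mult_strict_right_mono) simp_all
  also have "\<dots> = N ^ 5" by (simp add: eval_nat_numeral)
  finally have big: "card B < card (exponents 5 N)" using B(2) by (simp add: card_exponents)
  show ?thesis
  proof (cases "inj_on (monom_of xs) (exponents 5 N)")
    case True
    have "V.dependent (monom_of xs ` exponents 5 N)"
    proof (rule ccontr)
      assume ind: "\<not> ?thesis"
      have "monom_of xs ` exponents 5 N \<subseteq> V.span B" using bounded by blast
      from V.independent_span_bound[OF B(1) ind this] big card_image[OF True] show False by simp
    qed
    then obtain u where u: "\<exists>v\<in>monom_of xs ` exponents 5 N. u v \<noteq> 0"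
      "(\<Sum>v\<in>monom_of xs ` exponents 5 N. single 0 (u v) * v) = 0"
      using V.dependent_finite[OF finite_imageI[OF finite_exponents]] by blast
    then show ?thesis
      by (intro exI[of _ N] exI[of _ "\<lambda>e. u (monom_of xs e)"]) (auto simp: sum.reindex[OF True])
  next
    case False
    then obtain a b where ab: "a \<in> exponents 5 N" "b \<in> exponents 5 N" "a \<noteq> b"
      "monom_of xs a = monom_of xs b" by (auto simp: inj_on_def)
    define c where "c e = (if e = a then 1 else if e = b then - 1 else 0 :: 'k)" for e
    have "(\<Sum>e\<in>exponents 5 N. single 0 (c e) * monom_of xs e)
      = (\<Sum>e\<in>{a, b}. single 0 (c e) * monom_of xs e)"
      using ab by (intro sum.mono_neutral_right finite_exponents) (auto simp: c_def)
    also have "\<dots> = 0" using ab by (simp add: c_def single_uminus)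
    finally show ?thesis using ab(1) by (intro exI[of _ N] exI[of _ c]) (auto simp: c_def)
  qed
qed

text \<open>Choosing one element from each step of a chain of six primes would give five algebraically
  independent polynomials.\<close>

lemma no_prime_chain_6:
  fixes P :: "nat \<Rightarrow> 'k::field poly4 set"
  assumes prime: "\<And>i. i \<le> 5 \<Longrightarrow> primeideal (P i) type_ring"
    and strict: "\<And>i. i < 5 \<Longrightarrow> P i \<subset> P (Suc i)"
  shows False
proof -
  have "\<forall>i. \<exists>x. i < 5 \<longrightarrow> x \<in> P (Suc i) - P i" using strict by blast
  then obtain x where x: "\<And>i. i < 5 \<Longrightarrow> x i \<in> P (Suc i) - P i" by metis
  define xs where "xs = map x [0..<5]"
  have len: "length xs = 5" by (simp add: xs_def)
  obtain N c e where rel: "(\<Sum>e\<in>exponents 5 N. single 0 (c e) * monom_of xs e) = 0"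
    and e: "e \<in> exponents 5 N" "c e \<noteq> 0"
    using algebraically_dependent[OF len] by blast
  have "c e = 0"
  proof (rule monomials_independent_mod_prime[where xs = xs and P = P and N = N])
    show "(\<Sum>e\<in>exponents (length xs) N. single 0 (c e) * monom_of xs e) \<in> P 0"
      using rel prime_setD(1)[OF prime[of 0]] by (simp add: len)
    show "i < length xs \<Longrightarrow> xs ! i \<in> P (Suc i) \<and> xs ! i \<notin> P i" for i
      using x[of i] by (simp add: xs_def)
  qed (use prime strict e len in auto)
  then show False using e by blast
qed

text \<open>The variables generate the polynomial ring over the field of constants.\<close>

lemma noetherian_poly4: "noetherian_ring (type_ring :: 'k::field poly4 ring)"
proof -
  define S where "S = (type_ring :: 'k poly4 ring)"
  interpret S: cring S unfolding S_def by (rule cring_from_type_algebra)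
  define K where "K = range (\<lambda>c::'k. single (0 :: var \<Rightarrow>\<^sub>0 nat) c)"
  have minus: "\<ominus>\<^bsub>S\<^esub> p = - p" for p
    by (rule S.minus_equality) (simp_all add: S_def)
  have K: "subring K S"
  proof (rule S.subringI)
    show "\<one>\<^bsub>S\<^esub> \<in> K" by (auto simp: S_def K_def image_iff intro!: exI[of _ 1] simp flip: single_one)
  qed (auto simp: K_def S_def minus[unfolded S_def] mult_single simp flip: single_uminus single_add)
  have "noetherian_ring (S\<lparr>carrier := K\<rparr>)"
  proof (rule noetherian_ring_fractions)
    interpret k: field "type_ring :: 'k ring" by (rule field_from_type_algebra)
    show "noetherian_ring (type_ring :: 'k ring)"
    proof (rule k.noetherian_ringI)
      fix I assume "ideal I (type_ring :: 'k ring)"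
      then have "I = {\<zero>\<^bsub>type_ring\<^esub>} \<or> I = carrier type_ring"
        using k.all_ideals by blast
      then have "I = Idl\<^bsub>type_ring\<^esub> {\<zero>\<^bsub>type_ring\<^esub>}
        \<or> I = Idl\<^bsub>type_ring\<^esub> {\<one>\<^bsub>type_ring\<^esub>}"
        by (simp only: k.genideal_zero k.genideal_one)
      then show "\<exists>A\<subseteq>carrier type_ring. finite A \<and> I = Idl\<^bsub>type_ring\<^esub> A"
        by (metis finite.emptyI finite.insertI type_ring_simps(1) subset_UNIV)
    qed
    show "cring (S\<lparr>carrier := K\<rparr>)"
      using K by (simp add: S.subcring_iff[OF subringE(1)[OF K], symmetric] S.subcringI')
    then have "ring (S\<lparr>carrier := K\<rparr>)" by (rule cring.axioms)
    then show "ring_hom_ring type_ring (S\<lparr>carrier := K\<rparr>) (single 0)"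
      by (intro ring_hom_ringI k.ring_axioms) (auto simp: S_def K_def mult_single single_add)
    fix b assume "b \<in> carrier (S\<lparr>carrier := K\<rparr>)"
    then obtain c where c: "b = single 0 c" by (auto simp: K_def)
    show "\<exists>a\<in>carrier type_ring. \<exists>s\<in>carrier type_ring.
      single 0 s \<in> Units (S\<lparr>carrier := K\<rparr>) \<and>
      single 0 s \<otimes>\<^bsub>S\<lparr>carrier := K\<rparr>\<^esub> b = single 0 a"
    proof (rule bexI[of _ c], rule bexI[of _ 1], rule conjI)
      have "\<one>\<^bsub>S\<lparr>carrier := K\<rparr>\<^esub> \<in> Units (S\<lparr>carrier := K\<rparr>)"
        using \<open>ring (S\<lparr>carrier := K\<rparr>)\<close> by (intro monoid.Units_one_closed ring.is_monoid)
      then show "single 0 1 \<in> Units (S\<lparr>carrier := K\<rparr>)" by (simp add: S_def)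
    qed (auto simp: c S_def)
  qed
  then obtain B where B: "subring B S" "K \<subseteq> B" "range Var \<subseteq> B" "noetherian_ring (S\<lparr>carrier := B\<rparr>)"
    using S.finitely_generated_noetherian[OF _ _ K, of "range Var"] by (auto simp: S_def)
  have "p \<in> B" for p
    by (rule poly_in_generated_set)
      (use B subringE(6,7)[OF B(1)] in \<open>auto simp: K_def S_def\<close>)
  then have "B = carrier S" by (auto simp: S_def)
  moreover have "S\<lparr>carrier := carrier S\<rparr> = S" by simp
  ultimately have "noetherian_ring S" using B(4) by simp
  then show ?thesis by (simp add: S_def)
qed

section \<open>Quotients and local rings\<close>

lemma (in cring) Quot_facts:
  assumes "ideal I R"
  shows Quot_hom: "ring_hom_ring R (R Quot I) ((+>) I)"
    and Quot_cring: "cring (R Quot I)"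
    and Quot_carrier: "carrier (R Quot I) = {I +> r | r. r \<in> carrier R}"
    and Quot_zero: "r \<in> carrier R \<Longrightarrow> I +> r = \<zero>\<^bsub>R Quot I\<^esub> \<longleftrightarrow> r \<in> I"
    and Quot_eq: "r \<in> carrier R \<Longrightarrow> s \<in> carrier R \<Longrightarrow> I +> r = I +> s \<longleftrightarrow> r \<ominus> s \<in> I"
proof -
  show "ring_hom_ring R (R Quot I) ((+>) I)" by (rule ideal.rcos_ring_hom_ring[OF assms])
  show "cring (R Quot I)" by (rule ideal.quotient_is_cring[OF assms is_cring])
  show "carrier (R Quot I) = {I +> r | r. r \<in> carrier R}"
    unfolding FactRing_def A_RCOSETS_def' by auto
  show "I +> r = \<zero>\<^bsub>R Quot I\<^esub> \<longleftrightarrow> r \<in> I" if "r \<in> carrier R"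
    using ideal.rcos_const_imp_mem[OF assms that] a_rcos_zero[OF assms, of r]
    by (auto simp: FactRing_def)
  show "r \<in> carrier R \<Longrightarrow> s \<in> carrier R \<Longrightarrow> I +> r = I +> s \<longleftrightarrow> r \<ominus> s \<in> I"
    using quotient_eq_iff_same_a_r_cos[OF assms] by simp
qed

lemma assoc_primes_iff:
  assumes "cring R" "ideal I R"
  shows "p \<in> assoc_primes R I \<longleftrightarrow>
    primeideal p R \<and> (\<exists>y\<in>carrier R. p = {r \<in> carrier R. r \<otimes>\<^bsub>R\<^esub> y \<in> I})"
proof -
  interpret cring R by fact
  interpret h: ring_hom_ring R "R Quot I" "(+>\<^bsub>R\<^esub>) I" by (rule Quot_hom[OF assms(2)])
  have "(I +>\<^bsub>R\<^esub> r) \<otimes>\<^bsub>R Quot I\<^esub> (I +>\<^bsub>R\<^esub> y) = \<zero>\<^bsub>R Quot I\<^esub> \<longleftrightarrow> r \<otimes>\<^bsub>R\<^esub> y \<in> I"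
    if "y \<in> carrier R" "r \<in> carrier R" for y r
    using that Quot_zero[OF assms(2), of "r \<otimes>\<^bsub>R\<^esub> y"] h.hom_mult[of r y] by simp
  then have "{r \<in> carrier R. (I +>\<^bsub>R\<^esub> r) \<otimes>\<^bsub>R Quot I\<^esub> (I +>\<^bsub>R\<^esub> y) = \<zero>\<^bsub>R Quot I\<^esub>}
    = {r \<in> carrier R. r \<otimes>\<^bsub>R\<^esub> y \<in> I}" if "y \<in> carrier R" for y
    using that by blast
  then show ?thesis unfolding assoc_primes_def Quot_carrier[OF assms(2)] by auto
qed

lemma primeideal_vimage:
  assumes "ring_hom_ring A B h" "cring A" "primeideal p B"
  shows "primeideal {r \<in> carrier A. h r \<in> p} A"
proof -
  interpret p: primeideal p B by fact
  interpret h: ring_hom_ring A B h by fact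
  show ?thesis
  proof (rule primeidealI)
    show "ideal {r \<in> carrier A. h r \<in> p} A" by (rule h.ideal_vimage[OF p.is_ideal])
    have "\<one>\<^bsub>B\<^esub> \<notin> p" using cring.primeideal_not_one[OF p.is_cring assms(3)] .
    then show "carrier A \<noteq> {r \<in> carrier A. h r \<in> p}" using h.hom_one by (metis (mono_tags, lifting) h.R.one_closed mem_Collect_eq)
    fix a b assume "a \<in> carrier A" "b \<in> carrier A" "a \<otimes>\<^bsub>A\<^esub> b \<in> {r \<in> carrier A. h r \<in> p}"
    then show "a \<in> {r \<in> carrier A. h r \<in> p} \<or> b \<in> {r \<in> carrier A. h r \<in> p}"
      using p.I_prime[of "h a" "h b"] by auto
  qed fact
qed

lemma local_ringI:
  assumes "cring Q" and M: "ideal M Q" "\<one>\<^bsub>Q\<^esub> \<notin> M"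
    and units: "\<And>x. x \<in> carrier Q \<Longrightarrow> x \<notin> M \<Longrightarrow> x \<in> Units Q"
  shows "is_local_ring Q" "the_maximal_ideal Q = M"
proof -
  interpret cring Q by fact
  interpret M: ideal M Q by fact
  have sub: "J \<subseteq> M" if J: "ideal J Q" "J \<noteq> carrier Q" for J
  proof
    fix x assume x: "x \<in> J"
    show "x \<in> M"
    proof (rule ccontr)
      assume "x \<notin> M"
      moreover have "x \<in> carrier Q" using ideal.Icarr[OF J(1) x] .
      ultimately have u: "x \<in> Units Q" using units by blast
      have "\<one>\<^bsub>Q\<^esub> \<in> J" using unit_mult_mem_ideal[OF J(1) u, of "\<one>\<^bsub>Q\<^esub>"] x u by (simp add: Units_closed)
      then show False using ideal.one_imp_carrier[OF J(1)] J(2) by blast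
    qed
  qed
  have max: "maximalideal M Q"
  proof (rule maximalidealI[OF M(1)])
    show "carrier Q \<noteq> M" using M(2) by auto
    show "J = M \<or> J = carrier Q" if "ideal J Q" "M \<subseteq> J" for J
      using sub[OF that(1)] that(2) by blast
  qed
  have uniq: "N = M" if "maximalideal N Q" for N
  proof -
    have N: "ideal N Q" "carrier Q \<noteq> N"
      using that maximalideal.axioms(1) maximalideal.I_notcarr by blast+
    then have "N \<subseteq> M" using sub by auto
    then show ?thesis using maximalideal.I_maximal[OF that M(1)] M.a_subset M(2) by auto
  qed
  show "is_local_ring Q"
    unfolding is_local_ring_def using \<open>cring Q\<close> max uniq by blast
  show "the_maximal_ideal Q = M"
    unfolding the_maximal_ideal_def by (rule the_equality) (fact max, fact uniq)
qed

section \<open>Local rings of the polynomial ring at the origin\<close>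

text \<open>The localization of the polynomial ring at the origin, up to isomorphism. Since \<open>\<eta>\<close> need not be the
  canonical map, it can absorb a change of coordinates, after which the Jacobian ideal is generated by
  monomials.\<close>

locale local_poly_ring = cring R for R (structure) +
  fixes \<eta> :: "'k::field poly4 \<Rightarrow> 'a"
  assumes hom: "ring_hom_ring type_ring R \<eta>"
    and inj: "\<And>p q. \<eta> p = \<eta> q \<Longrightarrow> p = q"
    and unit: "\<And>s. lookup s 0 \<noteq> 0 \<Longrightarrow> \<eta> s \<in> Units R"
    and numerator: "\<And>r. r \<in> carrier R \<Longrightarrow> \<exists>p s. lookup s 0 \<noteq> 0 \<and> \<eta> s \<otimes> r = \<eta> p"
begin

lemma \<eta>_simps [simp]:
  "\<eta> p \<in> carrier R" "\<eta> (p + q) = \<eta> p \<oplus> \<eta> q" "\<eta> (p * q) = \<eta> p \<otimes> \<eta> q" "\<eta> 1 = \<one>" "\<eta> 0 = \<zero>"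
proof -
  interpret h: ring_hom_ring type_ring R \<eta> by (rule hom)
  show "\<eta> p \<in> carrier R" using h.hom_closed by simp
  show "\<eta> (p + q) = \<eta> p \<oplus> \<eta> q" using h.hom_add[of p q] by simp
  show "\<eta> (p * q) = \<eta> p \<otimes> \<eta> q" using h.hom_mult[of p q] by simp
  show "\<eta> 1 = \<one>" using h.hom_one by simp
  show "\<eta> 0 = \<zero>" using h.hom_zero by simp
qed

lemma \<eta>_uminus: "\<eta> (- p) = \<ominus> \<eta> p"
proof -
  have "\<eta> (- p) \<oplus> \<eta> p = \<zero>" by (simp flip: \<eta>_simps(2))
  then show ?thesis by (simp add: minus_equality)
qed

lemma \<eta>_diff: "\<eta> (p - q) = \<eta> p \<ominus> \<eta> q"
  using \<eta>_simps(2)[of p "- q"] \<eta>_uminus[of q] by (simp add: a_minus_def)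

lemma common_numerators:
  assumes "r \<in> carrier R" "r' \<in> carrier R"
  obtains p p' s where "lookup s 0 \<noteq> 0" "\<eta> s \<otimes> r = \<eta> p" "\<eta> s \<otimes> r' = \<eta> p'"
proof -
  obtain p s p' s' where *: "lookup s 0 \<noteq> 0" "\<eta> s \<otimes> r = \<eta> p"
    "lookup s' 0 \<noteq> 0" "\<eta> s' \<otimes> r' = \<eta> p'"
    using numerator[OF assms(1)] numerator[OF assms(2)] by blast
  have "s * s' \<notin> weight_ideal UNIV 1"
    using weight_ideal_cancel[of s UNIV s' 1] * by (auto simp: weight_ideal_UNIV simp del: One_nat_def)
  then have "lookup (s * s') 0 \<noteq> 0" by (simp add: weight_ideal_UNIV del: One_nat_def)
  moreover have "\<eta> (s * s') \<otimes> r = \<eta> (s' * p)" "\<eta> (s * s') \<otimes> r' = \<eta> (s * p')"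
    using assms by (simp_all add: m_ac flip: *(2,4))
  ultimately show thesis by (rule that)
qed

lemma origin_notin: "lookup s 0 \<noteq> 0 \<Longrightarrow> s \<notin> weight_ideal A 1"
  using weight_ideal_mono[of A UNIV 1 1] weight_ideal_UNIV[of s] by blast

text \<open>The extension of the weight ideal to the local ring, in a form that allows to check membership on any
  numerator.\<close>

definition wideal :: "var set \<Rightarrow> nat \<Rightarrow> 'a set" where
  "wideal A n = {r \<in> carrier R. \<exists>p s. lookup s 0 \<noteq> 0 \<and> \<eta> s \<otimes> r = \<eta> p \<and> p \<in> weight_ideal A n}"

lemma wideal_iff:
  assumes "r \<in> carrier R" "lookup s 0 \<noteq> 0" "\<eta> s \<otimes> r = \<eta> p"
  shows "r \<in> wideal A n \<longleftrightarrow> p \<in> weight_ideal A n"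
proof
  assume "r \<in> wideal A n"
  then obtain p' s' where *: "lookup s' 0 \<noteq> 0" "\<eta> s' \<otimes> r = \<eta> p'" "p' \<in> weight_ideal A n"
    unfolding wideal_def by blast
  have "\<eta> (s' * p) = \<eta> (s * p')"
    using assms(1) by (simp add: m_ac flip: assms(3) *(2))
  then have "s' * p = s * p'" by (rule inj)
  then have "s' * p \<in> weight_ideal A n" using weight_ideal_smult[OF *(3)] by simp
  then show "p \<in> weight_ideal A n" using weight_ideal_cancel[OF origin_notin[OF *(1)]] by blast
qed (use assms in \<open>auto simp: wideal_def\<close>)

lemma \<eta>_wideal_iff: "\<eta> p \<in> wideal A n \<longleftrightarrow> p \<in> weight_ideal A n"
  by (rule wideal_iff[where s = 1]) simp_all

lemma wideal_carrier: "r \<in> wideal A n \<Longrightarrow> r \<in> carrier R"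
  by (simp add: wideal_def)

lemma wideal_0: "wideal A 0 = carrier R"
  using numerator by (auto simp: wideal_def)

lemma wideal_mult:
  assumes "r \<in> wideal A m" "r' \<in> wideal A n"
  shows "r \<otimes> r' \<in> wideal A (m + n)"
proof -
  have c: "r \<in> carrier R" "r' \<in> carrier R" using assms wideal_carrier by auto
  obtain p p' s where *: "lookup s 0 \<noteq> 0" "\<eta> s \<otimes> r = \<eta> p" "\<eta> s \<otimes> r' = \<eta> p'"
    using common_numerators[OF c] .
  have "p * p' \<in> weight_ideal A (m + n)"
    using assms wideal_iff[OF c(1) *(1,2)] wideal_iff[OF c(2) *(1,3)] by (auto intro: weight_ideal_mult)
  moreover have "\<eta> (s * s) \<otimes> (r \<otimes> r') = \<eta> (p * p')"
    using c by (simp add: m_ac flip: *(2,3))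
  moreover have "lookup (s * s) 0 \<noteq> 0"
    using weight_ideal_cancel[of s UNIV s 1] origin_notin[OF *(1)] weight_ideal_UNIV[of "s * s"] by blast
  ultimately show ?thesis using wideal_iff[of "r \<otimes> r'" "s * s" "p * p'"] c by blast
qed

lemma wideal_ideal: "ideal (wideal A n) R"
proof (rule ideal_cringI)
  show "wideal A n \<subseteq> carrier R" using wideal_carrier by blast
  show "\<zero> \<in> wideal A n" using \<eta>_wideal_iff[of 0] by simp
  fix r r' assume r: "r \<in> wideal A n" "r' \<in> wideal A n"
  have c: "r \<in> carrier R" "r' \<in> carrier R" using r wideal_carrier by auto
  obtain p p' s where *: "lookup s 0 \<noteq> 0" "\<eta> s \<otimes> r = \<eta> p" "\<eta> s \<otimes> r' = \<eta> p'"
    using common_numerators[OF c] .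
  have "p + p' \<in> weight_ideal A n"
    using r wideal_iff[OF c(1) *(1,2)] wideal_iff[OF c(2) *(1,3)] by (auto intro: weight_ideal_add)
  moreover have "\<eta> s \<otimes> (r \<oplus> r') = \<eta> (p + p')"
    using c by (simp add: r_distr flip: *(2,3))
  ultimately show "r \<oplus> r' \<in> wideal A n" using wideal_iff[of "r \<oplus> r'" s "p + p'"] c *(1) by auto
next
  fix r a assume "r \<in> carrier R" "a \<in> wideal A n"
  then show "r \<otimes> a \<in> wideal A n" using wideal_mult[of r A 0 a n] by (simp add: wideal_0)
qed

lemma wideal_cancel:
  assumes c: "r \<in> carrier R" "r' \<in> carrier R" and r: "r \<notin> wideal A 1" and "r \<otimes> r' \<in> wideal A n"
  shows "r' \<in> wideal A n"
proof -
  obtain p p' s where *: "lookup s 0 \<noteq> 0" "\<eta> s \<otimes> r = \<eta> p" "\<eta> s \<otimes> r' = \<eta> p'"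
    using common_numerators[OF c] .
  have "\<eta> (s * s) \<otimes> (r \<otimes> r') = \<eta> (p * p')"
    using c by (simp add: m_ac flip: *(2,3))
  moreover have "\<eta> (s * s) \<otimes> (r \<otimes> r') \<in> wideal A n"
    using ideal.I_l_closed[OF wideal_ideal assms(4)] by simp
  ultimately have "p * p' \<in> weight_ideal A n" using \<eta>_wideal_iff by metis
  moreover have "p \<notin> weight_ideal A 1" using r wideal_iff[OF c(1) *(1,2)] by blast
  ultimately have "p' \<in> weight_ideal A n" using weight_ideal_cancel by blast
  then show ?thesis using wideal_iff[OF c(2) *(1,3)] by blast
qed

lemma wideal_prime: "primeideal (wideal A 1) R"
proof (rule primeidealI[OF wideal_ideal is_cring])
  have "\<eta> 1 \<notin> wideal A 1" unfolding \<eta>_wideal_iff by (rule not_one_in_weight_ideal) simp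
  then show "carrier R \<noteq> wideal A 1" using \<eta>_simps(1) by blast
qed (use wideal_cancel[of _ _ A 1] in blast)

lemma wideal_mono: "A \<subseteq> B \<Longrightarrow> wideal A n \<subseteq> wideal B n"
  using weight_ideal_mono[of A B n n] by (auto simp: wideal_def)

lemma Var_wideal_iff: "\<eta> (Var v) \<in> wideal A 1 \<longleftrightarrow> v \<in> A"
  unfolding \<eta>_wideal_iff Var_def by (simp add: single_in_weight_ideal_iff weight_single)

lemma wideal_subset_iff: "wideal A 1 \<subseteq> wideal B 1 \<longleftrightarrow> A \<subseteq> B"
  using wideal_mono[of A B 1] Var_wideal_iff by blast

lemma wideal_psubset: "A \<subset> B \<Longrightarrow> wideal A 1 \<subset> wideal B 1"
  using wideal_subset_iff by (metis psubsetE psubsetI subset_antisym)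

lemma wideal_empty: "wideal {} 1 = {\<zero>}"
proof -
  have "r = \<zero>" if r: "r \<in> wideal {} 1" for r
  proof -
    have c: "r \<in> carrier R" using wideal_carrier[OF r] .
    obtain p s where *: "lookup s 0 \<noteq> 0" "\<eta> s \<otimes> r = \<eta> p"
      using numerator[OF c] by blast
    have "p = 0" using r wideal_iff[OF c *, of "{}" 1] unfolding weight_ideal_empty by simp
    then have "\<eta> s \<otimes> r \<in> {\<zero>}" using * by simp
    then show ?thesis using unit_mult_mem_ideal[OF zeroideal unit[OF *(1)] c] by blast
  qed
  then show ?thesis using ideal_zero[OF wideal_ideal] by blast
qed

lemma domain_R: "domain R"
  by (rule zeroprimeideal_domainI) (use wideal_prime[of "{}"] wideal_empty in simp)

lemma unit_outside_origin:
  assumes c: "r \<in> carrier R" and r: "r \<notin> wideal UNIV 1" shows "r \<in> Units R"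
proof -
  obtain p s where *: "lookup s 0 \<noteq> 0" "\<eta> s \<otimes> r = \<eta> p"
    using numerator[OF c] by blast
  then have "p \<notin> weight_ideal UNIV 1" using r wideal_iff[OF c *] by blast
  then have "\<eta> p \<in> Units R" using unit weight_ideal_UNIV by blast
  then show ?thesis using unit_factor[of r "\<eta> s"] *(2) c by (simp add: m_comm)
qed

lemma local_R: "is_local_ring R" "the_maximal_ideal R = wideal UNIV 1"
  using local_ringI[OF is_cring wideal_ideal primeideal_not_one[OF wideal_prime] unit_outside_origin] by blast+

lemma noetherian_R: "noetherian_ring R"
proof (rule noetherian_ring_fractions[OF hom noetherian_poly4 is_cring])
  fix b assume "b \<in> carrier R"
  from numerator[OF this] show "\<exists>a\<in>carrier type_ring. \<exists>s\<in>carrier type_ring.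
    \<eta> s \<in> Units R \<and> \<eta> s \<otimes> b = \<eta> a" using unit by auto
qed

text \<open>Numerators of elements that separate consecutive primes separate their preimages.\<close>

lemma prime_chain_length:
  assumes "prime_chain R ps" shows "length ps \<le> 5"
proof (rule ccontr)
  assume len: "\<not> ?thesis"
  define P where "P i = {p \<in> carrier type_ring. \<eta> p \<in> ps ! i}" for i
  show False
  proof (rule no_prime_chain_6[of P])
    fix i :: nat
    show "primeideal (P i) type_ring" if "i \<le> 5"
      unfolding P_def
      using assms len that
      by (intro primeideal_vimage[OF hom cring_from_type_algebra]) (auto simp: prime_chain_def)
    show "P i \<subset> P (Suc i)" if i: "i < 5"
    proof -
      have sub: "ps ! i \<subset> ps ! Suc i"
        using assms len i sorted_wrt_nth_less[of "(\<subset>)" ps i "Suc i"] by (auto simp: prime_chain_def)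
      have pr: "primeideal (ps ! i) R" "primeideal (ps ! Suc i) R"
        using assms len i by (auto simp: prime_chain_def)
      obtain r where r: "r \<in> ps ! Suc i" "r \<notin> ps ! i" using sub by blast
      have I: "ideal (ps ! i) R" "ideal (ps ! Suc i) R" using pr primeideal.axioms(1) by blast+
      have c: "r \<in> carrier R" using ideal.Icarr[OF I(2) r(1)] .
      obtain p s where *: "lookup s 0 \<noteq> 0" "\<eta> s \<otimes> r = \<eta> p"
        using numerator[OF c] by blast
      have "\<eta> p \<in> ps ! Suc i" using ideal.I_l_closed[OF I(2) r(1), of "\<eta> s"] *(2) by simp
      moreover have "\<eta> p \<notin> ps ! i"
        using unit_mult_mem_ideal[OF I(1) unit[OF *(1)] c] r(2) *(2) by auto
      ultimately show ?thesis using sub unfolding P_def by auto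
    qed
  qed
qed

subsection \<open>The ideal generated by the products of two of three coordinates\<close>

text \<open>The variables \<open>VW\<close>, \<open>VX\<close>, \<open>VZ\<close> stand for \<open>u\<close>, \<open>v\<close>, \<open>c\<close>. The three components of \<open>\<aa>\<close> are indexed by the
  coordinate that does not occur in them.\<close>

definition others :: "var \<Rightarrow> var set" where
  "others d = coords - {d}"

abbreviation (input) "component d \<equiv> wideal (others d)"

definition \<aa> where
  "\<aa> = Idl {\<eta> (Var i * Var j) | i j. i \<in> coords \<and> j \<in> coords \<and> i \<noteq> j}"

lemma gens_carrier:
  "{\<eta> (Var i * Var j) | i j. i \<in> coords \<and> j \<in> coords \<and> i \<noteq> j} \<subseteq> carrier R"
  by auto

lemma \<aa>_ideal: "ideal \<aa> R"
  unfolding \<aa>_def by (rule genideal_ideal[OF gens_carrier])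

lemma gen_in_\<aa>: "i \<in> coords \<Longrightarrow> j \<in> coords \<Longrightarrow> i \<noteq> j \<Longrightarrow> \<eta> (Var i * Var j) \<in> \<aa>"
  unfolding \<aa>_def by (rule subsetD[OF genideal_self[OF gens_carrier]]) blast

lemma \<aa>_subset_ideal:
  assumes "ideal I R"
    and "\<And>i j. i \<in> coords \<Longrightarrow> j \<in> coords \<Longrightarrow> i \<noteq> j \<Longrightarrow> \<eta> (Var i * Var j) \<in> I"
  shows "\<aa> \<subseteq> I"
  unfolding \<aa>_def by (rule genideal_minimal[OF assms(1)]) (use assms(2) in blast)

lemma monomials_in_ideal:
  assumes I: "ideal I R"
    and "\<And>e. e \<in> keys p \<Longrightarrow> \<eta> (single e (lookup p e)) \<in> I"
  shows "\<eta> p \<in> I"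
proof -
  have "p \<in> {p. \<eta> p \<in> I}"
    by (rule poly_in_additive_set) (use assms ideal_zero[OF I] ideal_add[OF I] in auto)
  then show ?thesis by simp
qed

text \<open>A monomial that is divisible by a coordinate from each of the three pairs is divisible by two of them.\<close>

lemma \<aa>_eq: "\<aa> = {r \<in> carrier R. \<forall>d\<in>coords. r \<in> component d 1}"
proof
  have "\<eta> (Var i * Var j) \<in> component d 1"
    if ij: "i \<in> coords" "j \<in> coords" "i \<noteq> j" for i j d
  proof -
    have "i \<in> others d \<or> j \<in> others d" using ij by (auto simp: others_def)
    then have "1 \<le> weight (others d) (single i 1 + single j 1)"
      by (auto simp: weight_add weight_single)
    then show ?thesis
      unfolding \<eta>_wideal_iff Var_def mult_single by (rule single_in_weight_ideal)
  qed
  then have "\<aa> \<subseteq> component d 1" for d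
    by (intro \<aa>_subset_ideal wideal_ideal)
  then show "\<aa> \<subseteq> {r \<in> carrier R. \<forall>d\<in>coords. r \<in> component d 1}"
    using wideal_carrier by blast
  show "{r \<in> carrier R. \<forall>d\<in>coords. r \<in> component d 1} \<subseteq> \<aa>"
  proof clarify
    fix r assume c: "r \<in> carrier R" and all: "\<forall>d\<in>coords. r \<in> component d 1"
    obtain p s where *: "lookup s 0 \<noteq> 0" "\<eta> s \<otimes> r = \<eta> p"
      using numerator[OF c] by blast
    have W: "p \<in> weight_ideal (others d) 1" if "d \<in> coords" for d
      using all that wideal_iff[OF c *] by blast
    have "\<eta> p \<in> \<aa>"
    proof (rule monomials_in_ideal[OF \<aa>_ideal])
      fix e assume e: "e \<in> keys p"
      define c where "c = lookup p e"
      have w: "\<exists>i\<in>others d. lookup e i \<noteq> 0" if "d \<in> coords" for d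
      proof (rule ccontr)
        assume "\<not> ?thesis"
        then have "weight (others d) e = 0" by (simp add: weight_def)
        then show False using W[OF that] e by (auto simp: weight_ideal_def)
      qed
      obtain i where i: "i \<in> coords" "lookup e i \<noteq> 0"
        using w[of VX] by (auto simp: others_def)
      obtain j where j: "j \<in> coords" "i \<noteq> j" "lookup e j \<noteq> 0"
        using w[OF i(1)] by (auto simp: others_def)
      have j': "lookup (e - single i 1) j \<noteq> 0"
        using j by (simp add: lookup_minus lookup_single when_def)
      have "single e c = Var i * (Var j *
          single (e - single i 1 - single j 1) c)"
        by (simp only: single_factor_Var(1)[OF i(2), of c] single_factor_Var(1)[OF j', of c])
      then have "\<eta> (single e c) = \<eta> (Var i * Var j) \<otimes>
          \<eta> (single (e - single i 1 - single j 1) c)"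
        by (simp add: m_assoc)
      then show "\<eta> (single e (lookup p e)) \<in> \<aa>"
        unfolding c_def[symmetric]
        using ideal.I_r_closed[OF \<aa>_ideal gen_in_\<aa>[OF i(1) j(1,2)]] by simp
    qed
    then show "r \<in> \<aa>" using unit_mult_mem_ideal[OF \<aa>_ideal unit[OF *(1)] c] *(2) by simp
  qed
qed

lemma prime_over_\<aa>:
  assumes q: "primeideal q R" and sub: "\<aa> \<subseteq> q"
  shows "\<exists>d\<in>coords. component d 1 \<subseteq> q"
proof (rule ccontr)
  interpret q: primeideal q R by (rule q)
  assume "\<not> ?thesis"
  then have "\<forall>d\<in>coords. \<exists>r. r \<in> component d 1 \<and> r \<notin> q" by blast
  then obtain f where f: "\<And>d. d \<in> coords \<Longrightarrow> f d \<in> component d 1 \<and> f d \<notin> q"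
    by metis
  then have c: "f VX \<in> carrier R" "f VZ \<in> carrier R" "f VW \<in> carrier R"
    using wideal_carrier by blast+
  have I: "r \<in> carrier R \<Longrightarrow> a \<in> component d 1 \<Longrightarrow> r \<otimes> a \<in> component d 1"
    "r \<in> carrier R \<Longrightarrow> a \<in> component d 1 \<Longrightarrow> a \<otimes> r \<in> component d 1" for r a d
    using ideal.I_l_closed[OF wideal_ideal] ideal.I_r_closed[OF wideal_ideal] by blast+
  have "f VX \<otimes> (f VZ \<otimes> f VW) \<in> \<aa>"
    unfolding \<aa>_eq using I f c by auto
  then have "f VX \<otimes> (f VZ \<otimes> f VW) \<in> q" using sub by blast
  then show False using q.I_prime[of "f VX" "f VZ \<otimes> f VW"] q.I_prime[of "f VZ" "f VW"] c f by auto
qed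

lemma \<aa>_subset_wideal: "d \<in> coords \<Longrightarrow> \<aa> \<subseteq> component d 1"
  unfolding \<aa>_eq by blast

lemma others_eq: "d \<in> coords \<Longrightarrow> d' \<in> coords \<Longrightarrow> others d \<subseteq> others d' \<Longrightarrow> d = d'"
  by (auto simp: others_def)

text \<open>Each component is the colon ideal of \<open>\<aa>\<close> by the missing coordinate. Conversely, a prime \<open>\<aa> : y\<close> lies in
  every component that does not contain \<open>y\<close>, and being prime it contains some component; components are
  incomparable.\<close>

lemma assoc_primes_\<aa>: "assoc_primes R \<aa> = {component d 1 | d. d \<in> coords}"
proof (intro subset_antisym subsetI)
  fix p assume "p \<in> assoc_primes R \<aa>"
  then obtain y where p: "primeideal p R" and y: "y \<in> carrier R" "p = {r \<in> carrier R. r \<otimes> y \<in> \<aa>}"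
    using assoc_primes_iff[OF is_cring \<aa>_ideal] by blast
  have "\<one> \<notin> p" by (rule primeideal_not_one[OF p])
  then have "y \<notin> \<aa>" using y by simp
  then obtain d where d: "d \<in> coords" "y \<notin> component d 1"
    using y(1) unfolding \<aa>_eq by blast
  have up: "p \<subseteq> component d 1"
  proof
    fix r assume "r \<in> p"
    then have "r \<in> carrier R" "y \<otimes> r \<in> component d 1"
      using y \<aa>_subset_wideal[OF d(1)] by (auto simp: m_comm)
    then show "r \<in> component d 1" using wideal_cancel[OF y(1) _ d(2)] by blast
  qed
  have "\<aa> \<subseteq> p"
    using y ideal.I_r_closed[OF \<aa>_ideal _ y(1)] ideal.Icarr[OF \<aa>_ideal] by blast
  then obtain d' where d': "d' \<in> coords" "component d' 1 \<subseteq> p"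
    using prime_over_\<aa>[OF p] by blast
  then have "others d' \<subseteq> others d" using up wideal_subset_iff by blast
  then have "d' = d" by (rule others_eq[OF d'(1) d(1)])
  then show "p \<in> {component d 1 | d. d \<in> coords}" using up d' by blast
next
  fix p assume "p \<in> {component d 1 | d. d \<in> coords}"
  then obtain d where d: "d \<in> coords" "p = component d 1" by blast
  have "component d 1 = {r \<in> carrier R. r \<otimes> \<eta> (Var d) \<in> \<aa>}"
  proof (intro subset_antisym subsetI)
    fix r assume r: "r \<in> component d 1"
    have "r \<otimes> \<eta> (Var d) \<in> component d' 1" if d': "d' \<in> coords" for d'
    proof (cases "d' = d")
      case True
      then show ?thesis using ideal.I_r_closed[OF wideal_ideal r] by simp
    next
      case False
      then have "\<eta> (Var d) \<in> component d' 1"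
        using d(1) by (subst Var_wideal_iff) (auto simp: others_def)
      then show ?thesis using ideal.I_l_closed[OF wideal_ideal] wideal_carrier[OF r] by blast
    qed
    then show "r \<in> {r \<in> carrier R. r \<otimes> \<eta> (Var d) \<in> \<aa>}"
      unfolding \<aa>_eq using wideal_carrier[OF r] by simp
  next
    fix r assume "r \<in> {r \<in> carrier R. r \<otimes> \<eta> (Var d) \<in> \<aa>}"
    then have r: "r \<in> carrier R" "\<eta> (Var d) \<otimes> r \<in> component d 1"
      using \<aa>_subset_wideal[OF d(1)] by (auto simp: m_comm)
    have "\<eta> (Var d) \<notin> component d 1"
      by (subst Var_wideal_iff) (simp add: others_def)
    then show "r \<in> component d 1" using wideal_cancel[OF \<eta>_simps(1) r(1)] r(2) by blast
  qed
  then show "p \<in> assoc_primes R \<aa>"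
    unfolding assoc_primes_iff[OF is_cring \<aa>_ideal] d(2)
    using wideal_prime[of "others d"] \<eta>_simps(1)[of "Var d"] by blast
qed

lemma ideal_power_ideal: "ideal (ideal_power R \<aa> n) R"
  by (induction n) (use oneideal ideal_prod_is_ideal[OF \<aa>_ideal] in auto)

lemma ideal_power_subset:
  assumes "d \<in> coords" shows "ideal_power R \<aa> n \<subseteq> component d n"
proof (induction n)
  case (Suc n)
  have "s \<in> component d (Suc n)" if "s \<in> \<aa> \<cdot> ideal_power R \<aa> n" for s
    using that
  proof (induction s rule: ideal_prod.induct)
    case (prod i j)
    then have "i \<in> component d 1" "j \<in> component d n"
      using Suc \<aa>_subset_wideal[OF assms] by blast+
    then show ?case using wideal_mult[of i "others d" 1 j n] by simp
  next
    case (sum s t)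
    then show ?case by (intro ideal_add[OF wideal_ideal])
  qed
  then show ?case by auto
qed (simp add: wideal_0)

text \<open>If \<open>u\<close> and \<open>v\<close> are the coordinates other than \<open>d\<close>, then \<open>d\<^sup>n\<close> turns a product of \<open>n\<close> factors from \<open>u\<close>, \<open>v\<close>
  into a product of \<open>n\<close> factors from \<open>d u\<close>, \<open>d v\<close>.\<close>

lemma Var_power_mult_in_ideal_power:
  assumes d: "d \<in> coords" and p: "p \<in> weight_ideal (others d) n"
  shows "\<eta> (Var d ^ n * p) \<in> ideal_power R \<aa> n"
proof -
  have mono: "\<eta> (Var d ^ n * single e c) \<in> ideal_power R \<aa> n"
    if "n \<le> weight (others d) e" for e c
    using that
  proof (induction n arbitrary: e)
    case (Suc n)
    then have "weight (others d) e \<noteq> 0" by simp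
    then obtain i where i: "i \<in> others d" "lookup e i \<noteq> 0"
      by (auto simp: weight_def)
    define e' where "e' = e - single i 1"
    have e: "e = single i 1 + e'"
      unfolding e'_def by (rule single_factor_Var(2)[OF i(2)])
    have "n \<le> weight (others d) e'"
      using Suc.prems i(1) unfolding e by (simp add: weight_add weight_single)
    from Suc.IH[OF this] have IH: "\<eta> (Var d ^ n * single e' c) \<in> ideal_power R \<aa> n" .
    have gen: "\<eta> (Var d * Var i) \<in> \<aa>" using i(1) d by (intro gen_in_\<aa>) (auto simp: others_def)
    have "Var d ^ Suc n * single e c = (Var d * Var i) * (Var d ^ n * single e' c)"
      unfolding single_factor_Var(1)[OF i(2), of c] e'_def[symmetric] by (simp add: mult_ac)
    then have "\<eta> (Var d ^ Suc n * single e c)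
        = \<eta> (Var d * Var i) \<otimes> \<eta> (Var d ^ n * single e' c)"
      by (simp only: \<eta>_simps(3)[symmetric])
    then show ?case using ideal_prod.prod[OF gen IH, of R] by simp
  qed simp
  have "p \<in> {p. \<eta> (Var d ^ n * p) \<in> ideal_power R \<aa> n}"
  proof (rule poly_in_additive_set)
    show "0 \<in> {p. \<eta> (Var d ^ n * p) \<in> ideal_power R \<aa> n}"
      using ideal_zero[OF ideal_power_ideal] by simp
    fix e assume "e \<in> keys p"
    then show "single e (lookup p e)
        \<in> {p. \<eta> (Var d ^ n * p) \<in> ideal_power R \<aa> n}"
      using mono p by (simp add: weight_ideal_def)
  next
    fix p q assume "p \<in> {p. \<eta> (Var d ^ n * p) \<in> ideal_power R \<aa> n}"
      "q \<in> {p. \<eta> (Var d ^ n * p) \<in> ideal_power R \<aa> n}"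
    then have "\<eta> (Var d ^ n * p) \<oplus> \<eta> (Var d ^ n * q) \<in> ideal_power R \<aa> n"
      by (intro ideal_add[OF ideal_power_ideal]) auto
    then show "p + q \<in> {p. \<eta> (Var d ^ n * p) \<in> ideal_power R \<aa> n}"
      by (simp only: distrib_left \<eta>_simps(2) mem_Collect_eq)
  qed
  then show ?thesis by simp
qed

text \<open>Localizing at a component makes the missing coordinate \<open>d\<close> invertible, and \<open>d\<^sup>n\<close> moves the \<open>n\<close>-th power
  of the component into \<open>\<aa>\<^sup>n\<close>. In the other direction, powers of a component are primary.\<close>

lemma symbolic_power_\<aa>:
  "symbolic_power R \<aa> n = {r \<in> carrier R. \<forall>d\<in>coords. r \<in> component d n}"
proof -
  have "to_localization_at R (component d 1) r
      \<in> extend_to_localization_at R (component d 1) (ideal_power R \<aa> n)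
    \<longleftrightarrow> r \<in> component d n"
    if d: "d \<in> coords" and c: "r \<in> carrier R" for d r
  proof -
    interpret L: localized_domain R "component d 1"
      by (intro localized_domain.intro localized_domain_axioms.intro domain_R wideal_prime)
    have "(\<exists>s\<in>carrier R - component d 1. s \<otimes> r \<in> ideal_power R \<aa> n) \<longleftrightarrow> r \<in> component d n"
    proof
      assume "\<exists>s\<in>carrier R - component d 1. s \<otimes> r \<in> ideal_power R \<aa> n"
      then obtain s where "s \<in> carrier R" "s \<notin> component d 1" "s \<otimes> r \<in> component d n"
        using ideal_power_subset[OF d] by blast
      then show "r \<in> component d n" using wideal_cancel c by blast
    next
      assume r: "r \<in> component d n"
      obtain p s where *: "lookup s 0 \<noteq> 0" "\<eta> s \<otimes> r = \<eta> p"
        using numerator[OF c] by blast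
      have p: "p \<in> weight_ideal (others d) n" using r wideal_iff[OF c *] by blast
      have "Var d ^ n * s \<notin> weight_ideal (others d) 1"
      proof
        have V: "Var d \<notin> (weight_ideal (others d) 1 :: 'k poly4 set)"
          unfolding \<eta>_wideal_iff[symmetric] Var_wideal_iff by (simp add: others_def)
        assume "Var d ^ n * s \<in> weight_ideal (others d) 1"
        then have "s \<in> weight_ideal (others d) 1"
        proof (induction n)
          case (Suc n)
          then show ?case using weight_ideal_cancel[OF V, of "Var d ^ n * s" 1]
            by (simp only: power_Suc mult.assoc)
        qed simp
        then show False using origin_notin[OF *(1)] by blast
      qed
      then have "\<eta> (Var d ^ n * s) \<in> carrier R - component d 1"
        unfolding Diff_iff \<eta>_wideal_iff by simp
      moreover have "\<eta> (Var d ^ n * s) \<otimes> r = \<eta> (Var d ^ n * p)"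
        using c by (simp add: m_assoc flip: *(2))
      ultimately show "\<exists>s\<in>carrier R - component d 1. s \<otimes> r \<in> ideal_power R \<aa> n"
        using Var_power_mult_in_ideal_power[OF d p] by metis
    qed
    then show ?thesis using L.\<iota>_mem_extend[OF ideal_power_ideal c] by blast
  qed
  then show ?thesis unfolding symbolic_power_def assoc_primes_\<aa> by blast
qed

lemma \<eta>_symbolic_power_iff:
  "\<eta> p \<in> symbolic_power R \<aa> n \<longleftrightarrow> (\<forall>d\<in>coords. p \<in> weight_ideal (others d) n)"
  by (simp add: symbolic_power_\<aa> \<eta>_wideal_iff)

lemma symbolic_power_ideal: "ideal (symbolic_power R \<aa> n) R"
proof -
  have "symbolic_power R \<aa> n = component VX n \<inter> (component VZ n \<inter> component VW n)"
    unfolding symbolic_power_\<aa> using wideal_carrier by auto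
  then show ?thesis using i_intersect[OF wideal_ideal i_intersect[OF wideal_ideal wideal_ideal]] by simp
qed

subsection \<open>Heights\<close>

lemma prime_height_ge_2:
  assumes q: "primeideal q R" "\<aa> \<subseteq> q" shows "2 \<le> prime_height R q"
proof -
  obtain d where d: "d \<in> coords" "component d 1 \<subseteq> q" using prime_over_\<aa>[OF q] by blast
  obtain i where i: "{i} \<subset> others d" using d(1) by (auto simp: others_def)
  have "{\<zero>} \<subset> wideal {i} 1" using wideal_psubset[of "{}" "{i}"] unfolding wideal_empty by blast
  moreover have "wideal {i} 1 \<subset> q" using wideal_psubset[OF i] d(2) by blast
  moreover have "primeideal {\<zero>} R" using wideal_prime[of "{}"] wideal_empty by simp
  ultimately have "prime_chain R [{\<zero>}, wideal {i} 1, q]"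
    using q wideal_prime[of "{i}"] unfolding prime_chain_def by auto
  then have "enat (length [{\<zero>}, wideal {i} 1, q] - 1) \<le> prime_height R q"
    unfolding prime_height_def by (intro SUP_upper) auto
  then show ?thesis by (simp add: numeral_eq_enat numeral_2_eq_2)
qed

text \<open>The upper bound holds because a chain ending in \<open>(u, v)\<close> can be continued by \<open>(u, v, c)\<close> and the maximal
  ideal.\<close>

lemma prime_height_component:
  assumes d: "d \<in> coords" shows "prime_height R (component d 1) = 2"
proof (rule antisym)
  show "2 \<le> prime_height R (component d 1)"
    by (rule prime_height_ge_2[OF wideal_prime \<aa>_subset_wideal[OF d]])
  show "prime_height R (component d 1) \<le> 2"
    unfolding prime_height_def
  proof (rule SUP_least, clarify)
    fix ps assume ps: "prime_chain R ps" "last ps = component d 1"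
    have sub: "component d 1 \<subset> wideal coords 1" "wideal coords 1 \<subset> wideal UNIV 1"
      using d by (intro wideal_psubset; auto simp: others_def)+
    have "ps = butlast ps @ [component d 1]"
      using ps append_butlast_last_id[of ps] by (auto simp: prime_chain_def)
    then have "sorted_wrt (\<subset>) (butlast ps @ [component d 1])"
      using ps(1) by (simp add: prime_chain_def)
    then have "\<forall>p\<in>set (butlast ps). p \<subset> component d 1"
      by (simp add: sorted_wrt_append)
    moreover have "set ps = insert (component d 1) (set (butlast ps))"
      using arg_cong[OF \<open>ps = _\<close>, of set] by simp
    ultimately have le: "\<forall>p\<in>set ps. p \<subseteq> component d 1" by blast
    then have "\<forall>p\<in>set ps. p \<subset> wideal coords 1 \<and> p \<subset> wideal UNIV 1"
      using sub by blast
    then have "sorted_wrt (\<subset>) (ps @ [wideal coords 1, wideal UNIV 1])"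
      using ps(1) sub(2) unfolding sorted_wrt_append prime_chain_def by simp
    then have "prime_chain R (ps @ [wideal coords 1, wideal UNIV 1])"
      using ps(1) wideal_prime unfolding prime_chain_def by auto
    then have "length ps \<le> 3" using prime_chain_length by fastforce
    then have "length ps - 1 \<le> 2" by simp
    then show "enat (length ps - 1) \<le> 2" by (simp add: numeral_eq_enat)
  qed
qed

lemma ideal_height_\<aa>: "ideal_height R \<aa> = 2"
proof (rule antisym)
  show "2 \<le> ideal_height R \<aa>"
    unfolding ideal_height_def by (rule INF_greatest) (use prime_height_ge_2 in auto)
  have "component VX 1 \<in> {p. primeideal p R \<and> \<aa> \<subseteq> p}"
    using wideal_prime \<aa>_subset_wideal[of VX] by simp
  then have "ideal_height R \<aa> \<le> prime_height R (component VX 1)"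
    unfolding ideal_height_def by (rule INF_lower)
  then show "ideal_height R \<aa> \<le> 2" using prime_height_component[of VX] by simp
qed

lemma unmixed_\<aa>: "unmixed R \<aa>"
  unfolding unmixed_def assoc_primes_\<aa> using prime_height_component by auto

subsection \<open>The residue rings of the symbolic powers\<close>

lemma symbolic_power_subset_prime:
  assumes q: "primeideal q R" and "symbolic_power R \<aa> n \<subseteq> q"
  shows "\<aa> \<subseteq> q"
proof (rule \<aa>_subset_ideal)
  interpret q: primeideal q R by (rule q)
  show "ideal q R" by (rule q.is_ideal)
  fix i j assume ij: "i \<in> coords" "j \<in> coords" "i \<noteq> j"
  have "\<eta> ((Var i * Var j) ^ m) \<in> component d m" if "d \<in> coords" for d m
  proof (induction m)
    case 0
    then show ?case by (simp add: wideal_0)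
  next
    case (Suc m)
    have "\<eta> (Var i * Var j) \<in> component d 1"
      using gen_in_\<aa>[OF ij] \<aa>_subset_wideal[OF that] by blast
    from wideal_mult[OF this Suc] show ?case by simp
  qed
  then have "\<eta> ((Var i * Var j) ^ n) \<in> q"
    using assms(2) unfolding symbolic_power_\<aa> by auto
  moreover have "\<eta> (p ^ m) \<in> q \<Longrightarrow> \<eta> p \<in> q" for p m
  proof (induction m)
    case 0
    then show ?case using primeideal_not_one[OF q] by simp
  next
    case (Suc m)
    then show ?case using q.I_prime[of "\<eta> p" "\<eta> (p ^ m)"] by auto
  qed
  ultimately show "\<eta> (Var i * Var j) \<in> q" by blast
qed

text \<open>A chain of primes of the residue ring pulls back to primes over some component, hence over some \<open>(u)\<close>;
  this leaves room for \<open>0\<close> and \<open>(u)\<close> in front of it.\<close>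

lemma krull_dim_Quot_symbolic_power: "krull_dim (R Quot symbolic_power R \<aa> n) \<le> 2"
  unfolding krull_dim_def
proof (rule SUP_least, clarify)
  define I where "I = symbolic_power R \<aa> n"
  have I: "ideal I R" unfolding I_def by (rule symbolic_power_ideal)
  fix ps assume "prime_chain (R Quot symbolic_power R \<aa> n) ps"
  then have ps: "ps \<noteq> []" "\<And>p. p \<in> set ps \<Longrightarrow> primeideal p (R Quot I)" "sorted_wrt (\<subset>) ps"
    by (auto simp: prime_chain_def I_def)
  define pull where "pull p = {r \<in> carrier R. I +> r \<in> p}" for p
  have prime: "primeideal (pull p) R" if "p \<in> set ps" for p
    unfolding pull_def by (rule primeideal_vimage[OF Quot_hom[OF I] is_cring ps(2)[OF that]])
  have strict: "pull p \<subset> pull p'" if pp: "p \<in> set ps" "p' \<in> set ps" and "p \<subset> p'" for p p'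
  proof -
    note psub = \<open>p \<subset> p'\<close>
    obtain x where x: "x \<in> p'" "x \<notin> p" using psub by blast
    have "x \<in> carrier (R Quot I)"
      using ideal.Icarr[OF primeideal.axioms(1)[OF ps(2)[OF pp(2)]] x(1)] .
    then obtain r where "r \<in> carrier R" "x = I +> r" using Quot_carrier[OF I] by blast
    then have "r \<in> pull p'" "r \<notin> pull p" using x by (auto simp: pull_def)
    moreover have "pull p \<subseteq> pull p'" using psub by (auto simp: pull_def)
    ultimately show ?thesis by blast
  qed
  have hd: "hd ps \<in> set ps" using ps(1) by simp
  have "I \<subseteq> pull (hd ps)"
  proof
    fix r assume r: "r \<in> I"
    have c: "r \<in> carrier R" using ideal.Icarr[OF I r] .
    have "I +> r = \<zero>\<^bsub>R Quot I\<^esub>" using Quot_zero[OF I c] r by simp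
    moreover have "\<zero>\<^bsub>R Quot I\<^esub> \<in> hd ps"
      using ideal_zero[OF primeideal.axioms(1)[OF ps(2)[OF hd]]] .
    ultimately show "r \<in> pull (hd ps)" using c by (simp add: pull_def)
  qed
  then have "\<aa> \<subseteq> pull (hd ps)"
    unfolding I_def by (rule symbolic_power_subset_prime[OF prime[OF hd]])
  from prime_over_\<aa>[OF prime[OF hd] this] obtain d
    where d: "d \<in> coords" "component d 1 \<subseteq> pull (hd ps)" by blast
  obtain i where i: "{i} \<subset> others d" using d(1) by (auto simp: others_def)
  have z: "{\<zero>} \<subset> wideal {i} 1" using wideal_psubset[of "{}" "{i}"] unfolding wideal_empty by blast
  have w: "wideal {i} 1 \<subset> pull (hd ps)" using wideal_psubset[OF i] d(2) by blast
  have min: "pull (hd ps) \<subseteq> pull p" if "p \<in> set ps" for p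
  proof (cases "p = hd ps")
    case False
    then have "hd ps \<subset> p" using ps(1,3) that by (cases ps) auto
    then show ?thesis using strict[OF hd that] by blast
  qed simp
  have "primeideal {\<zero>} R" using wideal_prime[of "{}"] unfolding wideal_empty .
  moreover have "sorted_wrt (\<subset>) (map pull ps)"
    unfolding sorted_wrt_map by (rule sorted_wrt_mono_rel[OF _ ps(3)]) (rule strict)
  moreover have "wideal {i} 1 \<subset> pull p" "{\<zero>} \<subset> pull p" if "p \<in> set ps" for p
    using min[OF that] w z by blast+
  ultimately have "prime_chain R ({\<zero>} # wideal {i} 1 # map pull ps)"
    using prime wideal_prime[of "{i}"] z unfolding prime_chain_def by simp
  from prime_chain_length[OF this] have "length ps - 1 \<le> 2" by simp
  then show "enat (length ps - 1) \<le> 2" by (simp add: numeral_eq_enat)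
qed

lemma divisible_by_Var:
  assumes "p \<in> weight_ideal {v} 1" shows "\<exists>q. p = Var v * (q :: 'k poly4)"
proof -
  have "p \<in> {p. \<exists>q. p = Var v * q}"
  proof (rule poly_in_additive_set)
    show "0 \<in> {p. \<exists>q. p = Var v * (q :: 'k poly4)}" by (auto intro: exI[of _ 0])
    fix e assume "e \<in> keys p"
    then have "lookup e v \<noteq> 0" using assms by (auto simp: weight_ideal_def weight_def)
    from single_factor_Var(1)[OF this]
    show "single e (lookup p e) \<in> {p. \<exists>q. p = Var v * q}" by blast
  next
    fix a b assume "a \<in> {p. \<exists>q. p = Var v * (q :: 'k poly4)}" "b \<in> {p. \<exists>q. p = Var v * (q :: 'k poly4)}"
    then obtain q q' where "a = Var v * q" "b = Var v * q'" by blast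
    then have "a + b = Var v * (q + q')" by (simp add: distrib_left)
    then show "a + b \<in> {p. \<exists>q. p = Var v * q}" by blast
  qed
  then show ?thesis by simp
qed

lemma split_off_Var:
  fixes p :: "'k poly4"
  obtains p0 p1 where "p = p0 + Var v * p1" "keys p0 \<subseteq> keys p"
    "\<And>e. e \<in> keys p0 \<Longrightarrow> lookup e v = 0"
proof -
  define p0 where "p0 = (\<Sum>e\<in>{e \<in> keys p. lookup e v = 0}.
    single e (lookup p e))"
  have l: "lookup p0 e = (if lookup e v = 0 then lookup p e else 0)" for e
    unfolding p0_def lookup_sum lookup_single when_def by (auto simp: in_keys_iff)
  have "p - p0 \<in> weight_ideal {v} 1"
    by (auto simp: weight_ideal_def weight_def in_keys_iff lookup_minus l split: if_splits)
  then obtain p1 where "p - p0 = Var v * p1" using divisible_by_Var by blast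
  then have "p = p0 + Var v * p1" by (simp add: algebra_simps)
  then show thesis by (rule that) (auto simp: in_keys_iff l split: if_splits)
qed

text \<open>Setting \<open>y\<close> to zero keeps the other coordinates and does not leave the weight ideals. So the equation can
  be read modulo \<open>y\<close> in the polynomials without \<open>y\<close>, where \<open>u + v + c\<close> lies in none of the components and
  can be cancelled.\<close>

lemma coordinate_sum_regular:
  fixes p :: "'k poly4"
  assumes eq: "(Var VX + Var VZ + Var VW) * p = a + Var VY * b"
    and a: "\<And>d. d \<in> coords \<Longrightarrow> a \<in> weight_ideal (others d) n"
  shows "\<exists>p0 p1. p = p0 + Var VY * p1 \<and> (\<forall>d\<in>coords. p0 \<in> weight_ideal (others d) n)"
proof -
  define g :: "'k poly4" where "g = Var VX + Var VZ + Var VW"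
  have g_keys: "keys g \<subseteq> {single VX 1, single VZ 1, single VW 1}"
    using keys_add[of "Var VX + Var VZ" "Var VW :: 'k poly4"] keys_add[of "Var VX" "Var VZ :: 'k poly4"]
    unfolding g_def by (auto simp: Var_def)
  obtain p0 p1 where p: "p = p0 + Var VY * p1"
    "\<And>e. e \<in> keys p0 \<Longrightarrow> lookup e VY = 0"
    by (rule split_off_Var[of p VY]) blast
  obtain a0 a1 where a0: "a = a0 + Var VY * a1" "keys a0 \<subseteq> keys a"
    "\<And>e. e \<in> keys a0 \<Longrightarrow> lookup e VY = 0"
    by (rule split_off_Var[of a VY]) blast
  have "g * p0 - a0 = Var VY * (a1 + b - g * p1)"
    using eq unfolding g_def[symmetric] p(1) a0(1) by (simp add: algebra_simps)
  moreover have "Var VY \<in> (weight_ideal {VY} 1 :: 'k poly4 set)"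
    unfolding Var_def by (rule single_in_weight_ideal) (simp add: weight_single)
  ultimately have "g * p0 - a0 \<in> weight_ideal {VY} 1"
    using weight_ideal_smult[of "Var VY" "{VY}" 1 "a1 + b - g * p1"] by (simp only: mult.commute)
  moreover have "lookup e VY = 0" if "e \<in> keys (g * p0 - a0)" for e
  proof -
    have "e \<in> keys (g * p0) \<union> keys a0" by (rule subsetD[OF keys_diff that])
    then show ?thesis
    proof
      assume "e \<in> keys (g * p0)"
      then obtain e1 e2 where "e = e1 + e2" "e1 \<in> keys g" "e2 \<in> keys p0"
        using keys_mult by blast
      then show ?thesis using g_keys p(2) by (auto simp: lookup_add lookup_single)
    qed (rule a0(3))
  qed
  ultimately have "keys (g * p0 - a0) = {}"
    by (fastforce simp: weight_ideal_def weight_def)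
  then have gp: "g * p0 = a0" by simp
  have "p0 \<in> weight_ideal (others d) n" if d: "d \<in> coords" for d
  proof (rule weight_ideal_cancel)
    show "g * p0 \<in> weight_ideal (others d) n"
      using a[OF d] a0(2) unfolding gp weight_ideal_def by blast
    have "single v (Suc 0) = single v' (Suc 0) \<longleftrightarrow> v = v'" for v v' :: var
      by (metis lookup_single_eq lookup_single_not_eq nat.distinct(1))
    then have "lookup g (single d 1) = 1"
      using d by (auto simp: g_def Var_def lookup_add lookup_single when_def)
    then show "g \<notin> weight_ideal (others d) 1"
      by (auto simp: weight_ideal_def in_keys_iff weight_single others_def
          intro!: bexI[of _ "single d 1"])
  qed
  then show ?thesis using p(1) by blast
qed

text \<open>The regular sequence is \<open>y, u + v + c\<close>: the first lies in no component, so it can be cancelled modulo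
  every intersection of their powers.\<close>

lemma cohen_macaulay_symbolic_power:
  assumes n: "n \<ge> 1"
  shows "cohen_macaulay_local (R Quot symbolic_power R \<aa> n)"
proof -
  define I where "I = symbolic_power R \<aa> n"
  have I: "ideal I R" unfolding I_def by (rule symbolic_power_ideal)
  define Q where "Q = R Quot I"
  interpret Q: cring Q unfolding Q_def by (rule Quot_cring[OF I])
  interpret h: ring_hom_ring R Q "(+>) I" unfolding Q_def by (rule Quot_hom[OF I])
  have carrier: "carrier Q = {I +> r | r. r \<in> carrier R}" unfolding Q_def by (rule Quot_carrier[OF I])
  have reps: "\<exists>r\<in>carrier R. x = I +> r" if "x \<in> carrier Q" for x
    using that unfolding carrier by auto
  have eq: "r \<in> carrier R \<Longrightarrow> s \<in> carrier R \<Longrightarrow> I +> r = I +> s \<longleftrightarrow> r \<ominus> s \<in> I" for r s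
    by (rule Quot_eq[OF I])
  have zero: "r \<in> carrier R \<Longrightarrow> I +> r = \<zero>\<^bsub>Q\<^esub> \<longleftrightarrow> r \<in> I" for r
    unfolding Q_def by (rule Quot_zero[OF I])
  have noeth: "noetherian_ring Q"
  proof (rule noetherian_ring_fractions[OF h.ring_hom_ring_axioms noetherian_R Q.is_cring])
    fix b assume "b \<in> carrier Q"
    then obtain r where "r \<in> carrier R" "b = I +> r" by (elim reps[THEN bexE])
    then show "\<exists>a\<in>carrier R. \<exists>s\<in>carrier R. (I +> s) \<in> Units Q \<and> (I +> s) \<otimes>\<^bsub>Q\<^esub> b = I +> a"
      by (intro bexI[of _ r] bexI[of _ \<one>]) auto
  qed
  define m where "m = wideal UNIV 1"
  have m: "ideal m R" unfolding m_def by (rule wideal_ideal)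
  have one_m: "\<one> \<notin> m" unfolding m_def by (rule primeideal_not_one[OF wideal_prime])
  have Im: "I \<subseteq> m"
  proof
    fix r assume "r \<in> I"
    then have "r \<in> component VX n" unfolding I_def symbolic_power_\<aa> by simp
    then have "r \<in> component VX 1"
      using weight_ideal_mono[of "others VX" "others VX" 1 n] n by (auto simp: wideal_def)
    then show "r \<in> m" using wideal_mono[of "others VX" UNIV 1] by (auto simp: m_def)
  qed
  define M where "M = (+>) I ` m"
  have M: "ideal M Q" unfolding M_def Q_def by (rule ring_ideal_imp_quot_ideal[OF I m])
  have one_M: "\<one>\<^bsub>Q\<^esub> \<notin> M"
  proof
    assume "\<one>\<^bsub>Q\<^esub> \<in> M"
    then obtain r where r: "r \<in> m" "I +> \<one> = I +> r" unfolding M_def using h.hom_one by auto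
    have c: "r \<in> carrier R" using ideal.Icarr[OF m r(1)] .
    then have "\<one> \<ominus> r \<in> m" using eq[of \<one> r] r(2) Im by auto
    then have "r \<oplus> (\<one> \<ominus> r) \<in> m" using ideal_add[OF m r(1)] by blast
    moreover have "r \<oplus> (\<one> \<ominus> r) = \<one>" using c by algebra
    ultimately show False using one_m by simp
  qed
  have units: "x \<in> Units Q" if xQ: "x \<in> carrier Q" and xM: "x \<notin> M" for x
  proof -
    obtain r where r: "r \<in> carrier R" "x = I +> r" using reps[OF xQ] by (elim bexE)
    then have "r \<notin> m" using xM unfolding M_def by blast
    then have u: "r \<in> Units R" unfolding m_def by (rule unit_outside_origin[OF r(1)])
    have "(I +> r) \<otimes>\<^bsub>Q\<^esub> (I +> inv r) = \<one>\<^bsub>Q\<^esub>" "(I +> inv r) \<otimes>\<^bsub>Q\<^esub> (I +> r) = \<one>\<^bsub>Q\<^esub>"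
      using u r(1) by (simp_all flip: h.hom_mult)
    moreover have "I +> inv r \<in> carrier Q" using u by simp
    ultimately show ?thesis
      unfolding Units_def r(2) using h.hom_closed[OF r(1)] by (intro CollectI conjI bexI[of _ "I +> inv r"])
  qed
  note loc = local_ringI[OF Q.is_cring M one_M units]
  define t where "t = \<eta> (Var VY)"
  define g where "g = \<eta> (Var VX + Var VZ + Var VW)"
  have tg: "t \<in> carrier R" "g \<in> carrier R" "t \<in> m" "g \<in> m"
    using ideal_add[OF m] Var_wideal_iff[of _ UNIV] by (auto simp: t_def g_def m_def)
  have tI: "r \<in> I" if r: "r \<in> carrier R" "t \<otimes> r \<in> I" for r
  proof -
    have "t \<notin> component d 1" for d unfolding t_def Var_wideal_iff by (simp add: others_def)
    then show ?thesis
      using r wideal_cancel[OF tg(1) r(1)] unfolding I_def symbolic_power_\<aa> by blast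
  qed
  have gI: "\<exists>y\<in>carrier R. r \<ominus> y \<otimes> t \<in> I" if r: "r \<in> carrier R" "y \<in> carrier R" "g \<otimes> r \<ominus> y \<otimes> t \<in> I" for r y
  proof -
    obtain p b s where *: "lookup s 0 \<noteq> 0" "\<eta> s \<otimes> r = \<eta> p" "\<eta> s \<otimes> y = \<eta> b"
      using common_numerators[OF r(1,2)] .
    define a where "a = (Var VX + Var VZ + Var VW) * p - Var VY * b"
    have "\<eta> s \<otimes> (g \<otimes> r \<ominus> y \<otimes> t) = g \<otimes> (\<eta> s \<otimes> r) \<ominus> t \<otimes> (\<eta> s \<otimes> y)"
      using r tg \<eta>_simps(1)[of s] by algebra
    also have "\<dots> = \<eta> a"
      unfolding *(2,3) a_def g_def t_def by (simp add: \<eta>_diff)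
    finally have "\<eta> a \<in> I" using ideal.I_l_closed[OF I r(3), of "\<eta> s"] by simp
    then have "a \<in> weight_ideal (others d) n" if "d \<in> coords" for d
      using that unfolding I_def \<eta>_symbolic_power_iff by blast
    moreover have "(Var VX + Var VZ + Var VW) * p = a + Var VY * b" by (simp add: a_def)
    ultimately obtain p0 p1 where p: "p = p0 + Var VY * p1"
      "\<forall>d\<in>coords. p0 \<in> weight_ideal (others d) n"
      using coordinate_sum_regular by blast
    have u: "\<eta> s \<in> Units R" by (rule unit[OF *(1)])
    define z where "z = inv (\<eta> s) \<otimes> \<eta> p1"
    have z: "z \<in> carrier R" "\<eta> s \<otimes> z = \<eta> p1"
      using u by (simp_all add: z_def m_assoc[symmetric])
    have "\<eta> s \<otimes> (r \<ominus> z \<otimes> t) = \<eta> s \<otimes> r \<ominus> t \<otimes> (\<eta> s \<otimes> z)"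
      using r z(1) tg \<eta>_simps(1)[of s] by algebra
    also have "\<dots> = \<eta> p0 \<oplus> t \<otimes> \<eta> p1 \<ominus> t \<otimes> \<eta> p1"
      unfolding *(2) z(2) p(1) by (simp add: t_def)
    also have "\<dots> = \<eta> p0" using tg \<eta>_simps(1)[of p0] \<eta>_simps(1)[of p1] by algebra
    also have "\<dots> \<in> I" unfolding I_def \<eta>_symbolic_power_iff by (rule p(2))
    finally have "r \<ominus> z \<otimes> t \<in> I"
      using unit_mult_mem_ideal[OF I u, of "r \<ominus> z \<otimes> t"] r z(1) tg by simp
    then show ?thesis using z(1) by blast
  qed
  define t' where "t' = I +> t"
  define g' where "g' = I +> g"
  have tg': "t' \<in> carrier Q" "g' \<in> carrier Q" "t' \<in> M" "g' \<in> M"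
    using tg by (auto simp: t'_def g'_def M_def)
  have empty: "Idl\<^bsub>Q\<^esub> {} = {\<zero>\<^bsub>Q\<^esub>}"
    using Q.genideal_minimal[OF Q.zeroideal, of "{}"] ideal_zero[OF Q.genideal_ideal[of "{}"]] by blast
  have single: "Idl\<^bsub>Q\<^esub> {t'} = {x \<otimes>\<^bsub>Q\<^esub> t' | x. x \<in> carrier Q}"
    using Q.cgenideal_eq_genideal[OF tg'(1)] by (simp add: cgenideal_def)
  have reg0: "x \<in> Idl\<^bsub>Q\<^esub> {}" if x: "x \<in> carrier Q" "t' \<otimes>\<^bsub>Q\<^esub> x \<in> Idl\<^bsub>Q\<^esub> {}" for x
  proof -
    obtain r where r: "r \<in> carrier R" "x = I +> r" using reps[OF x(1)] by (elim bexE)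
    have "I +> (t \<otimes> r) = \<zero>\<^bsub>Q\<^esub>" using x(2) r tg unfolding empty t'_def by simp
    then have "r \<in> I" using tI[OF r(1)] zero[OF m_closed[OF tg(1) r(1)]] by blast
    then show ?thesis using zero r empty by simp
  qed
  have reg1: "x \<in> Idl\<^bsub>Q\<^esub> {t'}" if x: "x \<in> carrier Q" "g' \<otimes>\<^bsub>Q\<^esub> x \<in> Idl\<^bsub>Q\<^esub> {t'}" for x
  proof -
    obtain r where r: "r \<in> carrier R" "x = I +> r" using reps[OF x(1)] by (elim bexE)
    obtain y where y: "y \<in> carrier R" "g' \<otimes>\<^bsub>Q\<^esub> x = (I +> y) \<otimes>\<^bsub>Q\<^esub> t'"
      using x(2) reps unfolding single by auto
    have "I +> (g \<otimes> r) = I +> (y \<otimes> t)" using y r tg by (simp add: g'_def t'_def)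
    then have "g \<otimes> r \<ominus> y \<otimes> t \<in> I" using eq[of "g \<otimes> r" "y \<otimes> t"] y r tg by simp
    from gI[OF r(1) y(1) this] obtain z where z: "z \<in> carrier R" "r \<ominus> z \<otimes> t \<in> I" by blast
    then have "x = I +> (z \<otimes> t)" unfolding r(2) using eq[of r "z \<otimes> t"] r tg by simp
    then have "x = (I +> z) \<otimes>\<^bsub>Q\<^esub> t'" using z tg by (simp add: t'_def)
    then show ?thesis unfolding single using z(1) h.hom_closed by blast
  qed
  have "regular_sequence Q [t', g']"
    unfolding regular_sequence_def
  proof (intro conjI allI impI ballI)
    show "set [t', g'] \<subseteq> carrier Q" using tg' by simp
    have "Idl\<^bsub>Q\<^esub> (set [t', g']) \<subseteq> M" by (rule Q.genideal_minimal[OF M]) (use tg' in simp)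
    then show "Idl\<^bsub>Q\<^esub> (set [t', g']) \<noteq> carrier Q" using one_M Q.one_closed by blast
    fix i a assume i: "i < length [t', g']" and a: "a \<in> carrier Q"
      "[t', g'] ! i \<otimes>\<^bsub>Q\<^esub> a \<in> Idl\<^bsub>Q\<^esub> (set (take i [t', g']))"
    from i consider "i = 0" | "i = 1" by fastforce
    then show "a \<in> Idl\<^bsub>Q\<^esub> (set (take i [t', g']))"
      using a reg0 reg1 by cases simp_all
  qed
  then have "enat (length [t', g']) \<le> local_depth Q"
    unfolding local_depth_def using tg' loc(2) by (intro SUP_upper) auto
  then have "2 \<le> local_depth Q" by (simp add: numeral_eq_enat numeral_2_eq_2)
  moreover have "local_depth Q \<le> krull_dim Q"
    by (rule local_depth_le_krull_dim[OF Q.is_cring noeth])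
  moreover have "krull_dim Q \<le> 2" unfolding Q_def I_def by (rule krull_dim_Quot_symbolic_power)
  ultimately have "local_depth Q = krull_dim Q" by (meson order_trans antisym)
  then show ?thesis using loc(1) noeth unfolding cohen_macaulay_local_def Q_def I_def by blast
qed

subsection \<open>Set-theoretic complete intersection\<close>

text \<open>With \<open>e\<^sub>2 = i j + i k + j k\<close> and \<open>e\<^sub>3 = i j k\<close> one has \<open>(i j)\<^sup>2 = i j e\<^sub>2 - (i + j) e\<^sub>3\<close> and
  \<open>(i j) (i k) = i e\<^sub>3\<close>.\<close>

lemma products_of_generators:
  assumes i: "i \<in> coords" and j: "j \<in> coords" and "i \<noteq> j"
    and i': "i' \<in> coords" and j': "j' \<in> coords" and "i' \<noteq> j'"
  shows "\<exists>A B :: 'k poly4. (Var i * Var j) * (Var i' * Var j') =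
    A * (Var VX * Var VZ + Var VX * Var VW + Var VZ * Var VW) + B * (Var VX * Var VZ * Var VW)"
proof -
  have "\<exists>k. coords = {i, j, k}
    \<and> Var VX * Var VZ + Var VX * Var VW + Var VZ * Var VW
      = Var i * Var j + Var i * Var k + Var j * Var k
    \<and> Var VX * Var VZ * Var VW = Var i * Var j * (Var k :: 'k poly4)"
    using i j \<open>i \<noteq> j\<close>
    by (elim insertE emptyE; hypsubst)
      (simp, (rule exI[of _ VW], force simp: ac_simps)?, (rule exI[of _ VZ], force simp: ac_simps)?,
        (rule exI[of _ VX], force simp: ac_simps)?)+
  then obtain k where k: "coords = {i, j, k}"
    and E2: "Var VX * Var VZ + Var VX * Var VW + Var VZ * Var VW
      = Var i * Var j + Var i * Var k + Var j * (Var k :: 'k poly4)"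
    and E3: "Var VX * Var VZ * Var VW = Var i * Var j * (Var k :: 'k poly4)" by blast
  have "i' \<in> {i, j, k}" "j' \<in> {i, j, k}" using i' j' k by auto
  then consider "i' = i \<and> j' = j \<or> i' = j \<and> j' = i" | "i' = i \<and> j' = k \<or> i' = k \<and> j' = i"
    | "i' = j \<and> j' = k \<or> i' = k \<and> j' = j"
    using \<open>i' \<noteq> j'\<close> by blast
  then show ?thesis
    unfolding E2 E3
  proof cases
    case 1
    then show "\<exists>A B :: 'k poly4. (Var i * Var j) * (Var i' * Var j') =
      A * (Var i * Var j + Var i * Var k + Var j * Var k) + B * (Var i * Var j * Var k)"
      by (intro exI[of _ "Var i * Var j"] exI[of _ "- (Var i + Var j)"]) (auto simp: algebra_simps)
  next
    case 2
    then show "\<exists>A B :: 'k poly4. (Var i * Var j) * (Var i' * Var j') =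
      A * (Var i * Var j + Var i * Var k + Var j * Var k) + B * (Var i * Var j * Var k)"
      by (intro exI[of _ 0] exI[of _ "Var i"]) (auto simp: ac_simps)
  next
    case 3
    then show "\<exists>A B :: 'k poly4. (Var i * Var j) * (Var i' * Var j') =
      A * (Var i * Var j + Var i * Var k + Var j * Var k) + B * (Var i * Var j * Var k)"
      by (intro exI[of _ 0] exI[of _ "Var j"]) (auto simp: ac_simps)
  qed
qed

lemma set_theoretic_complete_intersection_\<aa>: "set_theoretic_complete_intersection R \<aa>"
proof -
  define E2 E3 :: "'k poly4" where "E2 = Var VX * Var VZ + Var VX * Var VW + Var VZ * Var VW"
    and "E3 = Var VX * Var VZ * Var VW"
  define K where "K = Idl {\<eta> E2, \<eta> E3}"
  have sub: "{\<eta> E2, \<eta> E3} \<subseteq> carrier R" by simp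
  have K: "ideal K R" unfolding K_def by (rule genideal_ideal[OF sub])
  have EK: "\<eta> E2 \<in> K" "\<eta> E3 \<in> K" unfolding K_def using genideal_self[OF sub] by auto
  have Ea: "\<eta> E2 \<in> \<aa>" "\<eta> E3 \<in> \<aa>"
  proof -
    have "\<eta> (Var VX * Var VZ) \<in> \<aa>" "\<eta> (Var VX * Var VW) \<in> \<aa>" "\<eta> (Var VZ * Var VW) \<in> \<aa>"
      by (rule gen_in_\<aa>; simp)+
    then show "\<eta> E2 \<in> \<aa>" unfolding E2_def by (simp add: ideal_add[OF \<aa>_ideal] del: \<eta>_simps(3))
    have "\<eta> (Var VX * Var VZ) \<otimes> \<eta> (Var VW) \<in> \<aa>"
      by (rule ideal.I_r_closed[OF \<aa>_ideal gen_in_\<aa>]) simp_all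
    then show "\<eta> E3 \<in> \<aa>" unfolding E3_def by simp
  qed
  have Ka: "K \<subseteq> \<aa>" unfolding K_def by (rule genideal_minimal[OF \<aa>_ideal]) (use Ea in simp)
  have gens: "\<eta> (Var i * Var j) \<otimes> \<eta> (Var i' * Var j') \<in> K"
    if i: "i \<in> coords" "j \<in> coords" "i \<noteq> j"
      "i' \<in> coords" "j' \<in> coords" "i' \<noteq> j'" for i j i' j'
  proof -
    obtain A B :: "'k poly4" where AB: "(Var i * Var j) * (Var i' * Var j') = A * E2 + B * E3"
      using products_of_generators[OF i] unfolding E2_def E3_def by blast
    have "\<eta> (A * E2 + B * E3) \<in> K"
      unfolding \<eta>_simps(2,3)
      using ideal.I_l_closed[OF K EK(1)] ideal.I_l_closed[OF K EK(2)] by (intro ideal_add[OF K]) auto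
    then show ?thesis unfolding AB[symmetric] by simp
  qed
  have square: "a \<otimes> b \<in> K" if a: "a \<in> \<aa>" and b: "b \<in> \<aa>" for a b
  proof -
    have c: "a \<in> carrier R" "b \<in> carrier R" using a b ideal.Icarr[OF \<aa>_ideal] by blast+
    have colon: "ideal {x \<in> carrier R. g \<otimes> x \<in> K} R" if "g \<in> carrier R" for g
      by (rule ideal.helper_max_prime[OF K is_cring that])
    have gb: "\<eta> (Var i * Var j) \<otimes> b \<in> K"
      if i: "i \<in> coords" "j \<in> coords" "i \<noteq> j" for i j
    proof -
      have "\<aa> \<subseteq> {x \<in> carrier R. \<eta> (Var i * Var j) \<otimes> x \<in> K}"
        by (rule \<aa>_subset_ideal[OF colon]) (use gens[OF i] in auto)
      then show ?thesis using b by blast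
    qed
    have "\<aa> \<subseteq> {x \<in> carrier R. b \<otimes> x \<in> K}"
      by (rule \<aa>_subset_ideal[OF colon[OF c(2)]]) (use gb c(2) m_comm in auto)
    then have "b \<otimes> a \<in> K" using a by blast
    then show ?thesis using c by (simp add: m_comm)
  qed
  have "ideal_radical R \<aa> = ideal_radical R K"
  proof (rule subset_antisym)
    show "ideal_radical R K \<subseteq> ideal_radical R \<aa>" unfolding ideal_radical_def using Ka by blast
    show "ideal_radical R \<aa> \<subseteq> ideal_radical R K"
    proof
      fix r assume "r \<in> ideal_radical R \<aa>"
      then obtain n :: nat where r: "r \<in> carrier R" "r [^] n \<in> \<aa>" unfolding ideal_radical_def by blast
      have "r [^] (n + n) \<in> K" using square[OF r(2) r(2)] r(1) by (simp add: nat_pow_mult)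
      then show "r \<in> ideal_radical R K" unfolding ideal_radical_def using r(1) by blast
    qed
  qed
  moreover have "\<aa> \<subseteq> wideal UNIV 1" using \<aa>_subset_wideal[of VX] wideal_mono[of "others VX" UNIV 1] by blast
  then have "set [\<eta> E2, \<eta> E3] \<subseteq> the_maximal_ideal R" unfolding local_R(2) using Ea by auto
  moreover have "enat (length [\<eta> E2, \<eta> E3]) = ideal_height R \<aa>"
    unfolding ideal_height_\<aa> by (simp add: numeral_eq_enat numeral_2_eq_2)
  moreover have "K = Idl (set [\<eta> E2, \<eta> E3])" by (simp add: K_def)
  ultimately show ?thesis
    unfolding set_theoretic_complete_intersection_def using local_R(1) \<aa>_ideal by metis
qed

subsection \<open>The symbolic Rees algebra\<close>

lemma symbolic_power_0: "symbolic_power R \<aa> 0 = carrier R"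
  unfolding symbolic_power_\<aa> wideal_0 by blast

lemma symbolic_power_mult:
  assumes "a \<in> symbolic_power R \<aa> m" "b \<in> symbolic_power R \<aa> n"
  shows "a \<otimes> b \<in> symbolic_power R \<aa> (m + n)"
  using assms wideal_mult unfolding symbolic_power_\<aa> by auto

lemma finsum_in_ideal:
  assumes "ideal I R" "finite F" "\<And>x. x \<in> F \<Longrightarrow> f x \<in> I"
  shows "(\<Oplus>x\<in>F. f x) \<in> I"
  using assms(2,3)
proof (induction F rule: finite_induct)
  case empty
  then show ?case using ideal_zero[OF assms(1)] by simp
next
  case (insert x F)
  have "f \<in> F \<rightarrow> carrier R" "f x \<in> carrier R"
    using insert.prems ideal.Icarr[OF assms(1)] by auto
  then have "(\<Oplus>x\<in>insert x F. f x) = f x \<oplus> (\<Oplus>x\<in>F. f x)"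
    using insert.hyps by (intro finsum_insert)
  then show ?case using insert.IH insert.prems ideal_add[OF assms(1)] by auto
qed

lemma weight_others:
  "weight (others VX) e = lookup e VZ + lookup e VW"
  "weight (others VZ) e = lookup e VX + lookup e VW"
  "weight (others VW) e = lookup e VX + lookup e VZ"
proof -
  have "others VX = {VZ, VW}" "others VZ = {VX, VW}" "others VW = {VX, VZ}"
    by (auto simp: others_def)
  then show "weight (others VX) e = lookup e VZ + lookup e VW"
    "weight (others VZ) e = lookup e VX + lookup e VW"
    "weight (others VW) e = lookup e VX + lookup e VZ"
    by (simp_all add: weight_def)
qed

text \<open>Let \<open>n \<ge> 1\<close>. The exponents of two coordinates always add up to at least \<open>n\<close>. If all three exponents are positive and
  \<open>n \<ge> 2\<close>, splitting off \<open>u v c\<close> lowers these sums by two. Otherwise two exponents are positive with sum at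
  least \<open>n + 1\<close>, and the product of these two coordinates can be split off: it lowers their own sum by two
  and the other sums by one.\<close>

lemma symbolic_monomials_generated:
  fixes G :: "nat \<Rightarrow> 'k poly4 set"
  assumes base: "\<And>p. p \<in> G 0"
    and pair: "\<And>i j p n. i \<in> coords \<Longrightarrow> j \<in> coords \<Longrightarrow> i \<noteq> j \<Longrightarrow> p \<in> G n \<Longrightarrow>
      Var i * Var j * p \<in> G (Suc n)"
    and triple: "\<And>p n. p \<in> G n \<Longrightarrow> Var VX * Var VZ * Var VW * p \<in> G (Suc (Suc n))"
    and "\<And>d. d \<in> coords \<Longrightarrow> n \<le> weight (others d) e"
  shows "single e c \<in> G n"
  using assms(4)
proof (induction n arbitrary: e rule: less_induct)
  case (less n)
  let ?a = "lookup e VX" and ?b = "lookup e VZ" and ?c = "lookup e VW"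
  have w: "n \<le> ?b + ?c" "n \<le> ?a + ?c" "n \<le> ?a + ?b"
    using less.prems[of VX] less.prems[of VZ] less.prems[of VW] by (simp_all add: weight_others)
  have split: "single e c \<in> G n"
    if ij: "i \<in> coords" "j \<in> coords" "i \<noteq> j"
      "lookup e i \<noteq> 0" "lookup e j \<noteq> 0"
      and n: "n \<noteq> 0" "Suc n \<le> lookup e i + lookup e j" for i j
  proof -
    define e' where "e' = e - single i 1 - single j 1"
    have j': "lookup (e - single i 1) j \<noteq> 0"
      using ij by (simp add: lookup_minus lookup_single when_def)
    have single: "single e c = Var i * (Var j * single e' c)"
      unfolding e'_def single_factor_Var(1)[OF ij(4), of c] single_factor_Var(1)[OF j', of c] ..
    have e: "e = single i 1 + (single j 1 + e')"
      unfolding e'_def using single_factor_Var(2)[OF ij(4)] single_factor_Var(2)[OF j'] by simp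
    have "n - 1 \<le> weight (others d) e'" if d: "d \<in> coords" for d
    proof (cases "d = i \<or> d = j")
      case True
      then have "weight (others d) e \<le> 1 + weight (others d) e'"
        using ij(3) by (subst e) (auto simp: weight_add weight_single others_def)
      then show ?thesis using less.prems[OF d] by simp
    next
      case False
      then have "others d = {i, j}" using d ij(1-3) by (auto simp: others_def)
      then have "weight (others d) e = lookup e i + lookup e j"
        using ij(3) by (simp add: weight_def)
      moreover have "weight (others d) e \<le> 2 + weight (others d) e'"
        by (subst e) (auto simp: weight_add weight_single)
      ultimately show ?thesis using n(2) by simp
    qed
    then have "single e' c \<in> G (n - 1)" using n(1) by (intro less.IH) auto
    then show ?thesis
      using single pair[OF ij(1-3), of "single e' c" "n - 1"] n(1) by (simp add: mult.assoc)
  qed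
  consider "n = 0" | "n \<ge> 2" "?a \<noteq> 0" "?b \<noteq> 0" "?c \<noteq> 0"
    | "n \<noteq> 0" "?a \<noteq> 0" "?b \<noteq> 0" "Suc n \<le> ?a + ?b"
    | "n \<noteq> 0" "?a \<noteq> 0" "?c \<noteq> 0" "Suc n \<le> ?a + ?c"
    | "n \<noteq> 0" "?b \<noteq> 0" "?c \<noteq> 0" "Suc n \<le> ?b + ?c"
  proof -
    have "n = 0 \<or> n \<ge> 2 \<and> a \<noteq> 0 \<and> b \<noteq> 0 \<and> c \<noteq> 0 \<or> n \<noteq> 0 \<and> a \<noteq> 0 \<and> b \<noteq> 0 \<and> Suc n \<le> a + b
      \<or> n \<noteq> 0 \<and> a \<noteq> 0 \<and> c \<noteq> 0 \<and> Suc n \<le> a + c \<or> n \<noteq> 0 \<and> b \<noteq> 0 \<and> c \<noteq> 0 \<and> Suc n \<le> b + c"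
      if "n \<le> b + c" "n \<le> a + c" "n \<le> a + b" for a b c :: nat
    proof -
      consider "n = 0" | "n \<noteq> 0" "a = 0" | "n \<noteq> 0" "b = 0" | "n \<noteq> 0" "c = 0"
        | "n = 1" "a \<noteq> 0" "b \<noteq> 0" | "n \<ge> 2" "a \<noteq> 0" "b \<noteq> 0" "c \<noteq> 0"
        by fastforce
      then show ?thesis by cases (use that in auto)
    qed
    from this[OF w] show thesis using that by blast
  qed
  then show ?case
  proof cases
    case 1
    then show ?thesis using base by simp
  next
    case 2
    define e' where "e' = e - single VX 1 - single VZ 1 - single VW 1"
    have b: "lookup (e - single VX 1) VZ \<noteq> 0"
      "lookup (e - single VX 1 - single VZ 1) VW \<noteq> 0"
      using 2 by (simp_all add: lookup_minus lookup_single)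
    have "single e c = Var VX * (Var VZ * (Var VW * single e' c))"
      unfolding e'_def single_factor_Var(1)[OF 2(2), of c] single_factor_Var(1)[OF b(1), of c]
        single_factor_Var(1)[OF b(2), of c] ..
    moreover have e: "e = single VX 1
        + (single VZ 1 + (single VW 1 + e'))"
      unfolding e'_def
      using single_factor_Var(2)[OF 2(2)] single_factor_Var(2)[OF b(1)] single_factor_Var(2)[OF b(2)]
      by simp
    have "n - 2 \<le> weight (others d) e'" if d: "d \<in> coords" for d
    proof -
      have "weight (others d) e \<le> 2 + weight (others d) e'"
        using d by (subst e) (auto simp: weight_add weight_single others_def)
      then show ?thesis using less.prems[OF d] by simp
    qed
    then have "single e' c \<in> G (n - 2)" using 2(1) by (intro less.IH) auto
    moreover have "Suc (Suc (n - 2)) = n" using 2(1) by simp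
    ultimately show ?thesis
      using triple[of "single e' c" "n - 2"] by (simp add: mult.assoc)
  next
    case 3
    show ?thesis by (rule split[of VX VZ]) (use 3 in simp_all)
  next
    case 4
    show ?thesis by (rule split[of VX VW]) (use 4 in simp_all)
  next
    case 5
    show ?thesis by (rule split[of VZ VW]) (use 5 in simp_all)
  qed
qed

text \<open>The algebra generated by the constants and the four elements of \<open>G\<close> is Noetherian. It contains
  \<open>r t\<^sup>n\<close> for each \<open>r\<close> in the \<open>n\<close>-th symbolic power, because denominators are constants and numerators
  are sums of monomials.\<close>

lemma noetherian_symbolic_rees_algebra: "noetherian_ring (symbolic_rees_algebra R \<aa>)"
proof -
  interpret U: UP_cring R "UP R" by (intro UP_cring.intro is_cring)
  let ?P = "UP R"
  let ?mon = "up_ring.monom ?P" and ?coeff = "up_ring.coeff ?P"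
  define I where "I n = symbolic_power R \<aa> n" for n
  have I: "ideal (I n) R" for n unfolding I_def by (rule symbolic_power_ideal)
  have I0: "I 0 = carrier R" unfolding I_def by (rule symbolic_power_0)
  define C where "C = {P \<in> carrier ?P. \<forall>n. ?coeff P n \<in> I n}"
  have C: "subring C ?P"
  proof (rule U.P.subringI)
    show "C \<subseteq> carrier ?P" by (auto simp: C_def)
    show "\<one>\<^bsub>?P\<^esub> \<in> C" using I0 ideal_zero[OF I] by (auto simp: C_def)
  next
    fix p assume "p \<in> C"
    then show "\<ominus>\<^bsub>?P\<^esub> p \<in> C"
      using additive_subgroup.a_inv_closed[OF ideal.axioms(1)[OF I]] by (auto simp: C_def)
  next
    fix p q assume pq: "p \<in> C" "q \<in> C"
    then show "p \<oplus>\<^bsub>?P\<^esub> q \<in> C" using ideal_add[OF I] by (auto simp: C_def)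
    have "?coeff (p \<otimes>\<^bsub>?P\<^esub> q) n \<in> I n" for n
    proof -
      have "?coeff p i \<otimes> ?coeff q (n - i) \<in> I n" if "i \<le> n" for i
        using symbolic_power_mult[of "?coeff p i" i "?coeff q (n - i)" "n - i"] pq that
        by (auto simp: C_def I_def)
      then have "(\<Oplus>i\<in>{..n}. ?coeff p i \<otimes> ?coeff q (n - i)) \<in> I n"
        by (intro finsum_in_ideal I) auto
      then show ?thesis using pq by (simp add: C_def U.coeff_mult)
    qed
    then show "p \<otimes>\<^bsub>?P\<^esub> q \<in> C" using pq by (auto simp: C_def)
  qed
  define A where "A = (\<lambda>r. ?mon r 0) ` carrier R"
  have hom: "ring_hom_ring R ?P (\<lambda>r. ?mon r 0)"
    by (rule ring_hom_ringI2[OF ring_axioms U.P.ring_axioms U.const_ring_hom])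
  have A: "subring A ?P"
    unfolding A_def by (rule ring_hom_ring.img_is_subring[OF hom carrier_is_subring])
  have noeth: "noetherian_ring (?P\<lparr>carrier := A\<rparr>)"
  proof (rule noetherian_ring_fractions[OF _ noetherian_R])
    show cA: "cring (?P\<lparr>carrier := A\<rparr>)"
      using A by (simp add: U.P.subcring_iff[OF subringE(1)[OF A], symmetric] U.P.subcringI')
    then have rA: "ring (?P\<lparr>carrier := A\<rparr>)" by (rule cring.axioms)
    show "ring_hom_ring R (?P\<lparr>carrier := A\<rparr>) (\<lambda>r. ?mon r 0)"
      by (intro ring_hom_ringI ring_axioms rA) (auto simp: A_def U.monom_mult[of _ _ 0 0, simplified])
    fix b assume "b \<in> carrier (?P\<lparr>carrier := A\<rparr>)"
    then obtain r where r: "r \<in> carrier R" "b = ?mon r 0" by (auto simp: A_def)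
    have "\<one>\<^bsub>?P\<lparr>carrier := A\<rparr>\<^esub> \<in> Units (?P\<lparr>carrier := A\<rparr>)"
      using rA by (intro monoid.Units_one_closed ring.is_monoid)
    then have "?mon \<one> 0 \<in> Units (?P\<lparr>carrier := A\<rparr>)" by simp
    moreover have "?mon \<one> 0 \<otimes>\<^bsub>?P\<lparr>carrier := A\<rparr>\<^esub> b = ?mon r 0" using r by simp
    ultimately show "\<exists>a\<in>carrier R. \<exists>s\<in>carrier R. ?mon s 0 \<in> Units (?P\<lparr>carrier := A\<rparr>)
      \<and> ?mon s 0 \<otimes>\<^bsub>?P\<lparr>carrier := A\<rparr>\<^esub> b = ?mon a 0"
      using r(1) one_closed by blast
  qed
  define pairs where "pairs = {(i, j). i \<in> coords \<and> j \<in> coords \<and> i \<noteq> j}"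
  define G where "G = insert (?mon (\<eta> (Var VX * Var VZ * Var VW)) 2)
    ((\<lambda>(i, j). ?mon (\<eta> (Var i * Var j)) 1) ` pairs)"
  have G: "finite G" "G \<subseteq> carrier ?P" by (auto simp: G_def)
  obtain B where B: "subring B ?P" "A \<subseteq> B" "G \<subseteq> B" "noetherian_ring (?P\<lparr>carrier := B\<rparr>)"
    and min: "\<forall>C. subring C ?P \<longrightarrow> A \<subseteq> C \<longrightarrow> G \<subseteq> C \<longrightarrow> B \<subseteq> C"
    using U.P.finitely_generated_noetherian[OF G A noeth] by (elim exE conjE)
  have monom_C: "?mon r n \<in> C" if "r \<in> I n" for r n
    using that ideal.Icarr[OF I that] ideal_zero[OF I] by (auto simp: C_def)
  have "A \<subseteq> C" unfolding A_def using monom_C I0 by auto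
  moreover have "G \<subseteq> C"
  proof -
    have "\<eta> (Var i * Var j) \<in> I 1" if "(i, j) \<in> pairs" for i j
    proof -
      have "\<eta> (Var i * Var j) \<in> \<aa>" using that by (intro gen_in_\<aa>) (auto simp: pairs_def)
      then show ?thesis
        unfolding I_def symbolic_power_\<aa> using \<aa>_subset_wideal \<eta>_simps(1) by blast
    qed
    moreover have "\<eta> (Var VX * Var VZ * Var VW) \<in> I 2"
    proof -
      have "Var VX * Var VZ * Var VW \<in> (weight_ideal (others d) 2 :: 'k poly4 set)"
        if "d \<in> coords" for d
        unfolding Var_def mult_single
        by (rule single_in_weight_ideal) (use that in \<open>auto simp: weight_add weight_single others_def\<close>)
      then show ?thesis
        unfolding I_def \<eta>_symbolic_power_iff by blast
    qed
    ultimately show ?thesis using monom_C unfolding G_def by auto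
  qed
  ultimately have "B \<subseteq> C" using min C by blast
  moreover have "C \<subseteq> B"
  proof
    have const: "?mon r 0 \<in> B" if "r \<in> carrier R" for r
      using that B(2) by (auto simp: A_def)
    have gen: "?mon (\<eta> p) n \<in> B" if p: "\<And>d. d \<in> coords \<Longrightarrow> p \<in> weight_ideal (others d) n" for p n
    proof -
      have "p \<in> {p. ?mon (\<eta> p) n \<in> B}"
      proof (rule poly_in_additive_set)
        show "0 \<in> {p. ?mon (\<eta> p) n \<in> B}" using subringE(2)[OF B(1)] by simp
        fix e assume e: "e \<in> keys p"
        have "single e (lookup p e) \<in> {p. ?mon (\<eta> p) n \<in> B}"
        proof (rule symbolic_monomials_generated[of "\<lambda>n. {p. ?mon (\<eta> p) n \<in> B}"])
          show "p \<in> {p. ?mon (\<eta> p) 0 \<in> B}" for p using const by simp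
          fix p n assume "p \<in> {p. ?mon (\<eta> p) n \<in> B}"
          then have p: "?mon (\<eta> p) n \<in> B" by simp
          have "?mon (\<eta> (Var VX * Var VZ * Var VW)) 2 \<otimes>\<^bsub>?P\<^esub> ?mon (\<eta> p) n \<in> B"
            using B(3) p by (intro subringE(6)[OF B(1)]) (auto simp: G_def)
          also have "?mon (\<eta> (Var VX * Var VZ * Var VW)) 2 \<otimes>\<^bsub>?P\<^esub> ?mon (\<eta> p) n
            = ?mon (\<eta> (Var VX * Var VZ * Var VW * p)) (2 + n)"
            by (subst U.monom_mult[symmetric]) simp_all
          finally show "Var VX * Var VZ * Var VW * p \<in> {p. ?mon (\<eta> p) (Suc (Suc n)) \<in> B}" by simp
          fix i j assume ij: "i \<in> coords" "j \<in> coords" "i \<noteq> j"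
          then have "(i, j) \<in> pairs" by (simp add: pairs_def)
          then have "?mon (\<eta> (Var i * Var j)) 1 \<in> B"
            using B(3) unfolding G_def by blast
          then have "?mon (\<eta> (Var i * Var j)) 1 \<otimes>\<^bsub>?P\<^esub> ?mon (\<eta> p) n \<in> B"
            using p by (intro subringE(6)[OF B(1)])
          also have "?mon (\<eta> (Var i * Var j)) 1 \<otimes>\<^bsub>?P\<^esub> ?mon (\<eta> p) n
            = ?mon (\<eta> (Var i * Var j * p)) (1 + n)"
            by (subst U.monom_mult[symmetric]) simp_all
          finally show "Var i * Var j * p \<in> {p. ?mon (\<eta> p) (Suc n) \<in> B}" by simp
        next
          show "n \<le> weight (others d) e" if "d \<in> coords" for d
            using p[OF that] e by (simp add: weight_ideal_def)
        qed
        then show "single e (lookup p e) \<in> {p. ?mon (\<eta> p) n \<in> B}" .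
      next
        fix p q assume "p \<in> {p. ?mon (\<eta> p) n \<in> B}" "q \<in> {p. ?mon (\<eta> p) n \<in> B}"
        then show "p + q \<in> {p. ?mon (\<eta> p) n \<in> B}" using subringE(7)[OF B(1)] by simp
      qed
      then show ?thesis by simp
    qed
    have mon: "?mon r n \<in> B" if r: "r \<in> I n" for r n
    proof -
      have c: "r \<in> carrier R" using ideal.Icarr[OF I r] .
      obtain p s where *: "lookup s 0 \<noteq> 0" "\<eta> s \<otimes> r = \<eta> p"
        using numerator[OF c] by blast
      have u: "\<eta> s \<in> Units R" by (rule unit[OF *(1)])
      have "p \<in> weight_ideal (others d) n" if "d \<in> coords" for d
        using r that wideal_iff[OF c *] unfolding I_def symbolic_power_\<aa> by blast
      then have "?mon (inv (\<eta> s)) 0 \<otimes>\<^bsub>?P\<^esub> ?mon (\<eta> p) n \<in> B"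
        using u by (intro subringE(6)[OF B(1)] const gen) auto
      also have "?mon (inv (\<eta> s)) 0 \<otimes>\<^bsub>?P\<^esub> ?mon (\<eta> p) n = ?mon (inv (\<eta> s) \<otimes> \<eta> p) (0 + n)"
        using u by (subst U.monom_mult) simp_all
      also have "inv (\<eta> s) \<otimes> \<eta> p = r"
        unfolding *(2)[symmetric] using u c by (simp add: m_assoc[symmetric])
      finally show ?thesis by simp
    qed
    fix p assume "p \<in> C"
    then have p: "p \<in> carrier ?P" "\<And>n. ?coeff p n \<in> I n" by (auto simp: C_def)
    have sum: "(\<Oplus>\<^bsub>?P\<^esub>i\<in>F. ?mon (?coeff p i) i) \<in> B" if "finite F" for F
      using that
    proof (induction F rule: finite_induct)
      case empty
      then show ?case using subringE(2)[OF B(1)] by simp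
    next
      case (insert i F)
      have "(\<Oplus>\<^bsub>?P\<^esub>i\<in>insert i F. ?mon (?coeff p i) i)
        = ?mon (?coeff p i) i \<oplus>\<^bsub>?P\<^esub> (\<Oplus>\<^bsub>?P\<^esub>i\<in>F. ?mon (?coeff p i) i)"
        using insert.hyps p(1) by (intro U.P.finsum_insert) auto
      then show ?case using insert.IH mon[OF p(2)] subringE(7)[OF B(1)] by simp
    qed
    then show "p \<in> B" using U.up_repr[OF p(1)] by (metis finite_atMost)
  qed
  ultimately have "B = C" by blast
  then show ?thesis
    using B(4) unfolding symbolic_rees_algebra_def C_def I_def by simp
qed

end

section \<open>Substitution\<close>

definition monomial_value :: "(var \<Rightarrow> 'k poly4) \<Rightarrow> (var \<Rightarrow>\<^sub>0 nat) \<Rightarrow> 'k::comm_ring_1 poly4" where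
  "monomial_value \<sigma> e = (\<Prod>v\<in>UNIV. \<sigma> v ^ lookup e v)"

definition subst_poly :: "(var \<Rightarrow> 'k poly4) \<Rightarrow> 'k::comm_ring_1 poly4 \<Rightarrow> 'k poly4" where
  "subst_poly \<sigma> p = (\<Sum>e\<in>keys p.
     single 0 (lookup p e) * monomial_value \<sigma> e)"

lemma sum_over_keys_add:
  fixes p q :: "'k::comm_ring_1 poly4"
  assumes "\<And>e. g e 0 = (0 :: 'b::comm_monoid_add)" "\<And>e a b. g e (a + b) = g e a + g e b"
  shows "(\<Sum>e\<in>keys (p + q). g e (lookup (p + q) e))
    = (\<Sum>e\<in>keys p. g e (lookup p e))
    + (\<Sum>e\<in>keys q. g e (lookup q e))"
proof -
  define F where "F = keys p \<union> keys q"
  have F: "finite F" by (simp add: F_def)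
  have ext: "(\<Sum>e\<in>keys r. g e (lookup r e)) = (\<Sum>e\<in>F. g e (lookup r e))"
    if "keys r \<subseteq> F" for r
    using that by (intro sum.mono_neutral_left[OF F]) (auto simp: in_keys_iff assms(1))
  have "keys (p + q) \<subseteq> F" unfolding F_def by (rule keys_add)
  then show ?thesis
    using ext[of "p + q"] ext[of p] ext[of q]
    by (simp add: F_def lookup_add assms(2) sum.distrib)
qed

lemma subst_poly_add: "subst_poly \<sigma> (p + q) = subst_poly \<sigma> p + subst_poly \<sigma> q"
  unfolding subst_poly_def by (rule sum_over_keys_add) (simp_all add: single_add distrib_right)

lemma subst_poly_single: "subst_poly \<sigma> (single e c) = single 0 c * monomial_value \<sigma> e"
  by (cases "c = 0") (simp_all add: subst_poly_def)

lemma monomial_value_add: "monomial_value \<sigma> (e + e') = monomial_value \<sigma> e * monomial_value \<sigma> e'"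
  by (simp add: monomial_value_def lookup_add power_add prod.distrib)

lemma subst_poly_0 [simp]: "subst_poly \<sigma> 0 = 0"
  by (simp add: subst_poly_def)

lemma subst_poly_const: "subst_poly \<sigma> (single 0 c) = single 0 c"
  by (simp add: subst_poly_single monomial_value_def)

lemma subst_poly_1 [simp]: "subst_poly \<sigma> 1 = 1"
  using subst_poly_const[of \<sigma> 1] by simp

lemma subst_poly_Var [simp]: "subst_poly \<sigma> (Var v) = \<sigma> v"
proof -
  have "monomial_value \<sigma> (single v 1) = (\<Prod>u\<in>UNIV. if u = v then \<sigma> v else 1)"
    unfolding monomial_value_def by (rule prod.cong) (auto simp: lookup_single when_def)
  also have "\<dots> = \<sigma> v" by simp
  finally show ?thesis by (simp add: Var_def subst_poly_single)
qed

lemma subst_poly_mult: "subst_poly \<sigma> (p * q) = subst_poly \<sigma> p * subst_poly \<sigma> q"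
proof -
  have singles: "subst_poly \<sigma> (single e c * single e' c')
    = subst_poly \<sigma> (single e c) * subst_poly \<sigma> (single e' c')" for e c e' c'
  proof -
    have "subst_poly \<sigma> (single e c * single e' c')
      = single 0 (c * c') * (monomial_value \<sigma> e * monomial_value \<sigma> e')"
      by (simp add: mult_single subst_poly_single monomial_value_add)
    also have "single 0 (c * c') = single 0 c * (single 0 c' :: 'a poly4)"
      by (simp add: mult_single)
    finally show ?thesis by (simp only: subst_poly_single mult_ac)
  qed
  have single: "subst_poly \<sigma> (single e c * q)
    = subst_poly \<sigma> (single e c) * subst_poly \<sigma> q" for e c
  proof -
    have "q \<in> {q. subst_poly \<sigma> (single e c * q)
      = subst_poly \<sigma> (single e c) * subst_poly \<sigma> q}"
      by (rule poly_in_additive_set) (simp_all add: subst_poly_add singles distrib_left)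
    then show ?thesis by simp
  qed
  have "p \<in> {p. subst_poly \<sigma> (p * q) = subst_poly \<sigma> p * subst_poly \<sigma> q}"
    by (rule poly_in_additive_set) (auto simp: single subst_poly_add distrib_right)
  then show ?thesis by simp
qed

lemma subst_poly_inverse:
  assumes "\<And>v. subst_poly \<sigma> (\<tau> v) = Var v"
  shows "subst_poly \<sigma> (subst_poly \<tau> p) = p"
proof -
  have "p \<in> {p. subst_poly \<sigma> (subst_poly \<tau> p) = p}"
    by (rule poly_in_generated_set)
      (auto simp: assms subst_poly_const subst_poly_add subst_poly_mult)
  then show ?thesis by simp
qed

lemma subst_poly_origin:
  assumes \<sigma>: "\<And>v. \<sigma> v \<in> weight_ideal UNIV 1" and p: "p \<in> weight_ideal UNIV 1"
  shows "subst_poly \<sigma> p \<in> weight_ideal UNIV 1"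
proof -
  have "p \<in> {p. subst_poly \<sigma> p \<in> weight_ideal UNIV 1}"
  proof (rule poly_in_additive_set)
    fix e assume e: "e \<in> keys p"
    then have "weight UNIV e \<noteq> 0" using p by (auto simp: weight_ideal_def)
    then obtain v where v: "lookup e v \<noteq> 0" by (auto simp: weight_def)
    have "subst_poly \<sigma> (single e (lookup p e)) = subst_poly \<sigma>
        (single (e - single v 1) (lookup p e)) * \<sigma> v"
      by (subst single_factor_Var(1)[OF v]) (simp add: subst_poly_mult mult.commute)
    then show "single e (lookup p e) \<in> {p. subst_poly \<sigma> p \<in> weight_ideal UNIV 1}"
      using weight_ideal_smult[OF \<sigma>] by (simp del: One_nat_def)
  qed (auto simp: subst_poly_add intro: weight_ideal_add)
  then show ?thesis by simp
qed

section \<open>Partial derivatives\<close>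

lemma partial_deriv_add: "partial_deriv v (p + q) = partial_deriv v p + partial_deriv v q"
  unfolding partial_deriv_def by (rule sum_over_keys_add) (simp_all add: single_add distrib_left)

lemma partial_deriv_single:
  "partial_deriv v (single e c)
    = single (e - single v 1) (of_nat (lookup e v) * c)"
  by (cases "c = 0") (simp_all add: partial_deriv_def)

lemma partial_deriv_0 [simp]: "partial_deriv v 0 = 0"
  by (simp add: partial_deriv_def)

lemma partial_deriv_1 [simp]: "partial_deriv v 1 = 0"
  using partial_deriv_single[of v 0 1] by simp

lemma partial_deriv_Var_mult:
  "partial_deriv v (Var u * p) = (if u = v then p else 0) + Var u * partial_deriv v (p :: 'k::comm_ring_1 poly4)"
proof -
  have "partial_deriv v (Var u * single e c) = (if u = v then single e c else 0)
    + Var u * partial_deriv v (single e (c :: 'k))" for e c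
  proof (cases "lookup e v = 0")
    case True
    then show ?thesis
      by (auto simp: Var_def mult_single partial_deriv_single lookup_add lookup_single when_def)
  next
    case False
    define e' where "e' = e - single v 1"
    have e: "e = single v 1 + e'"
      unfolding e'_def by (rule single_factor_Var(2)[OF False])
    have lhs: "single u 1 + e - single v 1 = single u 1 + e'"
      unfolding e by (subst add.left_commute) (rule add_diff_cancel_left')
    have "partial_deriv v (Var u * single e c) = single (single u 1 + e')
        (of_nat (lookup (single u 1) v) * c + of_nat (lookup e v) * c)"
      unfolding Var_def mult_single partial_deriv_single lhs lookup_add by (simp add: distrib_right)
    also have "\<dots> = single (single u 1 + e')
        (of_nat (lookup (single u 1) v) * c)
      + Var u * partial_deriv v (single e c)"
      unfolding Var_def mult_single partial_deriv_single e'_def[symmetric] single_add by simp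
    also have "single (single u 1 + e')
        (of_nat (lookup (single u 1) v) * c)
      = (if u = v then single e c else 0)"
      by (simp add: e lookup_single)
    finally show ?thesis .
  qed
  note monomial = this
  have "p \<in> {p. partial_deriv v (Var u * p) = (if u = v then p else 0) + Var u * partial_deriv v p}"
    by (rule poly_in_additive_set) (simp_all add: monomial partial_deriv_add distrib_left)
  then show ?thesis by simp
qed

lemma partial_deriv_Var: "partial_deriv v (Var u) = (if u = v then 1 else 0 :: 'k::comm_ring_1 poly4)"
  using partial_deriv_Var_mult[of v u 1] by simp

lemma partial_derivs_f:
  fixes x y z w f :: "'k::comm_ring_1 poly4"
  assumes "x = Var VX" "y = Var VY" "z = Var VZ" "w = Var VW"
    and f: "f = w * (x + y) * (x + y + z + w)"
  shows "partial_deriv VX f = w * (x + y + z + w) + w * (x + y)"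
    and "partial_deriv VY f = w * (x + y + z + w) + w * (x + y)"
    and "partial_deriv VZ f = w * (x + y)"
    and "partial_deriv VW f = (x + y) * (x + y + z + w) + w * (x + y)"
proof -
  have "f = w * (x * x) + w * (x * y) + w * (x * z) + w * (x * w)
    + w * (y * x) + w * (y * y) + w * (y * z) + w * (y * w)"
    unfolding f by (simp add: algebra_simps)
  note d = arg_cong[OF this, of "partial_deriv VX"] arg_cong[OF this, of "partial_deriv VY"]
    arg_cong[OF this, of "partial_deriv VZ"] arg_cong[OF this, of "partial_deriv VW"]
  note rules = partial_deriv_add partial_deriv_Var_mult partial_deriv_Var assms(1-4)
  show "partial_deriv VX f = w * (x + y + z + w) + w * (x + y)"
    unfolding d(1) by (simp only: rules) (simp add: algebra_simps)
  show "partial_deriv VY f = w * (x + y + z + w) + w * (x + y)"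
    unfolding d(2) by (simp only: rules) (simp add: algebra_simps)
  show "partial_deriv VZ f = w * (x + y)"
    unfolding d(3) by (simp only: rules) (simp add: algebra_simps)
  show "partial_deriv VW f = (x + y) * (x + y + z + w) + w * (x + y)"
    unfolding d(4) by (simp only: rules) (simp add: algebra_simps)
qed

section \<open>The Jacobian ideal\<close>

lemma weight_ideal_prime: "primeideal (weight_ideal A 1) (type_ring :: 'k::idom poly4 ring)"
proof -
  interpret cring "type_ring :: 'k poly4 ring" by (rule cring_from_type_algebra)
  show ?thesis
  proof (rule primeidealI)
    show "ideal (weight_ideal A 1) (type_ring :: 'k poly4 ring)"
      by (rule ideal_cringI) (simp_all add: weight_ideal_add weight_ideal_smult)
    show "carrier type_ring \<noteq> (weight_ideal A 1 :: 'k poly4 set)"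
      using not_one_in_weight_ideal[of 1 A] by auto
    fix a b :: "'k poly4"
    assume "a \<otimes>\<^bsub>type_ring\<^esub> b \<in> weight_ideal A 1"
    then show "a \<in> weight_ideal A 1 \<or> b \<in> weight_ideal A 1"
      using weight_ideal_cancel[of a A b 1] by auto
  qed (rule is_cring)
qed

lemma Idl_Vars:
  "Idl\<^bsub>type_ring\<^esub> {Var VX, Var VY, Var VZ, Var VW} = (weight_ideal UNIV 1 :: 'k::idom poly4 set)"
proof (rule subset_antisym)
  interpret cring "type_ring :: 'k poly4 ring" by (rule cring_from_type_algebra)
  let ?I = "Idl\<^bsub>type_ring\<^esub> {Var VX, Var VY, Var VZ, Var VW} :: 'k poly4 set"
  have Var: "Var v \<in> (weight_ideal UNIV 1 :: 'k poly4 set)" for v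
    unfolding Var_def by (rule single_in_weight_ideal) (simp add: weight_single)
  show "?I \<subseteq> weight_ideal UNIV 1"
    by (rule genideal_minimal[OF primeideal.axioms(1)[OF weight_ideal_prime]]) (use Var in auto)
  have I: "ideal ?I type_ring" by (rule genideal_ideal) simp
  have VI: "Var v \<in> ?I" for v
  proof -
    have "Var v \<in> {Var VX, Var VY, Var VZ, Var VW :: 'k poly4}" by (cases v) auto
    then show ?thesis using genideal_self[of "{Var VX, Var VY, Var VZ, Var VW :: 'k poly4}"] by auto
  qed
  show "weight_ideal UNIV 1 \<subseteq> ?I"
  proof
    fix p :: "'k poly4" assume p: "p \<in> weight_ideal UNIV 1"
    show "p \<in> ?I"
    proof (rule poly_in_additive_set)
      show "0 \<in> ?I" using ideal_zero[OF I] by simp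
      show "\<And>p q. p \<in> ?I \<Longrightarrow> q \<in> ?I \<Longrightarrow> p + q \<in> ?I" using ideal_add[OF I] by simp
      fix e assume e: "e \<in> keys p"
      then have "weight UNIV e \<noteq> 0" using p by (auto simp: weight_ideal_def)
      then obtain v where v: "lookup e v \<noteq> 0" by (auto simp: weight_def)
      show "single e (lookup p e) \<in> ?I"
        unfolding single_factor_Var(1)[OF v, of "lookup p e"]
        using ideal.I_r_closed[OF I VI] by simp
    qed
  qed
qed

theorem mainTheorem6:
  fixes S :: "'k::field poly4 ring"
    and \<mm> \<JJ> :: "'k poly4 set"
    and f x y z w :: "'k poly4"
    and R :: "('k poly4 \<times> 'k poly4) set ring"
    and \<aa> :: "('k poly4 \<times> 'k poly4) set set"
  assumes "infinite (UNIV :: 'k set)"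
    and "S = ring_of_type_algebra"
    and "x = Var VX" and "y = Var VY" and "z = Var VZ" and "w = Var VW"
    and "f = w * (x + y) * (x + y + z + w)"
    and "\<JJ> = jacobian_ideal f"
    and "\<mm> = Idl\<^bsub>S\<^esub> {x, y, z, w}"
    and "R = localization_at S \<mm>"
    and "\<aa> = extend_to_localization_at S \<mm> \<JJ>"
  shows "(ideal \<aa> R \<and> ideal_height R \<aa> = 2 \<and> unmixed R \<aa> \<and>
          (\<forall>n\<ge>1. cohen_macaulay_local (R Quot (symbolic_power R \<aa> n))))
       \<and> noetherian_ring (symbolic_rees_algebra R \<aa>)
       \<and> set_theoretic_complete_intersection R \<aa>"
proof -
  note defs = assms(2-6)
  have m: "\<mm> = weight_ideal UNIV 1" unfolding assms(9) defs by (rule Idl_Vars)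
  interpret S: cring S unfolding defs(1) by (rule cring_from_type_algebra)
  have "domain S"
    by (intro domain.intro S.is_cring domain_axioms.intro) (auto simp: defs(1))
  moreover have "primeideal \<mm> S" unfolding m defs(1) by (rule weight_ideal_prime)
  ultimately interpret L: localized_domain S \<mm>
    by (intro localized_domain.intro localized_domain_axioms.intro)
  define \<iota> where "\<iota> = to_localization_at S \<mm>"
  have R: "R = localization_at S \<mm>" by fact
  interpret \<iota>: ring_hom_ring S R \<iota> unfolding R \<iota>_def by (rule L.\<iota>_hom)
  have cR: "cring R" unfolding R by (rule L.cring_Q)
  then have rR: "ring R" by (rule cring.axioms)
  \<comment> \<open>\<open>\<sigma>\<close> sends \<open>w\<close>, \<open>x\<close> and \<open>z\<close> to the three factors of \<open>f\<close>.\<close>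
  define \<sigma> where "\<sigma> v = (case v of VX \<Rightarrow> x + y | VY \<Rightarrow> y | VZ \<Rightarrow> x + y + z + w | VW \<Rightarrow> w)" for v
  define \<tau> where "\<tau> v = (case v of VX \<Rightarrow> x - y | VY \<Rightarrow> y | VZ \<Rightarrow> z - x - w | VW \<Rightarrow> w)" for v
  have subst_minus: "subst_poly s (p - q) = subst_poly s p - subst_poly s q" for s and p q :: "'k poly4"
    using subst_poly_add[of s "p - q" q] by (simp add: algebra_simps)
  have "subst_poly \<sigma> (\<tau> v) = Var v" "subst_poly \<tau> (\<sigma> v) = Var v" for v
    by (cases v; simp add: \<sigma>_def \<tau>_def defs subst_poly_add subst_minus)+
  then have inverse: "subst_poly \<sigma> (subst_poly \<tau> p) = p" "subst_poly \<tau> (subst_poly \<sigma> p) = p" for p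
    by (simp_all add: subst_poly_inverse)
  have Var_m: "Var v \<in> \<mm>" for v
    unfolding m Var_def by (rule single_in_weight_ideal) (simp add: weight_single)
  have minus_m: "p - q \<in> \<mm>" if "p \<in> \<mm>" "q \<in> \<mm>" for p q
    using that unfolding m weight_ideal_UNIV by (simp add: lookup_minus)
  have \<sigma>\<tau>: "\<sigma> v \<in> weight_ideal UNIV 1" "\<tau> v \<in> weight_ideal UNIV 1" for v
    using Var_m minus_m unfolding m
    by (cases v; simp add: \<sigma>_def \<tau>_def defs weight_ideal_add del: One_nat_def)+
  have origin: "subst_poly \<sigma> p \<in> \<mm> \<longleftrightarrow> p \<in> \<mm>" "subst_poly \<tau> p \<in> \<mm> \<longleftrightarrow> p \<in> \<mm>" for p
    using subst_poly_origin[of \<sigma>, OF \<sigma>\<tau>(1)] subst_poly_origin[of \<tau>, OF \<sigma>\<tau>(2)] inverse unfolding m by metis+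
  have mem_m: "p \<in> \<mm> \<longleftrightarrow> lookup p 0 = 0" for p
    unfolding m by (rule weight_ideal_UNIV)
  define \<eta> where "\<eta> p = \<iota> (subst_poly \<sigma> p)" for p
  have carrier_S: "carrier S = UNIV" by (simp add: defs(1))
  interpret local_poly_ring R \<eta>
  proof (intro local_poly_ring.intro local_poly_ring_axioms.intro cR)
    show "ring_hom_ring type_ring R \<eta>"
      unfolding defs(1)[symmetric]
    proof (rule ring_hom_ringI[OF S.ring_axioms cring.axioms(1)[OF cR]])
      show "\<eta> (p \<otimes>\<^bsub>S\<^esub> q) = \<eta> p \<otimes>\<^bsub>R\<^esub> \<eta> q" for p q
        using \<iota>.hom_mult[of "subst_poly \<sigma> p" "subst_poly \<sigma> q"]
        by (simp add: \<eta>_def defs(1) subst_poly_mult)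
      show "\<eta> (p \<oplus>\<^bsub>S\<^esub> q) = \<eta> p \<oplus>\<^bsub>R\<^esub> \<eta> q" for p q
        using \<iota>.hom_add[of "subst_poly \<sigma> p" "subst_poly \<sigma> q"]
        by (simp add: \<eta>_def defs(1) subst_poly_add)
      show "\<eta> \<one>\<^bsub>S\<^esub> = \<one>\<^bsub>R\<^esub>" using \<iota>.hom_one by (simp add: \<eta>_def defs(1))
    qed (use \<iota>.hom_closed in \<open>simp add: \<eta>_def carrier_S\<close>)
    show "p = q" if "\<eta> p = \<eta> q" for p q
    proof -
      have "subst_poly \<sigma> p = subst_poly \<sigma> q"
        using that L.\<iota>_inj unfolding \<eta>_def \<iota>_def carrier_S by blast
      then show ?thesis using inverse(2) by metis
    qed
    show "\<eta> s \<in> Units R" if "lookup s 0 \<noteq> 0" for s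
      using that origin(1)[of s] mem_m[of s] L.\<iota>_unit[of "subst_poly \<sigma> s"]
      unfolding \<eta>_def \<iota>_def R carrier_S by simp
    show "\<exists>p s. lookup s 0 \<noteq> 0 \<and> \<eta> s \<otimes>\<^bsub>R\<^esub> r = \<eta> p" if "r \<in> carrier R" for r
    proof -
      obtain a s where "s \<notin> \<mm>" "\<iota> s \<otimes>\<^bsub>R\<^esub> r = \<iota> a"
        using L.\<iota>_frac[of r] \<open>r \<in> carrier R\<close> unfolding R \<iota>_def by blast
      then show ?thesis
        using origin(2)[of s] mem_m inverse(1)
        by (intro exI[of _ "subst_poly \<tau> a"] exI[of _ "subst_poly \<tau> s"]) (simp add: \<eta>_def)
    qed
  qed
  define a where "a = local_poly_ring.\<aa> R \<eta>"
  have a: "ideal a R" unfolding a_def by (rule \<aa>_ideal)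
  note partials = partial_derivs_f[OF defs(2-5) assms(7)]
  have jac: "\<JJ> = Idl\<^bsub>S\<^esub> (range (\<lambda>v. partial_deriv v f))"
    unfolding assms(8) jacobian_ideal_def defs(1) ..
  have rangeS: "range (\<lambda>v. partial_deriv v f) \<subseteq> carrier S" by (simp add: carrier_S)
  have J: "ideal \<JJ> S" unfolding jac by (rule S.genideal_ideal[OF rangeS])
  have dJ: "partial_deriv v f \<in> \<JJ>" for v
    unfolding jac using S.genideal_self[OF rangeS] by blast
  have addJ: "p + q \<in> \<JJ>" "p - q \<in> \<JJ>" if "p \<in> \<JJ>" "q \<in> \<JJ>" for p q
  proof -
    have "p + q \<in> \<JJ>" if "p \<in> \<JJ>" "q \<in> \<JJ>" for p q using ideal_add[OF J that] by (simp add: defs(1))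
    moreover have "- q \<in> \<JJ>" using ideal.I_l_closed[OF J that(2), of "- 1"] by (simp add: defs(1))
    ultimately show "p + q \<in> \<JJ>" "p - q \<in> \<JJ>" using that by (auto simp: diff_conv_add_uminus simp del: add_uminus_conv_diff)
  qed
  have \<eta>_products: "\<eta> (Var VW * Var VX) = \<iota> (w * (x + y))" "\<eta> (Var VW * Var VZ) = \<iota> (w * (x + y + z + w))"
    "\<eta> (Var VX * Var VZ) = \<iota> ((x + y) * (x + y + z + w))"
    unfolding \<eta>_def subst_poly_mult subst_poly_Var by (simp_all add: \<sigma>_def)
  have "\<aa> = a"
  proof (rule subset_antisym)
    have gens: "\<iota> (w * (x + y)) \<in> a" "\<iota> (w * (x + y + z + w)) \<in> a" "\<iota> ((x + y) * (x + y + z + w)) \<in> a"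
      unfolding \<eta>_products[symmetric] a_def by (rule gen_in_\<aa>; simp)+
    have \<iota>_add: "\<iota> (p + q) = \<iota> p \<oplus>\<^bsub>R\<^esub> \<iota> q" for p q
      using \<iota>.hom_add[of p q] by (simp add: defs(1))
    have "\<iota> (partial_deriv v f) \<in> a" for v
      by (cases v) (simp_all only: partials \<iota>_add gens ideal_add[OF a])
    then have "\<JJ> \<subseteq> {p \<in> carrier S. \<iota> p \<in> a}"
      unfolding jac by (intro S.genideal_minimal \<iota>.ideal_vimage[OF a]) (auto simp: carrier_S)
    then show "\<aa> \<subseteq> a"
      unfolding assms(11) extend_to_localization_at_def \<iota>_def[symmetric] R[symmetric]
      by (intro ring.genideal_minimal[OF rR a]) blast
    have sub: "\<iota> ` \<JJ> \<subseteq> \<aa>"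
      unfolding assms(11) extend_to_localization_at_def \<iota>_def[symmetric] R[symmetric]
      by (rule ring.genideal_self[OF rR]) (use \<iota>.hom_closed carrier_S in auto)
    have aid: "ideal \<aa> R"
      unfolding assms(11) extend_to_localization_at_def \<iota>_def[symmetric] R[symmetric]
      by (rule ring.genideal_ideal[OF rR]) (use \<iota>.hom_closed carrier_S in auto)
    have wv: "w * (x + y) \<in> \<JJ>" using dJ[of VZ] by (simp only: partials)
    have "w * (x + y + z + w) + w * (x + y) \<in> \<JJ>" using dJ[of VX] by (simp only: partials)
    from addJ(2)[OF this wv] have wc: "w * (x + y + z + w) \<in> \<JJ>" by simp
    have "(x + y) * (x + y + z + w) + w * (x + y) \<in> \<JJ>" using dJ[of VW] by (simp only: partials)
    from addJ(2)[OF this wv] have vc: "(x + y) * (x + y + z + w) \<in> \<JJ>" by simp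
    have mem: "\<eta> (Var VW * Var VX) \<in> \<aa>" "\<eta> (Var VW * Var VZ) \<in> \<aa>" "\<eta> (Var VX * Var VZ) \<in> \<aa>"
      unfolding \<eta>_products using sub wv wc vc by blast+
    show "a \<subseteq> \<aa>"
      unfolding a_def
    proof (rule \<aa>_subset_ideal[OF aid])
      fix i j assume "i \<in> coords" "j \<in> coords" "i \<noteq> j"
      then have "Var i * Var j \<in> {Var VW * Var VX, Var VW * Var VZ, Var VX * Var VZ :: 'k poly4}"
        by (auto simp: mult.commute)
      then show "\<eta> (Var i * Var j) \<in> \<aa>" using mem by (elim insertE emptyE) simp_all
    qed
  qed
  then show ?thesis
    unfolding a_def
    using \<aa>_ideal ideal_height_\<aa> unmixed_\<aa> cohen_macaulay_symbolic_power
      noetherian_symbolic_rees_algebra set_theoretic_complete_intersection_\<aa> by simp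
qed

end
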